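(* Suppose Assumption (A1) holds and $T>0$ is fixed. Then $$\frac{RV_T^{\Delta,I}}{T}\longrightarrow Q\quad\text{in } L^2(\Omega,\mathcal L_2(H))\quad\text{as }\Delta\downarrow 0 .$$
   Context: Standing setting. $\mathcal D\subset\mathbb R^d$, $d\in\{1,2,3\}$, is a bounded domain with Lipschitz boundary and $H=L^2(\mathcal D)$ with inner product $\langle\cdot,\cdot\rangle$ and norm $\|\cdot\|$. For $u,v\in H$, $u\otimes v$ denotes the operator $w\mapsto\langle v,w\rangle u$, and $u^{\otimes 2}=u\otimes u$. $\mathcal L(H),\mathcal L_2(H),\mathcal L_1(H)$ denote the bounded, Hilbert–Schmidt and trace-class operators on $H$. $(\Omega,\mathcal A,(\mathcal F_t)_{t\ge0},P)$ is a complete probability space with a normal filtration, $Q$ is a symmetric nonnegative trace-class operator on $H$, and $W$ is an $(\mathcal F_t)$-$Q$-Wiener process in $H$. $A$ is a linear operator on $H$ such that $-A$ generates a strongly continuous semigroup $(S(t))_{t\ge0}$; put $E(t):=I-S(t)$. $X_0$ is an $\mathcal F_0$-measurable $H$-valued random variable and $X$ is the mild solution of $dX_t+AX_t\,dt=dW_t$, i.e. $X_t=S(t)X_0+Y_t$ with $Y_t:=\int_0^tS(t-s)\,dW_s$. For $\Delta>0$, $T>0$ and a linear (observation) operator $O$, the realized covariation is $RV_T^{\Delta,O}:=\sum_{i=1}^{\lfloor T/\Delta\rfloor}(OX_{i\Delta}-OX_{(i-1)\Delta})^{\otimes2}$; $I$ is the identity. Assumption (A1): $A$ is closed, densely defined,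 self-adjoint, positive definite on $H$ and has a compact inverse; $Q$ is trace class; $X_0\in L^4(\Omega,H)$. *)

theory Defs
  imports "HOL-Probability.Probability"
begin

definition outer :: "'h::real_inner \<Rightarrow> 'h \<Rightarrow> 'h \<Rightarrow> 'h" where
  "outer u v = (\<lambda>w. inner v w *\<^sub>R u)"

definition orthonormal_family :: "nat \<Rightarrow> (nat \<Rightarrow> 'h::real_inner) \<Rightarrow> bool" where
  "orthonormal_family n e \<longleftrightarrow>
     (\<forall>i<n. norm (e i) = 1) \<and> (\<forall>i<n. \<forall>j<n. i \<noteq> j \<longrightarrow> inner (e i) (e j) = 0)"

text \<open>Squared Hilbert--Schmidt norm: sum over an orthonormal basis of |T e|^2, written
  as the supremum over finite orthonormal families (value infinity if T is not Hilbert--Schmidt).\<close>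
definition hs_norm_sq :: "('h::real_inner \<Rightarrow> 'h) \<Rightarrow> ennreal" where
  "hs_norm_sq T = (SUP (n, e) \<in> {(n, e). orthonormal_family n e}.
                     ennreal (\<Sum>i<n. (norm (T (e i)))\<^sup>2))"

text \<open>Trace class: bounded linear with finite trace norm
  sup { sum_i |<T e_i, f_i>| : (e_i), (f_i) finite orthonormal families }.\<close>
definition trace_class :: "('h::real_inner \<Rightarrow> 'h) \<Rightarrow> bool" where
  "trace_class T \<longleftrightarrow> bounded_linear T \<and>
     (\<exists>C. \<forall>n e f. orthonormal_family n e \<longrightarrow> orthonormal_family n f \<longrightarrow>
          (\<Sum>i<n. \<bar>inner (T (e i)) (f i)\<bar>) \<le> C)"

definition linear_op :: "'h::real_vector set \<Rightarrow> ('h \<Rightarrow> 'h) \<Rightarrow> bool" where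
  "linear_op D A \<longleftrightarrow> subspace D \<and>
     (\<forall>x\<in>D. \<forall>y\<in>D. A (x + y) = A x + A y) \<and> (\<forall>c. \<forall>x\<in>D. A (c *\<^sub>R x) = c *\<^sub>R A x)"

definition closed_op :: "'h::real_normed_vector set \<Rightarrow> ('h \<Rightarrow> 'h) \<Rightarrow> bool" where
  "closed_op D A \<longleftrightarrow> closed {(x, A x) | x. x \<in> D}"

definition densely_defined :: "'h::real_normed_vector set \<Rightarrow> bool" where
  "densely_defined D \<longleftrightarrow> closure D = UNIV"

definition adjoint_domain :: "'h::real_inner set \<Rightarrow> ('h \<Rightarrow> 'h) \<Rightarrow> 'h set" where
  "adjoint_domain D A = {y. \<exists>z. \<forall>x\<in>D. inner (A x) y = inner x z}"

definition self_adjoint_op :: "'h::real_inner set \<Rightarrow> ('h \<Rightarrow> 'h) \<Rightarrow> bool" where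
  "self_adjoint_op D A \<longleftrightarrow> adjoint_domain D A = D \<and>
     (\<forall>x\<in>D. \<forall>y\<in>D. inner (A x) y = inner x (A y))"

definition positive_definite_op :: "'h::real_inner set \<Rightarrow> ('h \<Rightarrow> 'h) \<Rightarrow> bool" where
  "positive_definite_op D A \<longleftrightarrow> (\<forall>x\<in>D. x \<noteq> 0 \<longrightarrow> inner (A x) x > 0)"

definition compact_operator :: "('h::real_normed_vector \<Rightarrow> 'h) \<Rightarrow> bool" where
  "compact_operator K \<longleftrightarrow> (\<forall>B. bounded B \<longrightarrow> compact (closure (K ` B)))"

definition has_compact_inverse :: "'h::real_normed_vector set \<Rightarrow> ('h \<Rightarrow> 'h) \<Rightarrow> bool" where
  "has_compact_inverse D A \<longleftrightarrow> bij_betw A D UNIV \<and> compact_operator (the_inv_into D A)"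

definition neg_generates_C0_semigroup ::
    "'h::real_normed_vector set \<Rightarrow> ('h \<Rightarrow> 'h) \<Rightarrow> (real \<Rightarrow> 'h \<Rightarrow> 'h) \<Rightarrow> bool" where
  "neg_generates_C0_semigroup D A S \<longleftrightarrow>
     (\<forall>t\<ge>0. bounded_linear (S t)) \<and> S 0 = id \<and>
     (\<forall>s\<ge>0. \<forall>t\<ge>0. S (s + t) = S s \<circ> S t) \<and>
     (\<forall>x. ((\<lambda>t. S t x) \<longlongrightarrow> x) (at_right 0)) \<and>
     (\<forall>x. x \<in> D \<longleftrightarrow> (\<exists>y. ((\<lambda>h. inverse h *\<^sub>R (S h x - x)) \<longlongrightarrow> y) (at_right 0))) \<and>
     (\<forall>x\<in>D. ((\<lambda>h. inverse h *\<^sub>R (S h x - x)) \<longlongrightarrow> - A x) (at_right 0))"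

definition complete_prob_space :: "'w measure \<Rightarrow> bool" where
  "complete_prob_space M \<longleftrightarrow> prob_space M \<and>
     (\<forall>N\<in>null_sets M. \<forall>B. B \<subseteq> N \<longrightarrow> B \<in> sets M)"

definition normal_filtration :: "'w measure \<Rightarrow> (real \<Rightarrow> 'w set set) \<Rightarrow> bool" where
  "normal_filtration M F \<longleftrightarrow>
     (\<forall>t\<ge>0. sigma_algebra (space M) (F t) \<and> F t \<subseteq> sets M) \<and>
     (\<forall>s t. 0 \<le> s \<longrightarrow> s \<le> t \<longrightarrow> F s \<subseteq> F t) \<and>
     (\<forall>t\<ge>0. F t = (\<Inter>s\<in>{t<..}. F s)) \<and>
     null_sets M \<subseteq> F 0"

definition measurable_wrt :: "'w measure \<Rightarrow> 'w set set \<Rightarrow> ('w \<Rightarrow> 'b::topological_space) \<Rightarrow> bool" where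
  "measurable_wrt M G Z \<longleftrightarrow> (\<forall>B\<in>sets borel. Z -` B \<inter> space M \<in> G)"

definition centred_gaussian :: "'w measure \<Rightarrow> ('w \<Rightarrow> real) \<Rightarrow> real \<Rightarrow> bool" where
  "centred_gaussian M Z v \<longleftrightarrow> Z \<in> borel_measurable M \<and>
     distr M borel Z = (if v = 0 then return borel 0 else density lborel (normal_density 0 (sqrt v)))"

text \<open>(F_t)-Q-Wiener process in H (Da Prato--Zabczyk): W 0 = 0 and continuous paths a.s.,
  adapted, increments W t - W s independent of F s and Gaussian N(0,(t-s)Q), i.e.
  every <W t - W s, h> is centred Gaussian with variance (t-s)<Q h, h>.\<close>
definition Q_Wiener_process ::
    "'w measure \<Rightarrow> (real \<Rightarrow> 'w set set) \<Rightarrow> ('h::real_inner \<Rightarrow> 'h) \<Rightarrow> (real \<Rightarrow> 'w \<Rightarrow> 'h) \<Rightarrow> bool" where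
  "Q_Wiener_process M F Q W \<longleftrightarrow>
     (AE \<omega> in M. W 0 \<omega> = 0 \<and> continuous_on {0..} (\<lambda>t. W t \<omega>)) \<and>
     (\<forall>t\<ge>0. measurable_wrt M (F t) (W t)) \<and>
     (\<forall>s t. 0 \<le> s \<longrightarrow> s \<le> t \<longrightarrow>
        prob_space.indep_set M (F s)
          {(\<lambda>\<omega>. W t \<omega> - W s \<omega>) -` B \<inter> space M | B. B \<in> sets (borel :: 'h measure)} \<and>
        (\<forall>h. centred_gaussian M (\<lambda>\<omega>. inner (W t \<omega> - W s \<omega>) h) ((t - s) * inner (Q h) h)))"

text \<open>Stochastic convolution Y t = int_0^t S(t-s) dW_s (deterministic integrand), defined as the
  L^2(Omega,H)-limit of the Riemann--Ito sums over uniform partitions of [0,t].\<close>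
definition riemann_conv_sum :: "(real \<Rightarrow> 'h \<Rightarrow> 'h) \<Rightarrow> (real \<Rightarrow> 'w \<Rightarrow> 'h::real_vector) \<Rightarrow> nat \<Rightarrow> real \<Rightarrow> 'w \<Rightarrow> 'h" where
  "riemann_conv_sum S W n t \<omega> =
     (\<Sum>j<n. S (t - real j * t / real n) (W (real (Suc j) * t / real n) \<omega> - W (real j * t / real n) \<omega>))"

definition stochastic_convolution ::
    "'w measure \<Rightarrow> (real \<Rightarrow> 'h \<Rightarrow> 'h) \<Rightarrow> (real \<Rightarrow> 'w \<Rightarrow> 'h::real_normed_vector) \<Rightarrow> (real \<Rightarrow> 'w \<Rightarrow> 'h) \<Rightarrow> bool" where
  "stochastic_convolution M S W Y \<longleftrightarrow>
     (\<forall>t\<ge>0. Y t \<in> borel_measurable M \<and>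
        (\<lambda>n. \<integral>\<^sup>+\<omega>. ennreal ((norm (Y t \<omega> - riemann_conv_sum S W n t \<omega>))\<^sup>2) \<partial>M) \<longlonglongrightarrow> 0)"

definition realized_covariation ::
    "(real \<Rightarrow> 'w \<Rightarrow> 'h::real_inner) \<Rightarrow> ('h \<Rightarrow> 'h) \<Rightarrow> real \<Rightarrow> real \<Rightarrow> 'w \<Rightarrow> 'h \<Rightarrow> 'h" where
  "realized_covariation X Obs \<Delta> T \<omega> =
     (\<lambda>w. \<Sum>i\<in>{1..nat \<lfloor>T / \<Delta>\<rfloor>}.
        outer (Obs (X (real i * \<Delta>) \<omega>) - Obs (X ((real i - 1) * \<Delta>) \<omega>))
              (Obs (X (real i * \<Delta>) \<omega>) - Obs (X ((real i - 1) * \<Delta>) \<omega>)) w)"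

end

theory Submission
  imports Defs
begin

text \<open>
  Writing \<open>\<Delta>\<^sub>iX = \<Delta>\<^sub>iW + \<rho>\<^sub>i\<close>, the Gaussian part \<open>\<Sum>\<^sub>i (\<Delta>\<^sub>iW)\<^bsup>\<otimes>2\<^esup>\<close> is a sum of independent terms and obeys the law of
  large numbers, and all other terms are controlled by \<open>\<Sum>\<^sub>i |\<rho>\<^sub>i|\<^sup>2\<close>, which must vanish in \<open>L\<^sup>2\<close>.
  As \<open>S\<close> is a semigroup of symmetric contractions, \<open>|S(\<Delta>)y - y|\<^sup>2 \<le> |y|\<^sup>2 - |S(\<Delta>)y|\<^sup>2\<close>; hence
  \<open>\<psi>\<^sub>\<Delta>(x) = \<Sum>\<^sub>i |S((i+1)\<Delta>)x - S(i\<Delta>)x|\<^sup>2\<close> telescopes to at most \<open>|x|\<^sup>2\<close>, and since it vanishes as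
  \<open>\<Delta> \<rightarrow> 0\<close> on the dense domain of \<open>A\<close>, it does so everywhere. This settles the contribution of \<open>X\<^sub>0\<close>.
  The variance of a Wiener sum \<open>\<Sum>\<^sub>j B\<^sub>j(\<Delta>\<^sub>jW)\<close> is \<open>\<Sum>\<^sub>j |\<Delta>\<^sub>j| E|B\<^sub>jN|\<^sup>2\<close> with the single Gaussian vector \<open>N = W\<^sub>1 - W\<^sub>0\<close>,
  so the contribution of the stochastic convolution reduces to \<open>E \<psi>\<^sub>\<Delta>(N)\<close> and \<open>E|S(s)N - N|\<^sup>2\<close>, \<open>s \<le> \<Delta>\<close>, both
  of which vanish by dominated convergence. Fourth moments follow from the variances coordinatewise by
  Minkowski's inequality in \<open>L\<^sup>2\<close>.
\<close>

text \<open>A termwise bound would need |\<rho>_i|^2 = o(\<Delta>), but nothing places X_0 or the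
  range of Q in the domain of A, so no single orbit increment need be that small. Only the sum along
  the grid is controlled, and without a rate. The convolution's share of \<rho>_i is formally the
  integral of S((i+1)\<Delta> - s) - S(i\<Delta> - s) over [0, i\<Delta>] plus that of
  S((i+1)\<Delta> - s) - I over the last block. The variance of the first integral is at most
  \<Delta> times a mean orbit variation, so summing over i costs only a factor T. Y is given merely
  as a limit of Riemann sums: the moment bounds are proved for those sums, uniformly in the mesh,
  and pass to Y by Fatou. The law of N enters only through scalar Gaussian moments: E|BN|^2 is the
  trace of BQB, and E Z^4 = 3 (E Z^2)^2 is the origin of the factor 3 in the moment bounds.
  Integrals are taken in \<open>ennreal\<close>, where nonnegative series and integrals can be
  exchanged freely.\<close>

section \<open>Symmetric contraction semigroups\<close>

text \<open>Since 2 L v = L (x + v) - L (x - v), one of x + v and x - v has an image at least as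
  large as L v, wherever the centre x lies. It remains to scale a vector on which L nearly attains
  its norm to length r. The factor 2/3 is a fixed loss below 1 that still exceeds the 1/2 lost when
  passing to the limit in the gliding hump.\<close>

lemma bounded_linear_large_value:
  fixes L :: "'a::real_normed_vector \<Rightarrow> 'b::real_normed_vector"
  assumes L: "bounded_linear L" and r: "r > 0"
  shows "\<exists>y. dist y x \<le> r \<and> norm (L y) \<ge> 2 / 3 * r * onorm L"
proof (cases "onorm L = 0")
  case True
  then show ?thesis using r by (intro exI[of _ x]) auto
next
  case False
  then have pos: "onorm L > 0" using onorm_pos_le[OF L] by simp
  then have "\<not> (\<forall>u. norm (L u) \<le> (2 / 3 * onorm L) * norm u)"
    using onorm_bound[of "2 / 3 * onorm L" L] by auto
  then obtain u where u: "norm (L u) > (2 / 3 * onorm L) * norm u" by (meson not_le)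
  then have "u \<noteq> 0" using bounded_linear.linear[OF L] by (auto simp: linear_0)
  then have un: "norm u > 0" by simp
  define v where "v = (r / norm u) *\<^sub>R u"
  have nv: "norm v = r" unfolding v_def using un r by simp
  have "L v = (r / norm u) *\<^sub>R L u"
    unfolding v_def by (simp add: bounded_linear.linear[OF L] linear_cmul)
  then have "norm (L v) = (r / norm u) * norm (L u)" using r un by simp
  also have "\<dots> \<ge> (r / norm u) * ((2 / 3 * onorm L) * norm u)"
    using u r un by (intro mult_left_mono) auto
  finally have Lv: "norm (L v) \<ge> 2 / 3 * r * onorm L" using un by simp
  have "2 *\<^sub>R L v = L (x + v) - L (x - v)"
    by (simp add: bounded_linear.linear[OF L] linear_add linear_diff scaleR_2)
  then have "2 * norm (L v) = norm (L (x + v) - L (x - v))"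
    by (metis abs_numeral norm_scaleR)
  also have "\<dots> \<le> norm (L (x + v)) + norm (L (x - v))" by (rule norm_triangle_ineq4)
  finally have "norm (L (x + v)) \<ge> norm (L v) \<or> norm (L (x - v)) \<ge> norm (L v)" by linarith
  then show ?thesis
  proof
    assume "norm (L (x + v)) \<ge> norm (L v)"
    then show ?thesis using Lv nv by (intro exI[of _ "x + v"]) (auto simp: dist_norm)
  next
    assume "norm (L (x - v)) \<ge> norm (L v)"
    then show ?thesis using Lv nv by (intro exI[of _ "x - v"]) (auto simp: dist_norm)
  qed
qed

text \<open>Sokal's gliding hump: no Baire category is needed.\<close>
lemma pointwise_bounded_imp_onorm_lt:
  fixes L :: "nat \<Rightarrow> 'a::{real_normed_vector, complete_space} \<Rightarrow> 'b::real_normed_vector"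
  assumes L: "\<And>n. bounded_linear (L n)" and bd: "\<And>x. \<exists>C. \<forall>n. norm (L n x) \<le> C"
  shows "\<exists>n. onorm (L n) < 4 ^ n"
proof (rule ccontr)
  assume "\<not> ?thesis"
  then have big: "onorm (L n) \<ge> 4 ^ n" for n by (simp add: not_less)
  have "\<exists>f. \<forall>n. True \<and> (dist (f (Suc n)) (f n) \<le> (1/3) ^ n
                \<and> norm (L n (f (Suc n))) \<ge> 2 / 3 * (1/3) ^ n * onorm (L n))"
    using bounded_linear_large_value[OF L]
    by (intro dependent_nat_choice) auto
  then obtain f where f: "\<And>n. dist (f (Suc n)) (f n) \<le> (1/3) ^ n"
    "\<And>n. norm (L n (f (Suc n))) \<ge> 2 / 3 * (1/3) ^ n * onorm (L n)" by blast
  have step: "dist (f (n + k)) (f n) \<le> 3 / 2 * (1/3) ^ n * (1 - (1/3) ^ k)" for n k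
  proof (induction k)
    case (Suc k)
    have "dist (f (n + Suc k)) (f n) \<le> dist (f (Suc (n + k))) (f (n + k)) + dist (f (n + k)) (f n)"
      by (simp add: dist_triangle)
    also have "\<dots> \<le> (1/3) ^ (n + k) + 3 / 2 * (1/3) ^ n * (1 - (1/3) ^ k)"
      using f(1) Suc.IH by (intro add_mono)
    also have "\<dots> = 3 / 2 * (1/3) ^ n * (1 - (1/3) ^ Suc k)"
      by (simp add: power_add field_simps)
    finally show ?case .
  qed simp
  have step': "dist (f m) (f n) \<le> 3 / 2 * (1/3) ^ n" if "m \<ge> n" for m n
  proof -
    have "dist (f m) (f n) \<le> 3 / 2 * (1/3) ^ n * (1 - (1/3) ^ (m - n))"
      using step[of n "m - n"] that by simp
    also have "\<dots> \<le> 3 / 2 * (1/3) ^ n * 1" by (intro mult_left_mono) auto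
    finally show ?thesis by simp
  qed
  have "Cauchy f"
  proof (rule metric_CauchyI)
    fix e :: real assume "e > 0"
    have "(\<lambda>n. 3 * (1/3::real) ^ n) \<longlonglongrightarrow> 3 * 0" by (intro tendsto_intros) auto
    then have "\<forall>\<^sub>F n in sequentially. 3 * (1/3::real) ^ n < e"
      by (rule order_tendstoD) (use \<open>e > 0\<close> in simp)
    then obtain N where N: "3 * (1/3::real) ^ N < e" by (auto simp: eventually_sequentially)
    show "\<exists>M. \<forall>m\<ge>M. \<forall>n\<ge>M. dist (f m) (f n) < e"
    proof (intro exI[of _ N] allI impI)
      fix m n assume "m \<ge> N" "n \<ge> N"
      then have "dist (f m) (f n) \<le> 3 / 2 * (1/3) ^ N + 3 / 2 * (1/3) ^ N"
        using dist_triangle2[of "f m" "f n" "f N"] step'[of N m] step'[of N n] by linarith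
      then show "dist (f m) (f n) < e" using N by simp
    qed
  qed
  then obtain x where x: "f \<longlonglongrightarrow> x" using Cauchy_convergent convergent_def by blast
  have dx: "dist x (f n) \<le> 3 / 2 * (1/3) ^ n" for n
  proof (rule tendsto_upperbound)
    show "(\<lambda>m. dist (f m) (f n)) \<longlonglongrightarrow> dist x (f n)" by (intro tendsto_intros x)
    show "\<forall>\<^sub>F m in sequentially. dist (f m) (f n) \<le> 3 / 2 * (1/3) ^ n"
      using step' by (auto simp: eventually_sequentially)
  qed auto
  \<comment> \<open>The n-th hump has size at least 2/3 (1/3)^n times the operator norm. Passing to
    the limit x costs at most 1/2 (1/3)^n times that norm, because \<open>dx\<close> is used at
    \<open>Suc n\<close>. One sixth is left, and against the assumed growth 4^n it is
    unbounded.\<close>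
  have low: "norm (L n x) \<ge> 1 / 6 * (4/3) ^ n" for n
  proof -
    have o: "onorm (L n) \<ge> 0" using onorm_pos_le[OF L] .
    have "norm (L n (f (Suc n))) \<le> norm (L n x) + norm (L n (f (Suc n) - x))"
      by (metis L add_diff_cancel_left' bounded_linear.linear linear_diff diff_add_cancel
          norm_triangle_ineq)
    moreover have "norm (L n (f (Suc n) - x)) \<le> onorm (L n) * (1/2 * (1/3) ^ n)"
    proof -
      have "norm (L n (f (Suc n) - x)) \<le> onorm (L n) * norm (f (Suc n) - x)"
        by (rule onorm[OF L])
      also have "\<dots> \<le> onorm (L n) * (1/2 * (1/3) ^ n)"
        using dx[of "Suc n"] o by (intro mult_left_mono) (auto simp: dist_norm norm_minus_commute)
      finally show ?thesis .
    qed
    ultimately have "norm (L n x) \<ge> (2/3 - 1/2) * (1/3) ^ n * onorm (L n)"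
      using f(2)[of n] by (simp add: algebra_simps)
    also have "(2/3 - 1/2) * (1/3) ^ n * onorm (L n) \<ge> (2/3 - 1/2) * (1/3) ^ n * 4 ^ n"
      using big by (intro mult_left_mono) auto
    finally show ?thesis by (simp add: power_divide field_simps)
  qed
  obtain C where C: "\<And>n. norm (L n x) \<le> C" using bd by blast
  obtain n where "6 * C < (4/3) ^ n" using real_arch_pow[of "4/3" "6 * C"] by auto
  then show False using low[of n] C[of n] by simp
qed

lemma norm_add_sq_le:
  fixes u v :: "'a::real_normed_vector"
  shows "(norm (u + v))\<^sup>2 \<le> 2 * (norm u)\<^sup>2 + 2 * (norm v)\<^sup>2"
proof -
  have "(norm (u + v))\<^sup>2 \<le> (norm u + norm v)\<^sup>2" by (intro power_mono norm_triangle_ineq) simp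
  also have "\<dots> \<le> 2 * (norm u)\<^sup>2 + 2 * (norm v)\<^sup>2"
    using zero_le_power2[of "norm u - norm v"] by (simp add: power2_eq_square algebra_simps)
  finally show ?thesis .
qed

section \<open>Orbits of a strongly continuous semigroup: local bounds, continuity,
  derivatives\<close>

locale symmetric_semigroup =
  fixes DA :: "'h::{real_inner, complete_space} set" and A :: "'h \<Rightarrow> 'h"
    and S :: "real \<Rightarrow> 'h \<Rightarrow> 'h"
  assumes dense_domain: "densely_defined DA"
    and symA: "\<And>x y. x \<in> DA \<Longrightarrow> y \<in> DA \<Longrightarrow> inner (A x) y = inner x (A y)"
    and posA: "\<And>x. x \<in> DA \<Longrightarrow> inner (A x) x \<ge> 0"
    and gen: "neg_generates_C0_semigroup DA A S"
begin

lemma S_bl: "t \<ge> 0 \<Longrightarrow> bounded_linear (S t)"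
  and S0 [simp]: "S 0 x = x"
  and S_add: "s \<ge> 0 \<Longrightarrow> t \<ge> 0 \<Longrightarrow> S (s + t) x = S s (S t x)"
  and S_tendsto_0: "((\<lambda>t. S t x) \<longlongrightarrow> x) (at_right 0)"
  and DA_iff: "x \<in> DA \<longleftrightarrow> (\<exists>y. ((\<lambda>h. inverse h *\<^sub>R (S h x - x)) \<longlongrightarrow> y) (at_right 0))"
  and S_deriv_0: "x \<in> DA \<Longrightarrow> ((\<lambda>h. inverse h *\<^sub>R (S h x - x)) \<longlongrightarrow> - A x) (at_right 0)"
  using gen unfolding neg_generates_C0_semigroup_def by (auto simp: fun_eq_iff)

lemmas S_lin = bounded_linear.linear[OF S_bl]

lemma S_diff: "t \<ge> 0 \<Longrightarrow> S t (x - y) = S t x - S t y"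
  using S_lin by (simp add: linear_diff)

lemma S_scaleR: "t \<ge> 0 \<Longrightarrow> S t (c *\<^sub>R x) = c *\<^sub>R S t x"
  using S_lin by (simp add: linear_cmul)

lemma S_commute: "s \<ge> 0 \<Longrightarrow> t \<ge> 0 \<Longrightarrow> S s (S t x) = S t (S s x)"
  by (metis S_add add.commute)

text \<open>Otherwise there are times t_n tending to 0 with operator norms above 4^n. Strong
  continuity at 0 makes every sequence S(t_n) x convergent, hence bounded, which the gliding hump
  forbids.\<close>

lemma bounded_near_0: "\<exists>\<delta>>0. \<exists>C\<ge>1. \<forall>t\<in>{0..\<delta>}. onorm (S t) \<le> C"
proof (rule ccontr)
  assume "\<not> ?thesis"
  then have no: "\<And>\<delta> C. \<delta> > 0 \<Longrightarrow> C \<ge> 1 \<Longrightarrow> \<exists>t\<in>{0..\<delta>}. onorm (S t) > C"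
    by (meson not_le)
  have "\<exists>t. 0 \<le> t \<and> t \<le> 1 / Suc n \<and> onorm (S t) > 4 ^ n" for n
    using no[of "1 / Suc n" "4 ^ n"] by auto
  then obtain t where t: "\<And>n. 0 \<le> t n" "\<And>n. t n \<le> 1 / Suc n" "\<And>n. onorm (S (t n)) > 4 ^ n"
    by metis
  have t0: "t \<longlonglongrightarrow> 0"
  proof (rule real_tendsto_sandwich[of "\<lambda>_. 0" _ _ "\<lambda>n. 1 / real (Suc n)"])
    show "(\<lambda>n. 1 / real (Suc n)) \<longlonglongrightarrow> 0" using LIMSEQ_inverse_real_of_nat
      by (simp add: inverse_eq_divide)
  qed (use t in auto)
  have conv: "((\<lambda>n. S (t n) x) \<longlonglongrightarrow> x)" for x
  proof -
    have "((\<lambda>t. S t x) \<longlongrightarrow> S 0 x) (at 0 within {0..})"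
      using S_tendsto_0[of x] by (simp add: at_within_Ici_at_right)
    then have "continuous (at 0 within {0..}) (\<lambda>t. S t x)"
      by (simp add: continuous_within)
    from continuous_within_tendsto_compose'[OF this _ t0] t(1) show ?thesis by simp
  qed
  have "\<exists>C. \<forall>n. norm (S (t n) x) \<le> C" for x
    using convergent_imp_bounded[OF conv[of x]] by (auto simp: bounded_iff)
  then have "\<exists>n. onorm (S (t n)) < 4 ^ n"
    using t(1) S_bl by (intro pointwise_bounded_imp_onorm_lt) auto
  then show False using t(3) by (meson not_less_iff_gr_or_eq)
qed

text \<open>The semigroup law carries the bound near 0 forward in steps of length \<delta>,
  multiplying the constant by C each time. It stands in for contractivity, whose proof needs left
  limits of orbits and hence a bound that is uniform on compact time intervals.\<close>

lemma locally_bounded: "\<exists>C\<ge>1. \<forall>t\<in>{0..\<tau>}. \<forall>x. norm (S t x) \<le> C * norm x"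
proof -
  obtain \<delta> C where \<delta>: "\<delta> > 0" and C: "C \<ge> 1" and
    b: "\<And>t. t \<in> {0..\<delta>} \<Longrightarrow> onorm (S t) \<le> C" using bounded_near_0 by blast
  have b': "norm (S t x) \<le> C * norm x" if "t \<in> {0..\<delta>}" for t x
    using onorm[OF S_bl, of t x] b[OF that] that
    by (meson atLeastAtMost_iff mult_right_mono norm_ge_zero order_trans)
  have "\<exists>C\<ge>1. \<forall>t\<in>{0..n * \<delta>}. \<forall>x. norm (S t x) \<le> C * norm x" for n :: nat
  proof (induction n)
    case 0 show ?case by (auto intro: exI[of _ 1])
  next
    case (Suc n)
    then obtain C' where C': "C' \<ge> 1" "\<And>t x. t \<in> {0..n * \<delta>} \<Longrightarrow> norm (S t x) \<le> C' * norm x"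
      by blast
    have "norm (S t x) \<le> (C * C') * norm x" if t: "t \<in> {0..Suc n * \<delta>}" for t x
    proof (cases "t \<le> n * \<delta>")
      case True
      then have "norm (S t x) \<le> 1 * (C' * norm x)" using C' t by auto
      also have "\<dots> \<le> C * (C' * norm x)" using C C' by (intro mult_right_mono) auto
      finally show ?thesis by (simp add: mult.assoc)
    next
      case False
      then have "S t x = S (t - n * \<delta>) (S (n * \<delta>) x)"
        using S_add[of "t - n * \<delta>" "n * \<delta>" x] \<delta> by simp
      moreover have "norm (S (t - n * \<delta>) (S (n * \<delta>) x)) \<le> C * norm (S (n * \<delta>) x)"
        using t False by (intro b') (auto simp: algebra_simps)
      moreover have "\<dots> \<le> C * (C' * norm x)"
        using C'(2)[of "n * \<delta>"] \<delta> C by (intro mult_left_mono) auto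
      ultimately show ?thesis by (simp add: mult.assoc)
    qed
    moreover have "C * C' \<ge> 1" using C C' mult_mono[of 1 C 1 C'] by simp
    ultimately show ?case by blast
  qed
  then obtain bd: "\<And>n::nat. \<exists>C\<ge>1. \<forall>t\<in>{0..n * \<delta>}. \<forall>x. norm (S t x) \<le> C * norm x" by blast
  obtain n :: nat where n: "\<tau> \<le> n * \<delta>"
    using reals_Archimedean3[OF \<delta>] by (meson less_imp_le)
  then have "{0..\<tau>} \<subseteq> {0..n * \<delta>}" by auto
  with bd[of n] show ?thesis by blast
qed

text \<open>S t commutes with S h, so the difference quotient of the orbit of S t x at 0 is the
  image under S t of the convergent quotient for x.\<close>

lemma S_DA:
  assumes t: "t \<ge> 0" and x: "x \<in> DA"
  shows "S t x \<in> DA" and "A (S t x) = S t (A x)"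
proof -
  have "((\<lambda>h. S t (inverse h *\<^sub>R (S h x - x))) \<longlongrightarrow> S t (- A x)) (at_right 0)"
    by (rule bounded_linear.tendsto[OF S_bl[OF t] S_deriv_0[OF x]])
  moreover have "\<forall>\<^sub>F h in at_right 0. S t (inverse h *\<^sub>R (S h x - x)) = inverse h *\<^sub>R (S h (S t x) - S t x)"
    using eventually_at_right_less[of 0]
    by eventually_elim (simp add: S_scaleR S_diff t S_commute)
  ultimately have lim: "((\<lambda>h. inverse h *\<^sub>R (S h (S t x) - S t x)) \<longlongrightarrow> S t (- A x)) (at_right 0)"
    using tendsto_cong by fast
  then show 1: "S t x \<in> DA" using DA_iff by blast
  have "S t (- A x) = - A (S t x)"
    using tendsto_unique[OF _ lim S_deriv_0[OF 1]] by simp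
  then show "A (S t x) = S t (A x)" using S_lin[OF t] by (simp add: linear_neg)
qed

text \<open>Here the operator S (t - h) itself moves with h. Writing the difference as S (t - h) (x
  - S h x) reduces it to strong continuity at 0, and the local bound absorbs the moving
  operator.\<close>

lemma S_tendsto_left:
  assumes t: "t > 0" shows "((\<lambda>h. S (t - h) x) \<longlongrightarrow> S t x) (at_right 0)"
proof -
  obtain C where C: "C \<ge> 1" "\<And>s x. s \<in> {0..t} \<Longrightarrow> norm (S s x) \<le> C * norm x"
    using locally_bounded by blast
  have "((\<lambda>h. S (t - h) x - S t x) \<longlongrightarrow> 0) (at_right 0)"
  proof (rule Lim_null_comparison)
    show "\<forall>\<^sub>F h in at_right 0. norm (S (t - h) x - S t x) \<le> C * norm (S h x - x)"
      using eventually_at_right_real[OF t]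
    proof eventually_elim
      case (elim h)
      then have "S t x = S (t - h) (S h x)" using S_add[of "t - h" h x] by simp
      then have "norm (S (t - h) x - S t x) = norm (S (t - h) (x - S h x))"
        using elim by (simp add: S_diff)
      also have "\<dots> \<le> C * norm (x - S h x)" using elim by (intro C) auto
      finally show ?case by (simp add: norm_minus_commute)
    qed
    have "((\<lambda>h. C * norm (S h x - x)) \<longlongrightarrow> C * norm (x - x)) (at_right 0)"
      by (intro tendsto_intros S_tendsto_0)
    then show "((\<lambda>h. C * norm (S h x - x)) \<longlongrightarrow> 0) (at_right 0)" by simp
  qed
  then show ?thesis by (simp add: LIM_zero_iff)
qed

lemma S_tendsto_right:
  assumes t: "t \<ge> 0" shows "((\<lambda>h. S (t + h) x) \<longlongrightarrow> S t x) (at_right 0)"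
proof -
  have "((\<lambda>h. S t (S h x)) \<longlongrightarrow> S t x) (at_right 0)"
    by (rule bounded_linear.tendsto[OF S_bl[OF t] S_tendsto_0])
  moreover have "\<forall>\<^sub>F h in at_right 0. S t (S h x) = S (t + h) x"
    using eventually_at_right_less[of 0] by eventually_elim (simp add: S_add t)
  ultimately show ?thesis using tendsto_cong by fast
qed

lemma continuous_on_S: "continuous_on {0..} (\<lambda>t. S t x)"
  unfolding continuous_on_def
proof
  fix t :: real assume "t \<in> {0..}"
  then have t: "t \<ge> 0" by simp
  have r: "((\<lambda>s. S s x) \<longlongrightarrow> S t x) (at_right t)"
    using S_tendsto_right[OF t, of x] by (subst filterlim_at_right_to_0) (simp add: add.commute)
  show "((\<lambda>s. S s x) \<longlongrightarrow> S t x) (at t within {0..})"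
  proof (cases "t = 0")
    case True
    then show ?thesis using r by (simp add: at_within_Ici_at_right)
  next
    case False
    then have t: "t > 0" using t by simp
    have "((\<lambda>s. S s x) \<longlongrightarrow> S t x) (at_left t)"
      using S_tendsto_left[OF t, of x]
      by (simp add: filterlim_at_left_to_right filterlim_at_right_to_0[of _ _ "- t"])
    then have "((\<lambda>s. S s x) \<longlongrightarrow> S t x) (at t)" using r by (rule filterlim_split_at)
    then show ?thesis by (rule tendsto_within_subset) simp
  qed
qed

text \<open>The right quotient is the quotient at 0 of the orbit of S t x. The left quotient is S (t
  - h) applied to the quotient of x, a moving operator on a moving vector. Adding A x makes the
  vector tend to 0, so the local bound suffices, and the compensating S (t - h) (A x) converges by
  left continuity.\<close>

lemma S_has_vector_derivative:
  assumes t: "t > 0" and x: "x \<in> DA"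
  shows "((\<lambda>s. S s x) has_vector_derivative - A (S t x)) (at t)"
proof -
  define q where "q = (\<lambda>s. inverse (s - t) *\<^sub>R (S s x - S t x))"
  have AS: "A (S t x) = S t (A x)" using S_DA(2)[OF _ x] t by simp
  have "(q \<longlongrightarrow> - A (S t x)) (at_right t)"
    unfolding filterlim_at_right_to_0[of q]
  proof (rule Lim_transform_eventually)
    show "((\<lambda>h. inverse h *\<^sub>R (S h (S t x) - S t x)) \<longlongrightarrow> - A (S t x)) (at_right 0)"
      using S_DA(1)[OF _ x] t by (intro S_deriv_0) simp
    show "\<forall>\<^sub>F h in at_right 0. inverse h *\<^sub>R (S h (S t x) - S t x) = q (h + t)"
      using eventually_at_right_less[of 0] by eventually_elim (use t in \<open>simp add: q_def S_add\<close>)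
  qed
  moreover have "(q \<longlongrightarrow> - A (S t x)) (at_left t)"
    unfolding filterlim_at_left_to_right[of q] filterlim_at_right_to_0[of _ _ "- t"]
  proof (rule Lim_transform_eventually)
    obtain C where C: "C \<ge> 1" "\<And>s x. s \<in> {0..t} \<Longrightarrow> norm (S s x) \<le> C * norm x"
      using locally_bounded by blast
    have 1: "((\<lambda>h. S (t - h) (inverse h *\<^sub>R (S h x - x) + A x)) \<longlongrightarrow> 0) (at_right 0)"
    proof (rule Lim_null_comparison)
      show "\<forall>\<^sub>F h in at_right 0. norm (S (t - h) (inverse h *\<^sub>R (S h x - x) + A x))
              \<le> C * norm (inverse h *\<^sub>R (S h x - x) + A x)"
        using eventually_at_right_real[OF t] by eventually_elim (intro C, auto)
      have "((\<lambda>h. C * norm (inverse h *\<^sub>R (S h x - x) + A x)) \<longlongrightarrow> C * norm (- A x + A x)) (at_right 0)"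
        by (intro tendsto_intros S_deriv_0 x)
      then show "((\<lambda>h. C * norm (inverse h *\<^sub>R (S h x - x) + A x)) \<longlongrightarrow> 0) (at_right 0)" by simp
    qed
    have "((\<lambda>h. S (t - h) (inverse h *\<^sub>R (S h x - x) + A x) - S (t - h) (A x)) \<longlongrightarrow> 0 - S t (A x)) (at_right 0)"
      by (intro tendsto_intros 1 S_tendsto_left t)
    then show "((\<lambda>h. S (t - h) (inverse h *\<^sub>R (S h x - x) + A x) - S (t - h) (A x)) \<longlongrightarrow> - A (S t x)) (at_right 0)"
      by (simp add: AS)
    show "\<forall>\<^sub>F h in at_right 0. S (t - h) (inverse h *\<^sub>R (S h x - x) + A x) - S (t - h) (A x) = q (- (h + - t))"
      using eventually_at_right_real[OF t]
    proof eventually_elim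
      case (elim h)
      then have e: "S t x = S (t - h) (S h x)" using S_add[of "t - h" h x] by simp
      have "S (t - h) (inverse h *\<^sub>R (S h x - x) + A x) - S (t - h) (A x)
          = S (t - h) (inverse h *\<^sub>R (S h x - x) + A x - A x)"
        by (rule S_diff[symmetric]) (use elim in simp)
      also have "\<dots> = inverse h *\<^sub>R (S (t - h) (S h x) - S (t - h) x)"
        using elim by (simp add: S_scaleR S_diff)
      also have "\<dots> = q (- (h + - t))"
        unfolding q_def e[symmetric] by (simp add: scaleR_diff_right)
      finally show ?case .
    qed
  qed
  ultimately have lim: "(q \<longlongrightarrow> - A (S t x)) (at t)" by (rule filterlim_split_at[rotated])
  have "((\<lambda>s. norm (q s - - A (S t x))) \<longlongrightarrow> norm (- A (S t x) - - A (S t x))) (at t)"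
    by (intro tendsto_intros lim)
  then have "((\<lambda>s. norm (q s - - A (S t x))) \<longlongrightarrow> 0) (at t)" by simp
  moreover have "\<forall>\<^sub>F s in at t. norm (q s - - A (S t x))
      = norm ((S s x - S t x) - (s - t) *\<^sub>R - A (S t x)) / norm (s - t)"
    unfolding eventually_at_filter
  proof (intro always_eventually allI impI)
    fix s :: real assume "s \<noteq> t"
    then have "(S s x - S t x) - (s - t) *\<^sub>R - A (S t x) = (s - t) *\<^sub>R (q s - - A (S t x))"
      by (simp add: q_def scaleR_diff_right scaleR_add_right)
    then show "norm (q s - - A (S t x)) = norm ((S s x - S t x) - (s - t) *\<^sub>R - A (S t x)) / norm (s - t)"
      using \<open>s \<noteq> t\<close> by simp
  qed
  ultimately have "((\<lambda>s. norm ((S s x - S t x) - (s - t) *\<^sub>R - A (S t x)) / norm (s - t)) \<longlongrightarrow> 0) (at t)"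
    by (rule Lim_transform_eventually)
  then show ?thesis
    unfolding has_vector_derivative_def has_derivative_iff_norm
    using bounded_linear_scaleR_left by blast
qed

section \<open>Symmetry and contractivity of the semigroup\<close>

lemma dense_sequence: "\<exists>f. (\<forall>n. f n \<in> DA) \<and> f \<longlonglongrightarrow> x"
  using dense_domain closure_sequential[of x DA] by (auto simp: densely_defined_def)

lemma tendsto_S: "t \<ge> 0 \<Longrightarrow> (f \<longlongrightarrow> x) F \<Longrightarrow> ((\<lambda>n. S t (f n)) \<longlongrightarrow> S t x) F"
  by (rule bounded_linear.tendsto[OF S_bl])

text \<open>For x and y in the domain, s |-> <S s x, S (t - s) y> has derivative zero by the
  symmetry of A, and its values at s = t and s = 0 are the two sides. Density and the boundedness of
  S t do the rest.\<close>

lemma S_symmetric: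
  assumes t: "t \<ge> 0" shows "inner (S t x) y = inner x (S t y)"
proof (cases "t = 0")
  case False
  then have t: "t > 0" using t by simp
  have main: "inner (S t x) y = inner x (S t y)" if x: "x \<in> DA" and y: "y \<in> DA" for x y
  proof -
    define f where "f s = inner (S s x) (S (t - s) y)" for s
    have "f t = f 0"
    proof (rule DERIV_isconst_end[OF t])
      have "continuous_on {0..t} (\<lambda>s. S s x)"
        by (rule continuous_on_subset[OF continuous_on_S]) auto
      moreover have "continuous_on {0..t} (\<lambda>s. S (t - s) y)"
        by (rule continuous_on_compose2[OF continuous_on_S]) (auto intro!: continuous_intros)
      ultimately show "continuous_on {0..t} f"
        unfolding f_def by (intro continuous_intros)
    next
      fix s assume s: "0 < s" "s < t"
      have "((\<lambda>s. S s x) has_vector_derivative - A (S s x)) (at s)"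
        using s x by (intro S_has_vector_derivative)
      moreover have "((\<lambda>s. S s y) \<circ> (\<lambda>s. t - s) has_vector_derivative ((- 1) *\<^sub>R - A (S (t - s) y))) (at s)"
        using s y by (intro vector_diff_chain_at S_has_vector_derivative)
          (auto intro!: derivative_eq_intros)
      ultimately have "(f has_vector_derivative
         (inner (S s x) (A (S (t - s) y)) + inner (- A (S s x)) (S (t - s) y))) (at s)"
        unfolding f_def using bounded_bilinear.has_vector_derivative[OF bounded_bilinear_inner]
        by (fastforce simp: o_def)
      moreover have "inner (A (S s x)) (S (t - s) y) = inner (S s x) (A (S (t - s) y))"
        using s x y by (intro symA S_DA) auto
      ultimately show "(f has_real_derivative 0) (at s)"
        by (simp add: has_real_derivative_iff_has_vector_derivative)
    qed
    then show ?thesis by (simp add: f_def)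
  qed
  obtain f g where f: "\<And>n. f n \<in> DA" "f \<longlonglongrightarrow> x" and g: "\<And>n. g n \<in> DA" "g \<longlonglongrightarrow> y"
    using dense_sequence by metis
  have "(\<lambda>n. inner (S t (f n)) (g n)) \<longlonglongrightarrow> inner (S t x) y"
    using t by (intro tendsto_intros tendsto_S f g) auto
  moreover have "(\<lambda>n. inner (f n) (S t (g n))) \<longlonglongrightarrow> inner x (S t y)"
    using t by (intro tendsto_intros tendsto_S f g) auto
  ultimately show ?thesis using main[OF f(1) g(1)] LIMSEQ_unique by simp
qed simp

text \<open>On the domain, |S s x|^2 has derivative -2 <A S s x, S s x>, which is not positive. The
  inequality survives limits along the dense domain.\<close>

lemma S_contraction:
  assumes t: "t \<ge> 0" shows "norm (S t x) \<le> norm x"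
proof -
  have main: "norm (S t x) \<le> norm x" if x: "x \<in> DA" for x
  proof -
    define f where "f s = inner (S s x) (S s x)" for s
    have "f 0 \<ge> f t"
    proof (rule DERIV_nonpos_imp_decreasing_open[OF t])
      have "continuous_on {0..t} (\<lambda>s. S s x)"
        by (rule continuous_on_subset[OF continuous_on_S]) auto
      then show "continuous_on {0..t} f"
        unfolding f_def by (intro continuous_intros)
    next
      fix s assume s: "0 < s" "s < t"
      have d: "((\<lambda>s. S s x) has_vector_derivative - A (S s x)) (at s)"
        using s x by (intro S_has_vector_derivative)
      then have "(f has_vector_derivative
         (inner (S s x) (- A (S s x)) + inner (- A (S s x)) (S s x))) (at s)"
        unfolding f_def by (intro bounded_bilinear.has_vector_derivative[OF bounded_bilinear_inner])
      moreover have "inner (A (S s x)) (S s x) \<ge> 0"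
        using s x by (intro posA S_DA) auto
      ultimately show "\<exists>y. (f has_real_derivative y) (at s) \<and> y \<le> 0"
        unfolding has_real_derivative_iff_has_vector_derivative
        by (intro exI conjI) (auto simp: inner_commute)
    qed
    then show ?thesis by (simp add: f_def norm_le)
  qed
  obtain f where f: "\<And>n. f n \<in> DA" "f \<longlonglongrightarrow> x" using dense_sequence by metis
  have "(\<lambda>n. norm (S t (f n))) \<longlonglongrightarrow> norm (S t x)" "(\<lambda>n. norm (f n)) \<longlonglongrightarrow> norm x"
    using t by (intro tendsto_intros tendsto_S f; simp)+
  then show ?thesis using main[OF f(1)] LIMSEQ_le by blast
qed

section \<open>Quadratic variation of semigroup orbits along a grid\<close>

text \<open>This is the functional \<psi> of the overview, cut off after \<open>n\<close> steps.
  Step length and number of steps are independent parameters; the horizon enters later as the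
  condition n \<Delta> \<le> T.\<close>

definition orbit_variation :: "real \<Rightarrow> nat \<Rightarrow> 'h \<Rightarrow> real" where
  "orbit_variation \<Delta> n x = (\<Sum>a<n. (norm (S (real (Suc a) * \<Delta>) x - S (real a * \<Delta>) x))\<^sup>2)"

lemma orbit_variation_nonneg: "orbit_variation \<Delta> n x \<ge> 0"
  by (simp add: orbit_variation_def sum_nonneg)

text \<open>Expanding the square, the claim becomes |S t x|^2 \<le> <S t x, x>. Symmetry and the
  semigroup law turn the right side into |S (t/2) x|^2, and a further half step is a contraction.
  This replaces a spectral argument for 0 \<le> S t \<le> I.\<close>

lemma norm_S_diff_sq_le:
  assumes t: "t \<ge> 0"
  shows "(norm (S t x - x))\<^sup>2 \<le> (norm x)\<^sup>2 - (norm (S t x))\<^sup>2"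
proof -
  have half: "S t x = S (t/2) (S (t/2) x)" using S_add[of "t/2" "t/2" x] t by simp
  then have "inner (S t x) x = (norm (S (t/2) x))\<^sup>2"
    using S_symmetric[of "t/2" "S (t/2) x" x] t by (simp add: power2_norm_eq_inner)
  moreover have "(norm (S t x))\<^sup>2 \<le> (norm (S (t/2) x))\<^sup>2"
    using S_contraction[of "t/2" "S (t/2) x"] half t by (intro power_mono) auto
  moreover have "(norm (S t x - x))\<^sup>2 = (norm (S t x))\<^sup>2 + (norm x)\<^sup>2 - 2 * inner (S t x) x"
    by (simp add: power2_norm_eq_inner inner_diff inner_commute)
  ultimately show ?thesis by linarith
qed

lemma orbit_variation_le:
  assumes D: "\<Delta> \<ge> 0" shows "orbit_variation \<Delta> n x \<le> (norm x)\<^sup>2"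
proof -
  have "orbit_variation \<Delta> n x \<le> (\<Sum>a<n. (norm (S (real a * \<Delta>) x))\<^sup>2 - (norm (S (real (Suc a) * \<Delta>) x))\<^sup>2)"
    unfolding orbit_variation_def
  proof (rule sum_mono)
    fix a
    have "S (real (Suc a) * \<Delta>) x = S \<Delta> (S (real a * \<Delta>) x)"
      using S_add[of \<Delta> "real a * \<Delta>" x] D by (simp add: algebra_simps)
    then show "(norm (S (real (Suc a) * \<Delta>) x - S (real a * \<Delta>) x))\<^sup>2
      \<le> (norm (S (real a * \<Delta>) x))\<^sup>2 - (norm (S (real (Suc a) * \<Delta>) x))\<^sup>2"
      using norm_S_diff_sq_le[OF D] by simp
  qed
  also have "\<dots> = (norm x)\<^sup>2 - (norm (S (real n * \<Delta>) x))\<^sup>2"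
    by (subst sum_lessThan_telescope') simp
  finally show ?thesis by (smt (verit) zero_le_power2)
qed

lemma orbit_variation_add_le:
  assumes "\<Delta> \<ge> 0"
  shows "orbit_variation \<Delta> n (x + y) \<le> 2 * orbit_variation \<Delta> n x + 2 * orbit_variation \<Delta> n y"
  unfolding orbit_variation_def sum_distrib_left sum.distrib[symmetric]
proof (rule sum_mono)
  fix a
  have "S (real (Suc a) * \<Delta>) (x + y) - S (real a * \<Delta>) (x + y)
     = (S (real (Suc a) * \<Delta>) x - S (real a * \<Delta>) x) + (S (real (Suc a) * \<Delta>) y - S (real a * \<Delta>) y)"
    using assms by (simp add: linear_add[OF S_lin] del: of_nat_Suc)
  then show "(norm (S (real (Suc a) * \<Delta>) (x + y) - S (real a * \<Delta>) (x + y)))\<^sup>2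
    \<le> 2 * (norm (S (real (Suc a) * \<Delta>) x - S (real a * \<Delta>) x))\<^sup>2
      + 2 * (norm (S (real (Suc a) * \<Delta>) y - S (real a * \<Delta>) y))\<^sup>2"
    using norm_add_sq_le by simp
qed

text \<open>On the domain every step is at most |S d x - x| by contractivity, and S d x - x = d w
  with w tending to -A x. The n terms therefore sum to at most T d |w|^2. For general x an
  approximant f N from the domain is fixed: \<open>orbit_variation_le\<close> bounds the
  contribution of x - f N uniformly in k.\<close>

lemma orbit_variation_tendsto_0:
  assumes d: "\<And>k. d k > 0" "d \<longlonglongrightarrow> 0" and n: "\<And>k. real (n k) * d k \<le> T"
  shows "(\<lambda>k. orbit_variation (d k) (n k) x) \<longlonglongrightarrow> 0"
proof -
  have T: "T \<ge> 0" using n[of 0] d(1)[of 0] by (smt (verit) mult_nonneg_nonneg of_nat_0_le_iff)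
  have dr: "filterlim d (at_right 0) sequentially"
    by (intro tendsto_imp_filterlim_at_right d(2)) (simp add: d(1))
  have DA: "(\<lambda>k. orbit_variation (d k) (n k) x) \<longlonglongrightarrow> 0" if x: "x \<in> DA" for x
  proof (rule real_tendsto_sandwich[of "\<lambda>_. 0"])
    define w where "w k = inverse (d k) *\<^sub>R (S (d k) x - x)" for k
    have "w \<longlonglongrightarrow> - A x"
      unfolding w_def by (rule filterlim_compose[OF S_deriv_0[OF x] dr])
    then have "(\<lambda>k. T * (d k * (norm (w k))\<^sup>2)) \<longlonglongrightarrow> T * (0 * (norm (- A x))\<^sup>2)"
      by (intro tendsto_intros d)
    then show "(\<lambda>k. T * (d k * (norm (w k))\<^sup>2)) \<longlonglongrightarrow> 0" by simp
    show "\<forall>\<^sub>F k in sequentially. orbit_variation (d k) (n k) x \<le> T * (d k * (norm (w k))\<^sup>2)"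
    proof (rule always_eventually, rule allI)
      fix k
      have dk: "S (d k) x - x = d k *\<^sub>R w k" unfolding w_def using d(1)[of k] by simp
      have "orbit_variation (d k) (n k) x \<le> (\<Sum>a<n k. (norm (S (d k) x - x))\<^sup>2)"
        unfolding orbit_variation_def
      proof (intro sum_mono power_mono)
        fix a
        have "S (real (Suc a) * d k) x = S (real a * d k) (S (d k) x)"
          using S_add[of "real a * d k" "d k" x] d(1)[of k] by (simp add: algebra_simps)
        then show "norm (S (real (Suc a) * d k) x - S (real a * d k) x) \<le> norm (S (d k) x - x)"
          using S_contraction[of "real a * d k" "S (d k) x - x"] d(1)[of k] by (simp add: S_diff)
      qed auto
      also have "\<dots> = (real (n k) * d k) * (d k * (norm (w k))\<^sup>2)"
        unfolding dk using d(1)[of k] by (simp add: power_mult_distrib power2_eq_square)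
      also have "\<dots> \<le> T * (d k * (norm (w k))\<^sup>2)"
        using n d(1)[of k] by (intro mult_right_mono) auto
      finally show "orbit_variation (d k) (n k) x \<le> T * (d k * (norm (w k))\<^sup>2)" .
    qed
  qed (auto simp: orbit_variation_nonneg)
  show ?thesis
  proof (rule LIMSEQ_I)
    fix e :: real assume e: "e > 0"
    obtain f where f: "\<And>n. f n \<in> DA" "f \<longlonglongrightarrow> x" using dense_sequence by metis
    have "(\<lambda>n. 2 * (norm (x - f n))\<^sup>2) \<longlonglongrightarrow> 2 * (norm (x - x))\<^sup>2" by (intro tendsto_intros f)
    then have "\<forall>\<^sub>F n in sequentially. 2 * (norm (x - f n))\<^sup>2 < e / 2"
      by (rule order_tendstoD) (use e in simp)
    then obtain N where N: "2 * (norm (x - f N))\<^sup>2 < e / 2"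
      using eventually_happens by force
    have "\<forall>\<^sub>F k in sequentially. orbit_variation (d k) (n k) (f N) < e / 4"
      by (rule order_tendstoD(2)[OF DA[OF f(1)]]) (use e in simp)
    then obtain K where K: "\<And>k. k \<ge> K \<Longrightarrow> orbit_variation (d k) (n k) (f N) < e / 4"
      by (auto simp: eventually_sequentially)
    have "orbit_variation (d k) (n k) x < e" if "k \<ge> K" for k
      using orbit_variation_add_le[of "d k" "n k" "f N" "x - f N"]
        orbit_variation_le[of "d k" "n k" "x - f N"] K[OF that] N d(1)[of k] by simp
    then show "\<exists>K. \<forall>k\<ge>K. norm (orbit_variation (d k) (n k) x - 0) < e"
      using orbit_variation_nonneg by auto
  qed
qed

text \<open>Grouping the fine grid \<open>l\<Delta>/m\<close> into \<open>i\<close> blocks of length \<open>\<Delta>\<close>, each term of block \<open>a\<close>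
  is dominated by the \<open>a\<close>-th term of the orbit variation.\<close>
lemma refined_variation_le:
  assumes D: "\<Delta> \<ge> 0" and m: "m > 0"
  shows "(\<Sum>l<i * m. (norm (S (\<Delta> + real (Suc l) * \<Delta> / real m) x - S (real (Suc l) * \<Delta> / real m) x))\<^sup>2)
           \<le> real m * orbit_variation \<Delta> i x"
proof -
  have "(norm (S (\<Delta> + real (Suc l) * \<Delta> / real m) x - S (real (Suc l) * \<Delta> / real m) x))\<^sup>2
     \<le> (norm (S (real (Suc a) * \<Delta>) x - S (real a * \<Delta>) x))\<^sup>2"
    if "l \<in> {a * m..<a * m + m}" for l a
  proof -
    \<comment> \<open>Both times of the refined increment exceed those of the a-th orbit increment
      by the same s, so S s factors out as a contraction.\<close>
    define s where "s = real (Suc l) * \<Delta> / real m - real a * \<Delta>"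
    have "real a * real m \<le> real (Suc l)" using that
      by (metis atLeastLessThan_iff le_SucI of_nat_le_iff of_nat_mult)
    then have "real a * \<Delta> * real m \<le> real (Suc l) * \<Delta>"
      using D by (metis mult.assoc mult.commute mult_right_mono)
    then have s: "s \<ge> 0" unfolding s_def using m by (simp add: pos_le_divide_eq)
    have 1: "S (real (Suc l) * \<Delta> / real m) x = S s (S (real a * \<Delta>) x)"
      using S_add[OF s, of "real a * \<Delta>" x] D by (simp add: s_def)
    have 2: "S (\<Delta> + real (Suc l) * \<Delta> / real m) x = S s (S (real (Suc a) * \<Delta>) x)"
      using S_add[OF s, of "real (Suc a) * \<Delta>" x] D by (simp add: s_def algebra_simps)
    show ?thesis unfolding 1 2 S_diff[OF s, symmetric]
      by (intro power_mono S_contraction s) simp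
  qed
  then have "(\<Sum>l<i * m. (norm (S (\<Delta> + real (Suc l) * \<Delta> / real m) x - S (real (Suc l) * \<Delta> / real m) x))\<^sup>2)
     \<le> (\<Sum>a<i. \<Sum>l\<in>{a * m..<a * m + m}. (norm (S (real (Suc a) * \<Delta>) x - S (real a * \<Delta>) x))\<^sup>2)"
    unfolding sum.nat_group[symmetric] by (intro sum_mono) blast
  also have "\<dots> = real m * orbit_variation \<Delta> i x"
    by (simp add: orbit_variation_def sum_distrib_left)
  finally show ?thesis .
qed

end

section \<open>Countable orthonormal bases\<close>

text \<open>The domain is the union of the images under the inverse K of the balls of integer
  radius. Each image is totally bounded, so finite nets of mesh 1/(k+1) for all radii and all k form
  a countable set whose closure contains the domain, and hence everything.\<close>

lemma compact_inverse_imp_separable: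
  fixes DA :: "'h::real_normed_vector set"
  assumes inv: "has_compact_inverse DA A" and dense: "densely_defined DA"
  shows "\<exists>d :: nat \<Rightarrow> 'h. closure (range d) = UNIV"
proof -
  define K where "K = the_inv_into DA A"
  have bij: "bij_betw A DA UNIV" and cK: "compact_operator K"
    using inv by (auto simp: has_compact_inverse_def K_def)
  have "\<exists>c. finite c \<and> K ` ball 0 (real n) \<subseteq> (\<Union>x\<in>c. ball x (1 / real (Suc k)))" for n k
  proof -
    have "compact (closure (K ` ball 0 (real n)))"
      using cK unfolding compact_operator_def by blast
    then have "\<forall>r>0. \<exists>c. finite c \<and> closure (K ` ball 0 (real n)) \<subseteq> (\<Union>x\<in>c. ball x r)"
      unfolding compact_eq_totally_bounded by blast
    moreover have "1 / real (Suc k) > 0" by simp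
    ultimately obtain c where "finite c" "closure (K ` ball 0 (real n)) \<subseteq> (\<Union>x\<in>c. ball x (1 / real (Suc k)))"
      by meson
    then show ?thesis by (meson closure_subset subset_trans)
  qed
  then obtain c where c: "\<And>n k. finite (c n k)"
    "\<And>n k. K ` ball 0 (real n) \<subseteq> (\<Union>x\<in>c n k. ball x (1 / real (Suc k)))" by metis
  \<comment> \<open>Inserting 0 makes C nonempty, as its enumeration by \<open>from_nat_into\<close>
    requires.\<close>
  define C where "C = insert 0 (\<Union>n. \<Union>k. c n k)"
  have count: "countable C" unfolding C_def by (intro countable_insert countable_UN) (simp_all add: c(1) countable_finite)
  have "DA \<subseteq> closure C"
  proof
    fix x assume x: "x \<in> DA"
    obtain n where n: "norm (A x) < real n" using reals_Archimedean2 by blast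
    have "x = K (A x)" unfolding K_def using x bij by (simp add: the_inv_into_f_f bij_betw_def)
    then have xK: "x \<in> K ` ball 0 (real n)" using n by auto
    show "x \<in> closure C"
      unfolding closure_approachable
    proof (intro allI impI)
      fix r :: real assume "r > 0"
      then obtain k where k: "1 / real (Suc k) < r"
        using reals_Archimedean[of r] by (metis inverse_eq_divide)
      obtain y where "y \<in> c n k" "dist y x < 1 / real (Suc k)"
        using c(2)[of n k] xK by auto
      then have "y \<in> C" "dist y x < r" using k unfolding C_def by (blast, linarith)
      then show "\<exists>y\<in>C. dist y x < r" by blast
    qed
  qed
  then have "closure DA \<subseteq> closure C" by (simp add: closure_minimal)
  then have "closure C = UNIV" using dense by (auto simp: densely_defined_def)
  moreover have "range (from_nat_into C) = C"
    using count by (intro range_from_nat_into) (auto simp: C_def)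
  ultimately show ?thesis by metis
qed

text \<open>\<open>sgn\<close> normalises the residual and leaves a vanishing one at 0, so vectors
  that depend on earlier ones need not be discarded from the sequence.\<close>

fun gram_schmidt :: "(nat \<Rightarrow> 'h::real_inner) \<Rightarrow> nat \<Rightarrow> 'h" where
  "gram_schmidt d n = sgn (d n - (\<Sum>j<n. inner (d n) (gram_schmidt d j) *\<^sub>R gram_schmidt d j))"

declare gram_schmidt.simps [simp del]

text \<open>Zero vectors are admitted so that finite-dimensional spaces are covered as well.\<close>
locale hilbert_basis =
  fixes e :: "nat \<Rightarrow> 'h::real_inner"
  assumes orth: "i \<noteq> j \<Longrightarrow> inner (e i) (e j) = 0"
    and norm_e: "norm (e i) = 1 \<or> e i = 0"
    and parseval: "(\<lambda>k. (inner x (e k))\<^sup>2) sums (norm x)\<^sup>2"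

lemma norm_diff_projection:
  fixes e :: "nat \<Rightarrow> 'h::real_inner"
  assumes orth: "\<And>i j. i < n \<Longrightarrow> j < n \<Longrightarrow> i \<noteq> j \<Longrightarrow> inner (e i) (e j) = 0"
    and norm_e: "\<And>i. i < n \<Longrightarrow> norm (e i) = 1 \<or> e i = 0"
  shows "(norm (x - (\<Sum>j<n. inner x (e j) *\<^sub>R e j)))\<^sup>2 = (norm x)\<^sup>2 - (\<Sum>j<n. (inner x (e j))\<^sup>2)"
proof -
  define P where "P = (\<Sum>j<n. inner x (e j) *\<^sub>R e j)"
  have Pe: "inner P (e i) = inner x (e i)" if i: "i < n" for i
  proof -
    have "inner P (e i) = (\<Sum>j<n. inner x (e j) * inner (e j) (e i))"
      by (simp add: P_def inner_sum_left)
    also have "\<dots> = (\<Sum>j<n. if j = i then inner x (e i) * inner (e i) (e i) else 0)"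
      using orth i by (intro sum.cong) auto
    also have "\<dots> = inner x (e i)" using i norm_e[OF i] by (auto simp: dot_square_norm)
    finally show ?thesis .
  qed
  have xP: "inner x P = (\<Sum>j<n. (inner x (e j))\<^sup>2)"
    by (simp add: P_def inner_sum_right power2_eq_square)
  have "inner P P = (\<Sum>j<n. inner x (e j) * inner P (e j))"
    by (subst (2) P_def) (simp add: inner_sum_right)
  also have "\<dots> = (\<Sum>j<n. (inner x (e j))\<^sup>2)" using Pe by (simp add: power2_eq_square)
  finally have PP: "inner P P = (\<Sum>j<n. (inner x (e j))\<^sup>2)" .
  have "(norm (x - P))\<^sup>2 = (norm x)\<^sup>2 - 2 * inner x P + inner P P"
    by (simp add: power2_norm_eq_inner inner_diff inner_commute)
  then show ?thesis using xP PP unfolding P_def by simp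
qed

text \<open>Completeness: the projection onto the first n basis vectors fixes d k once k < n. The
  residual of x is then also the residual of x - d k, whose norm is at most |x - d k|, and this is
  small for a suitable k by density.\<close>

lemma hilbert_basis_exists:
  fixes d :: "nat \<Rightarrow> 'h::real_inner"
  assumes dense: "closure (range d) = UNIV"
  shows "hilbert_basis (gram_schmidt d)"
proof -
  let ?e = "gram_schmidt d"
  have ne: "norm (?e i) = 1 \<or> ?e i = 0" for i
    by (subst (1 2) gram_schmidt.simps) (auto simp: norm_sgn sgn_zero_iff)
  define u where "u n = d n - (\<Sum>j<n. inner (d n) (?e j) *\<^sub>R ?e j)" for n
  have eu: "?e n = sgn (u n)" for n unfolding u_def by (rule gram_schmidt.simps)
  have ue: "u n = norm (u n) *\<^sub>R ?e n" for n
    unfolding eu by (cases "u n = 0") (auto simp: sgn_div_norm)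
  \<comment> \<open>Computing the projection coefficients of d n needs the orthogonality of all
    earlier basis vectors, which is why the induction is over all smaller indices.\<close>
  have main: "\<forall>i<n. inner (u n) (?e i) = 0" for n
  proof (induction n rule: less_induct)
    case (less n)
    have o: "inner (?e j) (?e i) = 0" if "j < n" "i < n" "i \<noteq> j" for i j
    proof -
      have "inner (?e j) (?e i) = 0" if "i < j" "j < n" for i j
        using less.IH[OF that(2)] that(1) by (simp add: eu[of j] sgn_div_norm)
      then show ?thesis using that by (metis inner_commute linorder_neqE_nat)
    qed
    show ?case
    proof (intro allI impI)
      fix i assume i: "i < n"
      have "(\<Sum>j<n. inner (d n) (?e j) * inner (?e j) (?e i))
          = (\<Sum>j<n. if j = i then inner (d n) (?e i) * inner (?e i) (?e i) else 0)"
        using o i by (intro sum.cong) auto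
      also have "\<dots> = inner (d n) (?e i)" using i ne[of i] by (auto simp: dot_square_norm)
      finally show "inner (u n) (?e i) = 0"
        by (simp add: u_def inner_diff_left inner_sum_left)
    qed
  qed
  have orth: "inner (?e i) (?e j) = 0" if "i \<noteq> j" for i j
  proof -
    have "inner (?e j) (?e i) = 0" if "i < j" for i j
      using main that by (simp add: eu[of j] sgn_div_norm)
    then show ?thesis using that by (metis inner_commute linorder_neqE_nat)
  qed
  have np: "(norm (x - (\<Sum>j<n. inner x (?e j) *\<^sub>R ?e j)))\<^sup>2 = (norm x)\<^sup>2 - (\<Sum>j<n. (inner x (?e j))\<^sup>2)" for x n
    by (rule norm_diff_projection) (use orth ne in auto)
  have bessel: "(\<Sum>j<n. (inner x (?e j))\<^sup>2) \<le> (norm x)\<^sup>2" for x n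
    using np[of x n] by (smt (verit) zero_le_power2)
  have dfull: "(\<Sum>j<n. (inner (d k) (?e j))\<^sup>2) = (norm (d k))\<^sup>2" if "k < n" for k n
  proof -
    have "inner (d k) (?e k) = inner (u k) (?e k)"
    proof -
      have "(\<Sum>j<k. inner (d k) (?e j) * inner (?e j) (?e k)) = 0"
        using orth by (intro sum.neutral) auto
      then show ?thesis by (simp add: u_def inner_diff_left inner_sum_left)
    qed
    also have "inner (u k) (?e k) = norm (u k) * (norm (?e k))\<^sup>2"
      by (subst ue) (simp add: dot_square_norm)
    finally have dk: "inner (d k) (?e k) *\<^sub>R ?e k = u k"
      using ne[of k] ue[of k] by auto
    have "d k - (\<Sum>j<Suc k. inner (d k) (?e j) *\<^sub>R ?e j) = 0"
      using dk by (simp add: u_def)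
    then have "(norm (d k))\<^sup>2 = (\<Sum>j<Suc k. (inner (d k) (?e j))\<^sup>2)" using np[of "d k" "Suc k"] by simp
    also have "\<dots> \<le> (\<Sum>j<n. (inner (d k) (?e j))\<^sup>2)"
      using that by (intro sum_mono2) auto
    finally show ?thesis using bessel[of "d k" n] by simp
  qed
  have "(\<lambda>k. (inner x (?e k))\<^sup>2) sums (norm x)\<^sup>2" for x
    unfolding sums_def
  proof (rule LIMSEQ_I)
    fix r :: real assume r: "r > 0"
    have "x \<in> closure (range d)" using dense by simp
    then obtain k where k: "norm (x - d k) < sqrt r"
      using r unfolding closure_approachable by (force simp: dist_norm norm_minus_commute)
    have "(norm (x - d k))\<^sup>2 < (sqrt r)\<^sup>2" using k by (intro power_strict_mono) auto
    then have kr: "(norm (x - d k))\<^sup>2 < r" using r by simp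
    have "norm ((\<Sum>j<n. (inner x (?e j))\<^sup>2) - (norm x)\<^sup>2) < r" if n: "n \<ge> Suc k" for n
    proof -
      have "d k - (\<Sum>j<n. inner (d k) (?e j) *\<^sub>R ?e j) = 0"
        using np[of "d k" n] dfull[of k n] n by simp
      then have eq: "x - (\<Sum>j<n. inner x (?e j) *\<^sub>R ?e j)
          = (x - d k) - (\<Sum>j<n. inner (x - d k) (?e j) *\<^sub>R ?e j)"
        by (simp add: inner_diff_left scaleR_diff_left sum_subtractf algebra_simps)
      then have "(norm x)\<^sup>2 - (\<Sum>j<n. (inner x (?e j))\<^sup>2)
          = (norm (x - d k))\<^sup>2 - (\<Sum>j<n. (inner (x - d k) (?e j))\<^sup>2)"
        unfolding np[symmetric] by (simp only: eq)
      also have "\<dots> \<le> (norm (x - d k))\<^sup>2" by (simp add: sum_nonneg)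
      finally show ?thesis using kr bessel[of x n] by simp
    qed
    then show "\<exists>no. \<forall>n\<ge>no. norm ((\<Sum>j<n. (inner x (?e j))\<^sup>2) - (norm x)\<^sup>2) < r" by blast
  qed
  then show ?thesis using orth ne by unfold_locales auto
qed

section \<open>Hilbert-Schmidt and trace sums in a basis\<close>

lemma orthonormal_bessel:
  assumes "orthonormal_family n f"
  shows "(\<Sum>i<n. (inner x (f i))\<^sup>2) \<le> (norm x)\<^sup>2"
proof -
  have "0 \<le> (norm (x - (\<Sum>j<n. inner x (f j) *\<^sub>R f j)))\<^sup>2" by simp
  also have "\<dots> = (norm x)\<^sup>2 - (\<Sum>i<n. (inner x (f i))\<^sup>2)"
    using assms by (intro norm_diff_projection) (auto simp: orthonormal_family_def)
  finally show ?thesis by simp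
qed

context hilbert_basis
begin

lemma parseval_ennreal: "(\<Sum>k. ennreal ((inner x (e k))\<^sup>2)) = ennreal ((norm x)\<^sup>2)"
  using parseval[of x] by (intro suminf_ennreal_eq) auto

text \<open>The images of an arbitrary orthonormal family are expanded in the basis. Symmetry moves
  T from f i to e k, and Bessel's inequality for the family then bounds the k-th sum by |T e_k|^2.
  Only this direction is needed, since the norm is to be bounded above.\<close>

lemma hs_norm_sq_le:
  assumes sym: "\<And>x y. inner (T x) y = inner x (T y)"
  shows "hs_norm_sq T \<le> (\<Sum>k. \<Sum>l. ennreal ((inner (T (e k)) (e l))\<^sup>2))"
  unfolding hs_norm_sq_def
proof (rule SUP_least, clarify)
  fix n f assume f: "orthonormal_family n (f :: nat \<Rightarrow> 'h)"
  have "ennreal (\<Sum>i<n. (norm (T (f i)))\<^sup>2) = (\<Sum>i<n. ennreal ((norm (T (f i)))\<^sup>2))" by simp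
  also have "\<dots> = (\<Sum>i<n. \<Sum>k. ennreal ((inner (T (f i)) (e k))\<^sup>2))"
    by (simp add: parseval_ennreal)
  also have "\<dots> = (\<Sum>k. \<Sum>i<n. ennreal ((inner (T (f i)) (e k))\<^sup>2))"
    by (rule suminf_sum[symmetric]) simp
  also have "\<dots> \<le> (\<Sum>k. ennreal ((norm (T (e k)))\<^sup>2))"
  proof (rule suminf_le)
    fix k
    have "(\<Sum>i<n. (inner (T (f i)) (e k))\<^sup>2) = (\<Sum>i<n. (inner (T (e k)) (f i))\<^sup>2)"
      using sym by (simp add: inner_commute)
    then have "(\<Sum>i<n. (inner (T (f i)) (e k))\<^sup>2) \<le> (norm (T (e k)))\<^sup>2"
      using orthonormal_bessel[OF f] by simp
    then show "(\<Sum>i<n. ennreal ((inner (T (f i)) (e k))\<^sup>2)) \<le> ennreal ((norm (T (e k)))\<^sup>2)"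
      by (simp add: sum_nonneg)
  qed auto
  also have "\<dots> = (\<Sum>k. \<Sum>l. ennreal ((inner (T (e k)) (e l))\<^sup>2))"
    by (simp add: parseval_ennreal)
  finally show "ennreal (\<Sum>i<n. (norm (T (f i)))\<^sup>2) \<le> (\<Sum>k. \<Sum>l. ennreal ((inner (T (e k)) (e l))\<^sup>2))" .
qed

text \<open>The type of H carries no countability class, so random vectors are handled through their
  scalar products. Parseval recovers the squared norm as a limit of measurable functions.\<close>

lemma measurable_norm_sq:
  fixes U :: "'w \<Rightarrow> 'h"
  assumes "\<And>h. (\<lambda>\<omega>. inner (U \<omega>) h) \<in> borel_measurable M"
  shows "(\<lambda>\<omega>. (norm (U \<omega>))\<^sup>2) \<in> borel_measurable M"
proof (rule borel_measurable_LIMSEQ_real)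
  show "(\<lambda>n. \<Sum>k<n. (inner (U \<omega>) (e k))\<^sup>2) \<longlonglongrightarrow> (norm (U \<omega>))\<^sup>2" for \<omega>
    using parseval unfolding sums_def .
  show "(\<lambda>\<omega>. \<Sum>k<n. (inner (U \<omega>) (e k))\<^sup>2) \<in> borel_measurable M" for n
    using assms by measurable
qed

text \<open>The trace class condition speaks of unit vectors, whereas basis vectors may be 0. The
  nonzero ones among the first n are renumbered by \<open>b\<close>; the others contribute nothing
  to the trace.\<close>

lemma trace_bounded:
  assumes "trace_class Q" and pos: "\<And>x. inner (Q x) x \<ge> 0"
  shows "(\<Sum>k. ennreal (inner (Q (e k)) (e k))) < \<infinity>"
proof -
  obtain C where C: "\<And>n e f. orthonormal_family n e \<Longrightarrow> orthonormal_family n f \<Longrightarrow>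
          (\<Sum>i<n. \<bar>inner (Q (e i)) (f i)\<bar>) \<le> C" and lin: "linear Q"
    using assms(1) unfolding trace_class_def by (metis bounded_linear.linear)
  have "(\<Sum>k<n. ennreal (inner (Q (e k)) (e k))) \<le> ennreal C" for n
  proof -
    define I where "I = {k. k < n \<and> e k \<noteq> 0}"
    have fin: "finite I" unfolding I_def by simp
    then obtain b where b: "bij_betw b {..<card I} I"
      using ex_bij_betw_nat_finite lessThan_atLeast0 by metis
    have inj: "inj_on b {..<card I}" and img: "\<And>i. i < card I \<Longrightarrow> b i \<in> I"
      using b by (auto simp: bij_betw_def)
    have "orthonormal_family (card I) (e \<circ> b)"
      unfolding orthonormal_family_def
    proof (intro conjI allI impI)
      fix i assume "i < card I"
      then show "norm ((e \<circ> b) i) = 1" using norm_e[of "b i"] img[of i] by (auto simp: I_def)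
    next
      fix i j assume "i < card I" "j < card I" "i \<noteq> j"
      then have "b i \<noteq> b j" using inj by (auto simp: inj_on_def)
      then show "inner ((e \<circ> b) i) ((e \<circ> b) j) = 0" using orth by simp
    qed
    then have "(\<Sum>i<card I. \<bar>inner (Q (e (b i))) (e (b i))\<bar>) \<le> C"
      using C[of "card I" "e \<circ> b" "e \<circ> b"] by simp
    then have "(\<Sum>k\<in>I. inner (Q (e k)) (e k)) \<le> C"
      using sum.reindex_bij_betw[OF b, of "\<lambda>k. inner (Q (e k)) (e k)"] pos by simp
    moreover have "(\<Sum>k<n. inner (Q (e k)) (e k)) = (\<Sum>k\<in>I. inner (Q (e k)) (e k))"
      by (rule sum.mono_neutral_right) (auto simp: I_def linear_0[OF lin])
    ultimately show ?thesis using pos by (simp add: ennreal_leI)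
  qed
  then have "(\<Sum>k. ennreal (inner (Q (e k)) (e k))) \<le> ennreal C"
    by (intro suminf_le_const) auto
  then show ?thesis using order_le_less_trans by fastforce
qed

end

section \<open>Moments of Wiener increments\<close>

lemma ennreal_power2_le_imp_le:
  fixes x y :: ennreal
  assumes "x\<^sup>2 \<le> y\<^sup>2" shows "x \<le> y"
proof (cases x)
  case (real a)
  show ?thesis
  proof (cases y)
    case (real b)
    with \<open>x = ennreal a\<close> \<open>0 \<le> a\<close> assms have "a\<^sup>2 \<le> b\<^sup>2" by (simp add: ennreal_power)
    then have "a \<le> b" using \<open>0 \<le> b\<close> by (rule power2_le_imp_le)
    then show ?thesis using real \<open>x = ennreal a\<close> by (simp add: ennreal_leI)
  qed simp
next
  case top
  then have "x * x = \<top>" by (simp add: ennreal_mult_eq_top_iff)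
  then have "y * y = \<top>" using assms top_unique unfolding power2_eq_square by metis
  then have "y = \<top>" by (simp add: ennreal_mult_eq_top_iff)
  then show ?thesis by simp
qed

text \<open>Minkowski's inequality in L^2 for nonnegative series: the square is expanded into a
  double series and each product is bounded by Cauchy-Schwarz. The common constant c will be the
  Gaussian factor 3, and v k a variance.\<close>

lemma nn_integral_suminf_square_le:
  fixes f :: "nat \<Rightarrow> 'a \<Rightarrow> ennreal"
  assumes [measurable]: "\<And>k. f k \<in> borel_measurable M"
    and sq: "\<And>k. (\<integral>\<^sup>+x. (f k x)\<^sup>2 \<partial>M) \<le> c * (v k)\<^sup>2"
  shows "(\<integral>\<^sup>+x. (\<Sum>k. f k x)\<^sup>2 \<partial>M) \<le> c * (\<Sum>k. v k)\<^sup>2"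
proof -
  have fg: "(\<integral>\<^sup>+x. f k x * f l x \<partial>M) \<le> c * (v k * v l)" for k l
  proof (rule ennreal_power2_le_imp_le)
    have "(\<integral>\<^sup>+x. f k x * f l x \<partial>M)\<^sup>2 \<le> (\<integral>\<^sup>+x. (f k x)\<^sup>2 \<partial>M) * (\<integral>\<^sup>+x. (f l x)\<^sup>2 \<partial>M)"
      by (rule Cauchy_Schwarz_nn_integral) auto
    also have "\<dots> \<le> (c * (v k)\<^sup>2) * (c * (v l)\<^sup>2)" by (intro mult_mono sq) auto
    also have "\<dots> = (c * (v k * v l))\<^sup>2" by (simp add: power2_eq_square mult_ac)
    finally show "(\<integral>\<^sup>+x. f k x * f l x \<partial>M)\<^sup>2 \<le> (c * (v k * v l))\<^sup>2" .
  qed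
  have "(\<integral>\<^sup>+x. (\<Sum>k. f k x)\<^sup>2 \<partial>M) = (\<integral>\<^sup>+x. (\<Sum>k. \<Sum>l. f k x * f l x) \<partial>M)"
    by (simp add: power2_eq_square)
  also have "\<dots> = (\<Sum>k. \<Sum>l. \<integral>\<^sup>+x. f k x * f l x \<partial>M)"
    by (subst nn_integral_suminf, measurable, subst nn_integral_suminf, measurable)
  also have "\<dots> \<le> (\<Sum>k. \<Sum>l. c * (v k * v l))"
    by (intro suminf_le fg) auto
  also have "\<dots> = c * (\<Sum>k. v k)\<^sup>2"
    by (simp add: power2_eq_square)
  finally show ?thesis .
qed

lemma nn_integral_sum_square_le:
  fixes f :: "nat \<Rightarrow> 'a \<Rightarrow> ennreal"
  assumes [measurable]: "\<And>k. f k \<in> borel_measurable M"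
    and sq: "\<And>k. k < n \<Longrightarrow> (\<integral>\<^sup>+x. (f k x)\<^sup>2 \<partial>M) \<le> c * (v k)\<^sup>2"
  shows "(\<integral>\<^sup>+x. (\<Sum>k<n. f k x)\<^sup>2 \<partial>M) \<le> c * (\<Sum>k<n. v k)\<^sup>2"
proof -
  have "(\<integral>\<^sup>+x. (\<Sum>k. if k < n then f k x else 0)\<^sup>2 \<partial>M) \<le> c * (\<Sum>k. if k < n then v k else 0)\<^sup>2"
  proof (rule nn_integral_suminf_square_le)
    fix k show "(\<integral>\<^sup>+x. (if k < n then f k x else 0)\<^sup>2 \<partial>M) \<le> c * (if k < n then v k else 0)\<^sup>2"
      using sq[of k] by (cases "k < n") auto
  qed measurable
  moreover have "(\<Sum>k. if k < n then g k else 0) = (\<Sum>k<n. g k)" for g :: "nat \<Rightarrow> ennreal"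
    by (subst suminf_finite[of "{..<n}"]) auto
  ultimately show ?thesis by simp
qed

lemma centred_gaussian_moments:
  assumes g: "centred_gaussian M Z v" and v: "v \<ge> 0"
  shows "integrable M (\<lambda>\<omega>. Z \<omega> ^ k)"
    and "(\<integral>\<omega>. Z \<omega> \<partial>M) = 0" "(\<integral>\<omega>. (Z \<omega>) ^ 2 \<partial>M) = v"
    and "(\<integral>\<omega>. (Z \<omega>) ^ 3 \<partial>M) = 0" "(\<integral>\<omega>. (Z \<omega>) ^ 4 \<partial>M) = 3 * v\<^sup>2"
proof -
  have Z[measurable]: "Z \<in> borel_measurable M" using g by (simp add: centred_gaussian_def)
  have "integrable M (\<lambda>\<omega>. Z \<omega> ^ k) \<and> (\<integral>\<omega>. Z \<omega> \<partial>M) = 0 \<and> (\<integral>\<omega>. (Z \<omega>) ^ 2 \<partial>M) = v \<and>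
     (\<integral>\<omega>. (Z \<omega>) ^ 3 \<partial>M) = 0 \<and> (\<integral>\<omega>. (Z \<omega>) ^ 4 \<partial>M) = 3 * v\<^sup>2"
  proof (cases "v = 0")
    case True
    then have d: "distr M borel Z = return borel 0" using g by (simp add: centred_gaussian_def)
    interpret D: prob_space "distr M borel Z" unfolding d by (rule prob_space_return) simp
    have "integrable (distr M borel Z) (\<lambda>x. x ^ k)"
      unfolding d
    proof (rule integrableI_bounded)
      show "(\<integral>\<^sup>+x. ennreal (norm (x ^ k)) \<partial>return borel (0::real)) < \<infinity>"
        by (subst nn_integral_return) auto
    qed simp
    then have "integrable M (\<lambda>\<omega>. Z \<omega> ^ k)" by (subst (asm) integrable_distr_eq) auto
    moreover have "(\<integral>\<omega>. (Z \<omega>) ^ j \<partial>M) = 0 ^ j" for j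
    proof -
      have "(\<integral>x. x ^ j \<partial>distr M borel Z) = 0 ^ j"
        unfolding d by (subst integral_return) auto
      then show ?thesis by (subst (asm) integral_distr) auto
    qed
    from this[of 1] this[of 2] this[of 3] this[of 4] have "(\<integral>\<omega>. Z \<omega> \<partial>M) = 0"
      "(\<integral>\<omega>. (Z \<omega>) ^ 2 \<partial>M) = 0" "(\<integral>\<omega>. (Z \<omega>) ^ 3 \<partial>M) = 0" "(\<integral>\<omega>. (Z \<omega>) ^ 4 \<partial>M) = 0"
      by simp_all
    ultimately show ?thesis using True by simp
  next
    case False
    then have d: "distr M borel Z = density lborel (normal_density 0 (sqrt v))"
      and s: "sqrt v > 0"
      using g v by (auto simp: centred_gaussian_def)
    have i: "integrable M (\<lambda>\<omega>. Z \<omega> ^ j)" for j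
    proof -
      have "integrable (distr M borel Z) (\<lambda>x. x ^ j)"
        unfolding d using integrable_normal_moment[OF s, of 0 j]
        by (subst integrable_density) auto
      then show ?thesis by (subst (asm) integrable_distr_eq) auto
    qed
    have e: "(\<integral>\<omega>. (Z \<omega>) ^ j \<partial>M) = (\<integral>x. normal_density 0 (sqrt v) x * x ^ j \<partial>lborel)" for j
    proof -
      have "(\<integral>\<omega>. (Z \<omega>) ^ j \<partial>M) = (\<integral>x. x ^ j \<partial>distr M borel Z)"
        by (subst integral_distr) auto
      also have "\<dots> = (\<integral>x. normal_density 0 (sqrt v) x * x ^ j \<partial>lborel)"
        unfolding d by (subst integral_density) auto
      finally show ?thesis .
    qed
    have "(\<integral>\<omega>. Z \<omega> \<partial>M) = 0"
      using e[of 1] integral_normal_moment_odd[OF s, of 0 0] by simp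
    moreover have "(\<integral>\<omega>. (Z \<omega>) ^ 2 \<partial>M) = v"
      using e[of 2] integral_normal_moment_even[OF s, of 0 1] v by simp
    moreover have "(\<integral>\<omega>. (Z \<omega>) ^ 3 \<partial>M) = 0"
      using e[of 3] integral_normal_moment_odd[OF s, of 0 1] by simp
    moreover have "(\<integral>\<omega>. (Z \<omega>) ^ 4 \<partial>M) = 3 * v\<^sup>2"
      using e[of 4] integral_normal_moment_even[OF s, of 0 2] v
      by (simp add: fact_numeral power_divide power2_eq_square)
    ultimately show ?thesis using i by blast
  qed
  then show "integrable M (\<lambda>\<omega>. Z \<omega> ^ k)"
    and "(\<integral>\<omega>. Z \<omega> \<partial>M) = 0" "(\<integral>\<omega>. (Z \<omega>) ^ 2 \<partial>M) = v"
    and "(\<integral>\<omega>. (Z \<omega>) ^ 3 \<partial>M) = 0" "(\<integral>\<omega>. (Z \<omega>) ^ 4 \<partial>M) = 3 * v\<^sup>2" by blast+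
qed

context prob_space
begin

lemma integrable_power_mono:
  fixes Z :: "'a \<Rightarrow> real"
  assumes i: "integrable M (\<lambda>\<omega>. Z \<omega> ^ n)" and [measurable]: "Z \<in> borel_measurable M"
    and "k \<le> n" "even n"
  shows "integrable M (\<lambda>\<omega>. Z \<omega> ^ k)"
proof (rule Bochner_Integration.integrable_bound)
  show "integrable M (\<lambda>\<omega>. 1 + Z \<omega> ^ n)" using i by simp
  show "AE \<omega> in M. norm (Z \<omega> ^ k) \<le> norm (1 + Z \<omega> ^ n)"
  proof (rule AE_I2)
    fix \<omega>
    have "\<bar>Z \<omega>\<bar> ^ k \<le> 1 + \<bar>Z \<omega>\<bar> ^ n"
    proof (cases "\<bar>Z \<omega>\<bar> \<le> 1")
      case True
      then have "\<bar>Z \<omega>\<bar> ^ k \<le> 1" by (simp add: power_le_one)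
      moreover have "0 \<le> \<bar>Z \<omega>\<bar> ^ n" by simp
      ultimately show ?thesis by linarith
    next
      case False
      then have "\<bar>Z \<omega>\<bar> ^ k \<le> \<bar>Z \<omega>\<bar> ^ n" by (intro power_increasing \<open>k \<le> n\<close>) simp
      then show ?thesis by linarith
    qed
    also have "\<bar>Z \<omega>\<bar> ^ n = Z \<omega> ^ n" using \<open>even n\<close> by (rule power_even_abs)
    also have "1 + Z \<omega> ^ n \<le> norm (1 + Z \<omega> ^ n)" by simp
    finally show "norm (Z \<omega> ^ k) \<le> norm (1 + Z \<omega> ^ n)" by (simp only: real_norm_def power_abs)
  qed
qed measurable

text \<open>The independence of increments from the past is used in this form only. Events in \<phi>
  o D are preimages under D of Borel sets, so independence of \<open>G\<close> from the events of D
  passes to the pair of real variables, and expectations factorise.\<close>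

lemma indep_set_integral_mult:
  fixes Z :: "'a \<Rightarrow> real" and D :: "'a \<Rightarrow> 'h::topological_space"
  assumes ind: "indep_set G {D -` B \<inter> space M | B. B \<in> sets borel}"
    and G: "sigma_algebra (space M) G"
    and Z: "Z \<in> borel_measurable (sigma (space M) G)"
    and \<phi>: "\<phi> \<in> borel_measurable borel"
    and iZ: "integrable M Z" and iD: "integrable M (\<lambda>\<omega>. \<phi> (D \<omega>))"
  shows "integrable M (\<lambda>\<omega>. Z \<omega> * \<phi> (D \<omega>))"
    and "(\<integral>\<omega>. Z \<omega> * \<phi> (D \<omega>) \<partial>M) = (\<integral>\<omega>. Z \<omega> \<partial>M) * (\<integral>\<omega>. \<phi> (D \<omega>) \<partial>M)"
proof -
  have Zm[measurable]: "Z \<in> borel_measurable M" and Dm[measurable]: "(\<lambda>\<omega>. \<phi> (D \<omega>)) \<in> borel_measurable M"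
    using iZ iD by auto
  have "indep_set (sigma_sets (space M) {Z -` A \<inter> space M | A. A \<in> sets borel})
      (sigma_sets (space M) {(\<lambda>\<omega>. \<phi> (D \<omega>)) -` A \<inter> space M | A. A \<in> sets borel})"
  proof (rule indep_set_sigma_sets)
    show "Int_stable {Z -` A \<inter> space M | A. A \<in> sets borel}"
    proof (rule Int_stableI, clarsimp)
      fix A B :: "real set" assume "A \<in> sets borel" "B \<in> sets borel"
      then show "\<exists>C. Z -` A \<inter> space M \<inter> (Z -` B \<inter> space M) = Z -` C \<inter> space M \<and> C \<in> sets borel"
        by (intro exI[of _ "A \<inter> B"]) auto
    qed
    show "Int_stable {(\<lambda>\<omega>. \<phi> (D \<omega>)) -` A \<inter> space M | A. A \<in> sets borel}"
    proof (rule Int_stableI, clarsimp)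
      fix A B :: "real set" assume "A \<in> sets borel" "B \<in> sets borel"
      then show "\<exists>C. (\<lambda>\<omega>. \<phi> (D \<omega>)) -` A \<inter> space M \<inter> ((\<lambda>\<omega>. \<phi> (D \<omega>)) -` B \<inter> space M)
          = (\<lambda>\<omega>. \<phi> (D \<omega>)) -` C \<inter> space M \<and> C \<in> sets borel"
        by (intro exI[of _ "A \<inter> B"]) auto
    qed
    show "indep_set {Z -` A \<inter> space M | A. A \<in> sets borel}
      {(\<lambda>\<omega>. \<phi> (D \<omega>)) -` A \<inter> space M | A. A \<in> sets borel}"
    proof (rule indep_setI)
      show "{Z -` A \<inter> space M | A. A \<in> sets borel} \<subseteq> events"
        "{(\<lambda>\<omega>. \<phi> (D \<omega>)) -` A \<inter> space M | A. A \<in> sets borel} \<subseteq> events"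
        by (auto intro: measurable_sets[OF Zm] measurable_sets[OF Dm])
    next
      fix a b assume "a \<in> {Z -` A \<inter> space M | A. A \<in> sets borel}"
        and "b \<in> {(\<lambda>\<omega>. \<phi> (D \<omega>)) -` A \<inter> space M | A. A \<in> sets borel}"
      then obtain A B where A: "A \<in> sets borel" "a = Z -` A \<inter> space M"
        and B: "B \<in> sets borel" "b = (\<lambda>\<omega>. \<phi> (D \<omega>)) -` B \<inter> space M" by blast
      have "sets (sigma (space M) G) = G" "space (sigma (space M) G) = space M"
        using G by (simp_all add: sigma_algebra.sets_measure_of_eq space_measure_of_conv)
      then have "a \<in> G" using measurable_sets[OF Z A(1)] A(2) by simp
      moreover have "\<phi> -` B \<in> sets borel" using measurable_sets[OF \<phi> B(1)] by simp
      then have "b \<in> {D -` B \<inter> space M | B. B \<in> sets borel}" using B(2) by blast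
      ultimately show "prob (a \<inter> b) = prob a * prob b" using ind by (rule indep_setD[rotated])
    qed
  qed
  then have iv: "indep_var borel Z borel (\<lambda>\<omega>. \<phi> (D \<omega>))"
    unfolding indep_var_eq by simp
  show "integrable M (\<lambda>\<omega>. Z \<omega> * \<phi> (D \<omega>))" by (rule indep_var_integrable[OF iv iZ iD])
  show "(\<integral>\<omega>. Z \<omega> * \<phi> (D \<omega>) \<partial>M) = (\<integral>\<omega>. Z \<omega> \<partial>M) * (\<integral>\<omega>. \<phi> (D \<omega>) \<partial>M)"
    by (rule indep_var_lebesgue_integral[OF iv iZ iD])
qed

end

section \<open>Moments of scalar Wiener sums\<close>

locale wiener_setting = prob_space M + hilbert_basis e
  for M :: "'w measure" and e :: "nat \<Rightarrow> 'h::{real_inner, complete_space}" +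
  fixes F :: "real \<Rightarrow> 'w set set" and Q :: "'h \<Rightarrow> 'h" and W :: "real \<Rightarrow> 'w \<Rightarrow> 'h"
  assumes filtration: "normal_filtration M F"
    and Q_lin: "bounded_linear Q" and Q_sym: "inner (Q x) y = inner x (Q y)"
    and Q_pos: "inner (Q x) x \<ge> 0" and Q_trace: "trace_class Q"
    and wiener: "Q_Wiener_process M F Q W"
begin

abbreviation Ft :: "real \<Rightarrow> 'w measure" where "Ft t \<equiv> sigma (space M) (F t)"

lemma F_sigma: "t \<ge> 0 \<Longrightarrow> sigma_algebra (space M) (F t)"
  and F_events: "t \<ge> 0 \<Longrightarrow> F t \<subseteq> events"
  and F_mono: "0 \<le> s \<Longrightarrow> s \<le> t \<Longrightarrow> F s \<subseteq> F t"
proof -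
  note f = filtration[unfolded normal_filtration_def]
  note * = f[THEN conjunct1] f[THEN conjunct2, THEN conjunct1]
  show "t \<ge> 0 \<Longrightarrow> sigma_algebra (space M) (F t)" "t \<ge> 0 \<Longrightarrow> F t \<subseteq> events"
    "0 \<le> s \<Longrightarrow> s \<le> t \<Longrightarrow> F s \<subseteq> F t"
    using * by blast+
qed

lemma sets_Ft: "t \<ge> 0 \<Longrightarrow> sets (Ft t) = F t"
  by (rule sigma_algebra.sets_measure_of_eq[OF F_sigma])

lemma space_Ft [simp]: "space (Ft t) = space M"
  by (simp add: space_measure_of_conv)

lemma measurable_Ft_iff:
  "t \<ge> 0 \<Longrightarrow> Z \<in> borel_measurable (Ft t) \<longleftrightarrow> measurable_wrt M (F t) Z"
  by (simp add: measurable_def measurable_wrt_def sets_Ft)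

lemma measurable_Ft_mono:
  "0 \<le> s \<Longrightarrow> s \<le> t \<Longrightarrow> Z \<in> borel_measurable (Ft s) \<Longrightarrow> Z \<in> borel_measurable (Ft t)"
  by (rule measurable_mono[THEN subsetD, of borel borel "Ft s"]) (auto simp: sets_Ft F_mono)

lemma measurable_Ft_imp: "0 \<le> t \<Longrightarrow> Z \<in> borel_measurable (Ft t) \<Longrightarrow> Z \<in> borel_measurable M"
  by (rule measurable_mono[THEN subsetD, of borel borel "Ft t"]) (auto simp: sets_Ft F_events)

lemma borel_measurable_inner_const: "(\<lambda>x::'h. inner x h) \<in> borel_measurable borel"
  by (intro borel_measurable_continuous_onI continuous_intros)

lemma W_Ft:
  assumes "t \<ge> 0" shows "(\<lambda>\<omega>. inner (W t \<omega>) h) \<in> borel_measurable (Ft t)"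
proof -
  have "measurable_wrt M (F t) (W t)" using wiener assms unfolding Q_Wiener_process_def by blast
  then have "W t \<in> borel_measurable (Ft t)" using assms by (simp add: measurable_Ft_iff)
  then show ?thesis by (rule measurable_compose[OF _ borel_measurable_inner_const])
qed

lemma dW_Ft:
  assumes "0 \<le> s" "s \<le> t"
  shows "(\<lambda>\<omega>. inner (W t \<omega> - W s \<omega>) h) \<in> borel_measurable (Ft t)"
  unfolding inner_diff_left
  using assms measurable_Ft_mono[OF assms W_Ft[of s]] W_Ft[of t] by (intro borel_measurable_diff) auto

lemma dW_measurable:
  "0 \<le> s \<Longrightarrow> s \<le> t \<Longrightarrow> (\<lambda>\<omega>. inner (W t \<omega> - W s \<omega>) h) \<in> borel_measurable M"
  by (rule measurable_Ft_imp[OF _ dW_Ft]) auto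

lemma dW_indep:
  "0 \<le> s \<Longrightarrow> s \<le> t \<Longrightarrow> indep_set (F s) {(\<lambda>\<omega>. W t \<omega> - W s \<omega>) -` B \<inter> space M | B. B \<in> sets borel}"
  using wiener unfolding Q_Wiener_process_def by blast

lemma dW_gauss:
  "0 \<le> s \<Longrightarrow> s \<le> t \<Longrightarrow> centred_gaussian M (\<lambda>\<omega>. inner (W t \<omega> - W s \<omega>) h) ((t - s) * inner (Q h) h)"
  using wiener unfolding Q_Wiener_process_def by blast

lemma dW_moments:
  assumes "0 \<le> s" "s \<le> t"
  shows "integrable M (\<lambda>\<omega>. inner (W t \<omega> - W s \<omega>) h ^ k)"
    and "(\<integral>\<omega>. inner (W t \<omega> - W s \<omega>) h \<partial>M) = 0"
    and "(\<integral>\<omega>. (inner (W t \<omega> - W s \<omega>) h) ^ 2 \<partial>M) = (t - s) * inner (Q h) h"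
    and "(\<integral>\<omega>. (inner (W t \<omega> - W s \<omega>) h) ^ 3 \<partial>M) = 0"
    and "(\<integral>\<omega>. (inner (W t \<omega> - W s \<omega>) h) ^ 4 \<partial>M) = 3 * ((t - s) * inner (Q h) h)\<^sup>2"
  by (rule centred_gaussian_moments[OF dW_gauss[OF assms]]; use assms Q_pos[of h] in simp)+

text \<open>Normality of the sum is not invoked. If the fourth moment of Z is 3 v^2 and an
  independent increment of variance w is added, the terms with odd powers of the increment vanish,
  and 3 v^2 + 6 v w + 3 w^2 = 3 (v + w)^2.\<close>

lemma wiener_integral_moments:
  fixes h :: "nat \<Rightarrow> 'h" and \<tau> :: "nat \<Rightarrow> real"
  assumes \<tau>: "\<tau> 0 \<ge> 0" "\<And>j. \<tau> j \<le> \<tau> (Suc j)"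
  defines "Z \<equiv> \<lambda>n \<omega>. \<Sum>j<n. inner (W (\<tau> (Suc j)) \<omega> - W (\<tau> j) \<omega>) (h j)"
    and "v \<equiv> \<lambda>n. \<Sum>j<n. (\<tau> (Suc j) - \<tau> j) * inner (Q (h j)) (h j)"
  shows "Z n \<in> borel_measurable (Ft (\<tau> n))" "integrable M (\<lambda>\<omega>. Z n \<omega> ^ 4)"
    "(\<integral>\<omega>. Z n \<omega> ^ 2 \<partial>M) = v n" "(\<integral>\<omega>. Z n \<omega> ^ 4 \<partial>M) = 3 * (v n)\<^sup>2"
proof -
  have \<tau>0: "\<tau> n \<ge> 0" for n
    using order_trans[OF \<tau>(1) lift_Suc_mono_le[of \<tau>, OF \<tau>(2) le0[of n]]] .
  \<comment> \<open>Measurability at time \<tau> n is carried along because it is what makes the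
    partial sum independent of the next increment.\<close>
  have "Z n \<in> borel_measurable (Ft (\<tau> n)) \<and> integrable M (\<lambda>\<omega>. Z n \<omega> ^ 4) \<and>
    (\<integral>\<omega>. Z n \<omega> ^ 2 \<partial>M) = v n \<and> (\<integral>\<omega>. Z n \<omega> ^ 4 \<partial>M) = 3 * (v n)\<^sup>2"
  proof (induction n)
    case 0
    show ?case by (simp add: Z_def v_def)
  next
    case (Suc n)
    define D where "D \<omega> = W (\<tau> (Suc n)) \<omega> - W (\<tau> n) \<omega>" for \<omega>
    define N where "N \<omega> = inner (D \<omega>) (h n)" for \<omega>
    define w where "w = (\<tau> (Suc n) - \<tau> n) * inner (Q (h n)) (h n)"
    have ZS: "Z (Suc n) \<omega> = Z n \<omega> + N \<omega>" for \<omega> by (simp add: Z_def N_def D_def)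
    have vS: "v (Suc n) = v n + w" by (simp add: v_def w_def)
    note mom = dW_moments[OF \<tau>0[of n] \<tau>(2)[of n], of "h n", folded D_def, folded N_def w_def]
    have Zm: "Z n \<in> borel_measurable (Ft (\<tau> n))" and Z4: "integrable M (\<lambda>\<omega>. Z n \<omega> ^ 4)"
      and EZ: "(\<integral>\<omega>. Z n \<omega> ^ 2 \<partial>M) = v n" "(\<integral>\<omega>. Z n \<omega> ^ 4 \<partial>M) = 3 * (v n)\<^sup>2"
      using Suc.IH by auto
    have ZM: "Z n \<in> borel_measurable M" by (rule measurable_Ft_imp[OF \<tau>0 Zm])
    have Zi: "integrable M (\<lambda>\<omega>. Z n \<omega> ^ k)" if "k \<le> 4" for k
      by (rule integrable_power_mono[OF Z4 ZM that]) simp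
    have prod: "integrable M (\<lambda>\<omega>. Z n \<omega> ^ k * N \<omega> ^ l)"
      "(\<integral>\<omega>. Z n \<omega> ^ k * N \<omega> ^ l \<partial>M) = (\<integral>\<omega>. Z n \<omega> ^ k \<partial>M) * (\<integral>\<omega>. N \<omega> ^ l \<partial>M)" if "k \<le> 4" for k l
    proof -
      have \<phi>: "(\<lambda>x. inner x (h n) ^ l) \<in> borel_measurable borel"
        using borel_measurable_inner_const by measurable
      have Zk: "(\<lambda>\<omega>. Z n \<omega> ^ k) \<in> borel_measurable (Ft (\<tau> n))" using Zm by measurable
      have Ni: "integrable M (\<lambda>\<omega>. inner (D \<omega>) (h n) ^ l)" using mom(1) by (simp add: N_def)
      note r = indep_set_integral_mult[OF dW_indep[OF \<tau>0[of n] \<tau>(2)[of n], folded D_def] F_sigma[OF \<tau>0[of n]]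
          Zk \<phi> Zi[OF that] Ni]
      show "integrable M (\<lambda>\<omega>. Z n \<omega> ^ k * N \<omega> ^ l)"
        "(\<integral>\<omega>. Z n \<omega> ^ k * N \<omega> ^ l \<partial>M) = (\<integral>\<omega>. Z n \<omega> ^ k \<partial>M) * (\<integral>\<omega>. N \<omega> ^ l \<partial>M)"
        using r by (simp_all add: N_def)
    qed
    have p2: "Z (Suc n) \<omega> ^ 2 = Z n \<omega> ^ 2 + 2 * (Z n \<omega> ^ 1 * N \<omega> ^ 1) + N \<omega> ^ 2" for \<omega>
      by (simp add: ZS power2_sum)
    have p4: "Z (Suc n) \<omega> ^ 4 = Z n \<omega> ^ 4 + 4 * (Z n \<omega> ^ 3 * N \<omega> ^ 1) + 6 * (Z n \<omega> ^ 2 * N \<omega> ^ 2)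
        + 4 * (Z n \<omega> ^ 1 * N \<omega> ^ 3) + N \<omega> ^ 4" for \<omega>
      unfolding ZS by (simp add: algebra_simps power4_eq_xxxx power3_eq_cube power2_eq_square)
    have "Z (Suc n) \<in> borel_measurable (Ft (\<tau> (Suc n)))"
    proof -
      have "Z n \<in> borel_measurable (Ft (\<tau> (Suc n)))"
        by (rule measurable_Ft_mono[OF \<tau>0 \<tau>(2) Zm])
      moreover have "N \<in> borel_measurable (Ft (\<tau> (Suc n)))"
        unfolding N_def D_def by (rule dW_Ft[OF \<tau>0 \<tau>(2)])
      ultimately show ?thesis unfolding ZS by measurable
    qed
    moreover have "integrable M (\<lambda>\<omega>. Z (Suc n) \<omega> ^ 4)"
      unfolding p4 by (intro Bochner_Integration.integrable_add integrable_mult_right prod Z4 mom) auto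
    moreover have "(\<integral>\<omega>. Z (Suc n) \<omega> ^ 2 \<partial>M) = v (Suc n)"
      using prod[of 1 1] Zi[of 2] mom EZ unfolding p2 vS by simp
    moreover have "(\<integral>\<omega>. Z (Suc n) \<omega> ^ 4 \<partial>M) = 3 * (v (Suc n))\<^sup>2"
    proof -
      have "(\<integral>\<omega>. Z (Suc n) \<omega> ^ 4 \<partial>M) = 3 * (v n)\<^sup>2 + 6 * (v n * w) + 3 * w\<^sup>2"
        using prod[of 3 1] prod[of 2 2] prod[of 1 3] Z4 mom EZ unfolding p4 by simp
      then show ?thesis unfolding vS by (simp add: power2_sum algebra_simps)
    qed
    ultimately show ?case by blast
  qed
  then show "Z n \<in> borel_measurable (Ft (\<tau> n))" "integrable M (\<lambda>\<omega>. Z n \<omega> ^ 4)"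
    "(\<integral>\<omega>. Z n \<omega> ^ 2 \<partial>M) = v n" "(\<integral>\<omega>. Z n \<omega> ^ 4 \<partial>M) = 3 * (v n)\<^sup>2" by auto
qed

end

section \<open>Wiener sums and their limits\<close>

text \<open>Mean-square convergence yields almost sure convergence along a subsequence, and Fatou's
  lemma then transfers the bound on fourth moments.\<close>

lemma (in hilbert_basis) nn_integral_norm4_L2_limit:
  fixes U :: "'w \<Rightarrow> 'h" and V :: "nat \<Rightarrow> 'w \<Rightarrow> 'h"
  assumes U: "\<And>h. (\<lambda>\<omega>. inner (U \<omega>) h) \<in> borel_measurable M"
    and V: "\<And>m h. (\<lambda>\<omega>. inner (V m \<omega>) h) \<in> borel_measurable M"
    and lim: "(\<lambda>m. \<integral>\<^sup>+\<omega>. ennreal ((norm (U \<omega> - V m \<omega>))\<^sup>2) \<partial>M) \<longlonglongrightarrow> 0"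
    and bd: "\<And>m. (\<integral>\<^sup>+\<omega>. (ennreal ((norm (V m \<omega>))\<^sup>2))\<^sup>2 \<partial>M) \<le> c"
  shows "(\<integral>\<^sup>+\<omega>. (ennreal ((norm (U \<omega>))\<^sup>2))\<^sup>2 \<partial>M) \<le> c"
proof -
  have mU[measurable]: "(\<lambda>\<omega>. (norm (U \<omega>))\<^sup>2) \<in> borel_measurable M" by (rule measurable_norm_sq[OF U])
  have mV[measurable]: "(\<lambda>\<omega>. (norm (V m \<omega>))\<^sup>2) \<in> borel_measurable M" for m by (rule measurable_norm_sq[OF V])
  have mUV[measurable]: "(\<lambda>\<omega>. (norm (U \<omega> - V m \<omega>))\<^sup>2) \<in> borel_measurable M" for m
    by (rule measurable_norm_sq) (use U V in \<open>simp add: inner_diff_left\<close>)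
  have "\<forall>\<^sub>F m in sequentially. (\<integral>\<^sup>+\<omega>. ennreal ((norm (U \<omega> - V m \<omega>))\<^sup>2) \<partial>M) < 1"
    by (rule order_tendstoD(2)[OF lim]) simp
  then obtain m0 where m0: "\<And>m. m \<ge> m0 \<Longrightarrow> (\<integral>\<^sup>+\<omega>. ennreal ((norm (U \<omega> - V m \<omega>))\<^sup>2) \<partial>M) < 1"
    by (auto simp: eventually_sequentially)
  \<comment> \<open>The shift by \<open>m0\<close> makes every member integrable; extracting an
    almost surely convergent subsequence in L^1 asks for this from the first index on.\<close>
  define u where "u m = (\<lambda>\<omega>. (norm (U \<omega> - V (m + m0) \<omega>))\<^sup>2)" for m
  have i: "integrable M (u m)" for m
  proof (rule integrableI_bounded)
    show "(\<integral>\<^sup>+\<omega>. ennreal (norm (u m \<omega>)) \<partial>M) < \<infinity>"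
      using m0[of "m + m0"] by (auto simp: u_def intro: less_trans)
  qed (simp add: u_def)
  have en: "(\<integral>\<^sup>+\<omega>. ennreal ((norm (U \<omega> - V (m + m0) \<omega>))\<^sup>2) \<partial>M) = ennreal (\<integral>\<omega>. norm (u m \<omega>) \<partial>M)" for m
    using nn_integral_eq_integral[OF i[of m]] by (simp add: u_def)
  have "(\<lambda>m. ennreal (\<integral>\<omega>. norm (u m \<omega>) \<partial>M)) \<longlonglongrightarrow> ennreal 0"
    using LIMSEQ_ignore_initial_segment[OF lim, of m0] unfolding en by simp
  then have "(\<lambda>m. \<integral>\<omega>. norm (u m \<omega>) \<partial>M) \<longlonglongrightarrow> 0"
    by (subst (asm) tendsto_ennreal_iff) auto
  then obtain r where r: "strict_mono (r :: nat \<Rightarrow> nat)" "AE \<omega> in M. (\<lambda>m. u (r m) \<omega>) \<longlonglongrightarrow> 0"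
    using tendsto_L1_AE_subseq[of M u, OF i] by blast
  have "AE \<omega> in M. (ennreal ((norm (U \<omega>))\<^sup>2))\<^sup>2
     = liminf (\<lambda>m. (ennreal ((norm (V (r m + m0) \<omega>))\<^sup>2))\<^sup>2)"
    using r(2)
  proof eventually_elim
    case (elim \<omega>)
    have "(\<lambda>m. sqrt (u (r m) \<omega>)) \<longlonglongrightarrow> sqrt 0" by (intro tendsto_intros elim)
    then have d: "(\<lambda>m. norm (U \<omega> - V (r m + m0) \<omega>)) \<longlonglongrightarrow> 0" by (simp add: u_def)
    have "(\<lambda>m. norm (V (r m + m0) \<omega>)) \<longlonglongrightarrow> norm (U \<omega>)"
    proof (rule LIM_zero_cancel)
      show "(\<lambda>m. norm (V (r m + m0) \<omega>) - norm (U \<omega>)) \<longlonglongrightarrow> 0"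
        by (rule Lim_null_comparison[OF _ d]) (simp add: norm_triangle_ineq3 norm_minus_commute[of "U \<omega>"])
    qed
    then have "(\<lambda>m. ennreal (((norm (V (r m + m0) \<omega>))\<^sup>2)\<^sup>2)) \<longlonglongrightarrow> ennreal (((norm (U \<omega>))\<^sup>2)\<^sup>2)"
      by (intro tendsto_ennrealI tendsto_power)
    then have "(\<lambda>m. (ennreal ((norm (V (r m + m0) \<omega>))\<^sup>2))\<^sup>2) \<longlonglongrightarrow> (ennreal ((norm (U \<omega>))\<^sup>2))\<^sup>2"
      by (simp add: ennreal_power)
    then show ?case by (intro lim_imp_Liminf[symmetric]) auto
  qed
  then have "(\<integral>\<^sup>+\<omega>. (ennreal ((norm (U \<omega>))\<^sup>2))\<^sup>2 \<partial>M)
     = (\<integral>\<^sup>+\<omega>. liminf (\<lambda>m. (ennreal ((norm (V (r m + m0) \<omega>))\<^sup>2))\<^sup>2) \<partial>M)"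
    by (rule nn_integral_cong_AE)
  also have "\<dots> \<le> liminf (\<lambda>m. \<integral>\<^sup>+\<omega>. (ennreal ((norm (V (r m + m0) \<omega>))\<^sup>2))\<^sup>2 \<partial>M)"
    by (rule nn_integral_liminf) measurable
  also have "\<dots> \<le> limsup (\<lambda>m. \<integral>\<^sup>+\<omega>. (ennreal ((norm (V (r m + m0) \<omega>))\<^sup>2))\<^sup>2 \<partial>M)"
    by (rule Liminf_le_Limsup) simp
  also have "\<dots> \<le> c" by (rule Limsup_bounded) (simp add: bd)
  finally show ?thesis .
qed

section \<open>Wiener sums with operator integrands, and covariances of increments\<close>

context wiener_setting
begin

text \<open>A model for the law N(0, Q) on the given probability space. Traces of B Q B become
  expectations of |B N|^2, so facts about single orbits, such as pointwise convergence and
  domination by |x|^2, can be integrated.\<close>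

definition N :: "'w \<Rightarrow> 'h" where "N \<omega> = W 1 \<omega> - W 0 \<omega>"

lemma N_measurable [measurable]: "(\<lambda>\<omega>. inner (N \<omega>) h) \<in> borel_measurable M"
  unfolding N_def by (rule dW_measurable) auto

lemma nn_integral_inner_N: "(\<integral>\<^sup>+\<omega>. ennreal ((inner (N \<omega>) h)\<^sup>2) \<partial>M) = ennreal (inner (Q h) h)"
proof -
  have "(\<integral>\<^sup>+\<omega>. ennreal ((inner (N \<omega>) h)\<^sup>2) \<partial>M) = ennreal (\<integral>\<omega>. (inner (N \<omega>) h)\<^sup>2 \<partial>M)"
    unfolding N_def by (intro nn_integral_eq_integral dW_moments) auto
  then show ?thesis using dW_moments(3)[of 0 1 h] by (simp add: N_def)
qed

lemma norm_image_N_measurable: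
  assumes "\<And>x y. inner (B x) y = inner x (B y)"
  shows "(\<lambda>\<omega>. (norm (B (N \<omega>)))\<^sup>2) \<in> borel_measurable M"
  by (rule measurable_norm_sq) (simp add: assms)

lemma nn_integral_norm_image_N:
  assumes B: "\<And>x y. inner (B x) y = inner x (B y)"
  shows "(\<integral>\<^sup>+\<omega>. ennreal ((norm (B (N \<omega>)))\<^sup>2) \<partial>M) = (\<Sum>k. ennreal (inner (Q (B (e k))) (B (e k))))"
proof -
  have "(\<integral>\<^sup>+\<omega>. ennreal ((norm (B (N \<omega>)))\<^sup>2) \<partial>M)
      = (\<integral>\<^sup>+\<omega>. (\<Sum>k. ennreal ((inner (N \<omega>) (B (e k)))\<^sup>2)) \<partial>M)"
    unfolding parseval_ennreal[symmetric] B ..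
  also have "\<dots> = (\<Sum>k. \<integral>\<^sup>+\<omega>. ennreal ((inner (N \<omega>) (B (e k)))\<^sup>2) \<partial>M)"
    by (rule nn_integral_suminf) measurable
  finally show ?thesis by (simp add: nn_integral_inner_N)
qed

lemma nn_integral_norm_N: "(\<integral>\<^sup>+\<omega>. ennreal ((norm (N \<omega>))\<^sup>2) \<partial>M) = (\<Sum>k. ennreal (inner (Q (e k)) (e k)))"
  using nn_integral_norm_image_N[of "\<lambda>x. x"] by simp

lemma nn_integral_norm_N_finite: "(\<integral>\<^sup>+\<omega>. ennreal ((norm (N \<omega>))\<^sup>2) \<partial>M) < \<infinity>"
  unfolding nn_integral_norm_N by (rule trace_bounded[OF Q_trace Q_pos])

text \<open>By symmetry of the operators, the coordinate of U along e k is a scalar Wiener sum with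
  integrands B j (e k), so its fourth moment is 3 (v k)^2. Minkowski adds the coordinates, and
  exchanging the sums over k and j turns the total variance into the weighted sum of the E|B j
  N|^2.\<close>

lemma
  fixes B :: "nat \<Rightarrow> 'h \<Rightarrow> 'h" and \<tau> :: "nat \<Rightarrow> real" and n :: nat
  assumes \<tau>: "\<tau> 0 \<ge> 0" "\<And>j. \<tau> j \<le> \<tau> (Suc j)"
    and B: "\<And>j x y. inner (B j x) y = inner x (B j y)"
  defines "U \<equiv> \<lambda>\<omega>. \<Sum>j<n. B j (W (\<tau> (Suc j)) \<omega> - W (\<tau> j) \<omega>)"
  shows wiener_sum_measurable: "(\<lambda>\<omega>. inner (U \<omega>) h) \<in> borel_measurable M"
    and wiener_sum_norm4: "(\<integral>\<^sup>+\<omega>. (ennreal ((norm (U \<omega>))\<^sup>2))\<^sup>2 \<partial>M)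
      \<le> 3 * (\<Sum>j<n. ennreal (\<tau> (Suc j) - \<tau> j) * (\<integral>\<^sup>+\<omega>. ennreal ((norm (B j (N \<omega>)))\<^sup>2) \<partial>M))\<^sup>2"
proof -
  have \<tau>0: "\<tau> n \<ge> 0" for n
    using order_trans[OF \<tau>(1) lift_Suc_mono_le[of \<tau>, OF \<tau>(2) le0[of n]]] .
  have Uh: "inner (U \<omega>) h = (\<Sum>j<n. inner (W (\<tau> (Suc j)) \<omega> - W (\<tau> j) \<omega>) (B j h))" for \<omega> h
    by (simp add: U_def inner_sum_left B)
  note mom = wiener_integral_moments[OF \<tau>, where h = "\<lambda>j. B j h" and n = n for h, folded Uh]
  show meas: "(\<lambda>\<omega>. inner (U \<omega>) h) \<in> borel_measurable M" for h
    by (rule measurable_Ft_imp[OF \<tau>0 mom(1)])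
  define v where "v k = (\<Sum>j<n. (\<tau> (Suc j) - \<tau> j) * inner (Q (B j (e k))) (B j (e k)))" for k
  have vpos: "v k \<ge> 0" for k unfolding v_def using \<tau>(2) Q_pos by (simp add: sum_nonneg)
  have "(\<integral>\<^sup>+\<omega>. (\<Sum>k. ennreal ((inner (U \<omega>) (e k))\<^sup>2))\<^sup>2 \<partial>M) \<le> 3 * (\<Sum>k. ennreal (v k))\<^sup>2"
  proof (rule nn_integral_suminf_square_le)
    fix k
    show "(\<lambda>\<omega>. ennreal ((inner (U \<omega>) (e k))\<^sup>2)) \<in> borel_measurable M" using meas by measurable
    have "(\<integral>\<^sup>+\<omega>. (ennreal ((inner (U \<omega>) (e k))\<^sup>2))\<^sup>2 \<partial>M) = (\<integral>\<^sup>+\<omega>. ennreal (inner (U \<omega>) (e k) ^ 4) \<partial>M)"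
      by (simp add: ennreal_power flip: power_mult)
    also have "\<dots> = ennreal (\<integral>\<omega>. inner (U \<omega>) (e k) ^ 4 \<partial>M)"
      by (intro nn_integral_eq_integral mom) (simp add: zero_le_even_power)
    also have "\<dots> = ennreal (3 * (v k)\<^sup>2)" unfolding mom(4) v_def ..
    also have "\<dots> = 3 * (ennreal (v k))\<^sup>2" using vpos by (simp add: ennreal_mult ennreal_power)
    finally show "(\<integral>\<^sup>+\<omega>. (ennreal ((inner (U \<omega>) (e k))\<^sup>2))\<^sup>2 \<partial>M) \<le> 3 * (ennreal (v k))\<^sup>2" by simp
  qed
  also have "(\<Sum>k. ennreal (v k))
      = (\<Sum>k. \<Sum>j<n. ennreal (\<tau> (Suc j) - \<tau> j) * ennreal (inner (Q (B j (e k))) (B j (e k))))"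
    unfolding v_def using \<tau>(2) Q_pos
    by (intro suminf_cong) (simp add: ennreal_mult flip: sum_ennreal)
  also have "\<dots> = (\<Sum>j<n. \<Sum>k. ennreal (\<tau> (Suc j) - \<tau> j) * ennreal (inner (Q (B j (e k))) (B j (e k))))"
    by (rule suminf_sum) simp
  also have "\<dots> = (\<Sum>j<n. ennreal (\<tau> (Suc j) - \<tau> j) * (\<integral>\<^sup>+\<omega>. ennreal ((norm (B j (N \<omega>)))\<^sup>2) \<partial>M))"
    by (simp add: nn_integral_norm_image_N[OF B])
  finally show "(\<integral>\<^sup>+\<omega>. (ennreal ((norm (U \<omega>))\<^sup>2))\<^sup>2 \<partial>M)
      \<le> 3 * (\<Sum>j<n. ennreal (\<tau> (Suc j) - \<tau> j) * (\<integral>\<^sup>+\<omega>. ennreal ((norm (B j (N \<omega>)))\<^sup>2) \<partial>M))\<^sup>2"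
    by (simp only: parseval_ennreal)
qed

lemma dW_norm4:
  assumes "0 \<le> s" "s \<le> t"
  shows "(\<integral>\<^sup>+\<omega>. (ennreal ((norm (W t \<omega> - W s \<omega>))\<^sup>2))\<^sup>2 \<partial>M)
    \<le> 3 * (ennreal (t - s) * (\<integral>\<^sup>+\<omega>. ennreal ((norm (N \<omega>))\<^sup>2) \<partial>M))\<^sup>2"
  using wiener_sum_norm4[of "\<lambda>j. if j = 0 then s else t" "\<lambda>_ x. x" 1] assms by simp

text \<open>The mean of a product of two coordinates comes from polarisation, its second moment from
  Cauchy-Schwarz between fourth moments; an upper bound with the factor 3 is enough. The last claim
  is a by-product: a variance is nonnegative, so the squared mean obeys the same bound.\<close>

lemma dW_product_moments:
  fixes g h :: 'h
  assumes st: "0 \<le> s" "s \<le> t"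
  defines "\<phi> \<equiv> \<lambda>x. inner x g * inner x h - (t - s) * inner (Q g) h"
  shows "integrable M (\<lambda>\<omega>. \<phi> (W t \<omega> - W s \<omega>))"
    and "(\<integral>\<omega>. \<phi> (W t \<omega> - W s \<omega>) \<partial>M) = 0"
    and "integrable M (\<lambda>\<omega>. (\<phi> (W t \<omega> - W s \<omega>))\<^sup>2)"
    and "(\<integral>\<omega>. (\<phi> (W t \<omega> - W s \<omega>))\<^sup>2 \<partial>M) \<le> 3 * (t - s)\<^sup>2 * (inner (Q g) g * inner (Q h) h)"
    and "((t - s) * inner (Q g) h)\<^sup>2 \<le> 3 * (t - s)\<^sup>2 * (inner (Q g) g * inner (Q h) h)"
proof -
  define D where "D \<omega> = W t \<omega> - W s \<omega>" for \<omega>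
  define q where "q = (t - s) * inner (Q g) h"
  note mom = dW_moments[OF st, folded D_def]
  have meas[measurable]: "(\<lambda>\<omega>. inner (D \<omega>) z) \<in> borel_measurable M" for z
    unfolding D_def by (rule dW_measurable[OF st])
  have polar: "inner (D \<omega>) g * inner (D \<omega>) h
      = ((inner (D \<omega>) (g + h))\<^sup>2 - (inner (D \<omega>) g)\<^sup>2 - (inner (D \<omega>) h)\<^sup>2) / 2" for \<omega>
    by (simp add: inner_add_right power2_eq_square algebra_simps)
  have i2: "integrable M (\<lambda>\<omega>. inner (D \<omega>) g * inner (D \<omega>) h)"
    unfolding polar by (intro Bochner_Integration.integrable_diff integrable_divide_zero mom)
  have Qgh: "inner (Q (g + h)) (g + h) = inner (Q g) g + 2 * inner (Q g) h + inner (Q h) h"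
    using Q_lin Q_sym[of h g]
    by (simp add: linear_add[OF bounded_linear.linear] inner_add_left inner_add_right inner_commute)
  have "(\<integral>\<omega>. inner (D \<omega>) g * inner (D \<omega>) h \<partial>M)
      = ((\<integral>\<omega>. (inner (D \<omega>) (g + h))\<^sup>2 \<partial>M) - (\<integral>\<omega>. (inner (D \<omega>) g)\<^sup>2 \<partial>M)
          - (\<integral>\<omega>. (inner (D \<omega>) h)\<^sup>2 \<partial>M)) / 2"
    unfolding polar by (simp only: integral_divide_zero Bochner_Integration.integral_diff
        Bochner_Integration.integrable_diff mom(1))
  then have E2: "(\<integral>\<omega>. inner (D \<omega>) g * inner (D \<omega>) h \<partial>M) = q"
    unfolding mom(3) Qgh by (simp add: q_def algebra_simps)
  have i4: "integrable M (\<lambda>\<omega>. (inner (D \<omega>) g * inner (D \<omega>) h)\<^sup>2)"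
  proof (rule Bochner_Integration.integrable_bound)
    show "integrable M (\<lambda>\<omega>. inner (D \<omega>) g ^ 4 + inner (D \<omega>) h ^ 4)"
      by (intro Bochner_Integration.integrable_add mom)
    show "AE \<omega> in M. norm ((inner (D \<omega>) g * inner (D \<omega>) h)\<^sup>2) \<le> norm (inner (D \<omega>) g ^ 4 + inner (D \<omega>) h ^ 4)"
    proof (rule AE_I2)
      fix \<omega>
      have "2 * (a * b) \<le> a\<^sup>2 + b\<^sup>2" for a b :: real
        using zero_le_power2[of "a - b"] by (simp add: power2_eq_square algebra_simps)
      from this[of "(inner (D \<omega>) g)\<^sup>2" "(inner (D \<omega>) h)\<^sup>2"]
      have "2 * (inner (D \<omega>) g * inner (D \<omega>) h)\<^sup>2 \<le> inner (D \<omega>) g ^ 4 + inner (D \<omega>) h ^ 4"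
        by (simp add: power_mult_distrib flip: power_mult)
      moreover have "0 \<le> (inner (D \<omega>) g * inner (D \<omega>) h)\<^sup>2" by simp
      ultimately show "norm ((inner (D \<omega>) g * inner (D \<omega>) h)\<^sup>2) \<le> norm (inner (D \<omega>) g ^ 4 + inner (D \<omega>) h ^ 4)"
        by (simp only: real_norm_def)
    qed
  qed measurable
  have gpos: "(t - s) * inner (Q z) z \<ge> 0" for z using st Q_pos by simp
  have n4: "(\<integral>\<^sup>+\<omega>. (ennreal ((inner (D \<omega>) z)\<^sup>2))\<^sup>2 \<partial>M) = 3 * (ennreal ((t - s) * inner (Q z) z))\<^sup>2" for z
  proof -
    have "(\<integral>\<^sup>+\<omega>. (ennreal ((inner (D \<omega>) z)\<^sup>2))\<^sup>2 \<partial>M) = (\<integral>\<^sup>+\<omega>. ennreal (inner (D \<omega>) z ^ 4) \<partial>M)"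
      by (simp add: ennreal_power flip: power_mult)
    also have "\<dots> = ennreal (\<integral>\<omega>. inner (D \<omega>) z ^ 4 \<partial>M)"
      by (intro nn_integral_eq_integral mom) (simp add: zero_le_even_power)
    also have "\<dots> = ennreal (3 * ((t - s) * inner (Q z) z)\<^sup>2)" unfolding mom(5) ..
    also have "\<dots> = 3 * (ennreal ((t - s) * inner (Q z) z))\<^sup>2"
      by (simp only: ennreal_mult ennreal_power[OF gpos] ennreal_numeral zero_le_power2 zero_le_numeral)
    finally show ?thesis .
  qed
  have "(\<integral>\<^sup>+\<omega>. ennreal ((inner (D \<omega>) g)\<^sup>2) * ennreal ((inner (D \<omega>) h)\<^sup>2) \<partial>M)
      \<le> 3 * (ennreal ((t - s) * inner (Q g) g) * ennreal ((t - s) * inner (Q h) h))"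
  proof (rule ennreal_power2_le_imp_le)
    have "(\<integral>\<^sup>+\<omega>. ennreal ((inner (D \<omega>) g)\<^sup>2) * ennreal ((inner (D \<omega>) h)\<^sup>2) \<partial>M)\<^sup>2
      \<le> (\<integral>\<^sup>+\<omega>. (ennreal ((inner (D \<omega>) g)\<^sup>2))\<^sup>2 \<partial>M) * (\<integral>\<^sup>+\<omega>. (ennreal ((inner (D \<omega>) h)\<^sup>2))\<^sup>2 \<partial>M)"
      by (rule Cauchy_Schwarz_nn_integral) measurable
    also have "\<dots> = (3 * (ennreal ((t - s) * inner (Q g) g) * ennreal ((t - s) * inner (Q h) h)))\<^sup>2"
      unfolding n4 by (simp only: power2_eq_square mult_ac)
    finally show "(\<integral>\<^sup>+\<omega>. ennreal ((inner (D \<omega>) g)\<^sup>2) * ennreal ((inner (D \<omega>) h)\<^sup>2) \<partial>M)\<^sup>2 \<le> \<dots>" .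
  qed
  also have "\<dots> = ennreal (3 * (t - s)\<^sup>2 * (inner (Q g) g * inner (Q h) h))"
  proof -
    have "3 * (t - s)\<^sup>2 * (inner (Q g) g * inner (Q h) h)
        = 3 * (((t - s) * inner (Q g) g) * ((t - s) * inner (Q h) h))"
      by (simp add: power2_eq_square)
    then show ?thesis by (simp only: ennreal_mult gpos mult_nonneg_nonneg ennreal_numeral zero_le_numeral)
  qed
  also have "(\<integral>\<^sup>+\<omega>. ennreal ((inner (D \<omega>) g)\<^sup>2) * ennreal ((inner (D \<omega>) h)\<^sup>2) \<partial>M)
      = ennreal (\<integral>\<omega>. (inner (D \<omega>) g * inner (D \<omega>) h)\<^sup>2 \<partial>M)"
    using nn_integral_eq_integral[OF i4] by (simp add: ennreal_mult power_mult_distrib)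
  finally have E4: "(\<integral>\<omega>. (inner (D \<omega>) g * inner (D \<omega>) h)\<^sup>2 \<partial>M) \<le> 3 * (t - s)\<^sup>2 * (inner (Q g) g * inner (Q h) h)"
    using Q_pos by (simp add: ennreal_le_iff)
  have sq: "(\<phi> (D \<omega>))\<^sup>2 = (inner (D \<omega>) g * inner (D \<omega>) h)\<^sup>2 - 2 * q * (inner (D \<omega>) g * inner (D \<omega>) h) + q\<^sup>2" for \<omega>
    by (simp add: \<phi>_def q_def power2_diff)
  show "integrable M (\<lambda>\<omega>. \<phi> (W t \<omega> - W s \<omega>))" using i2 by (simp add: \<phi>_def flip: D_def)
  show "(\<integral>\<omega>. \<phi> (W t \<omega> - W s \<omega>) \<partial>M) = 0"
    using i2 E2 by (simp add: \<phi>_def q_def prob_space flip: D_def)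
  show "integrable M (\<lambda>\<omega>. (\<phi> (W t \<omega> - W s \<omega>))\<^sup>2)"
    unfolding D_def[symmetric] sq using i2 i4 by simp
  have Ephi: "(\<integral>\<omega>. (\<phi> (D \<omega>))\<^sup>2 \<partial>M) = (\<integral>\<omega>. (inner (D \<omega>) g * inner (D \<omega>) h)\<^sup>2 \<partial>M) - q\<^sup>2"
    unfolding sq using i2 i4 E2 by (simp add: prob_space power2_eq_square)
  then show "(\<integral>\<omega>. (\<phi> (W t \<omega> - W s \<omega>))\<^sup>2 \<partial>M) \<le> 3 * (t - s)\<^sup>2 * (inner (Q g) g * inner (Q h) h)"
    unfolding D_def[symmetric] using E4 zero_le_power2[of q] by linarith
  have "0 \<le> (\<integral>\<omega>. (\<phi> (D \<omega>))\<^sup>2 \<partial>M)" by simp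
  with Ephi E4 show "((t - s) * inner (Q g) h)\<^sup>2 \<le> 3 * (t - s)\<^sup>2 * (inner (Q g) g * inner (Q h) h)"
    unfolding q_def by linarith
qed

text \<open>The summands are centred and each is independent of the past, so cross terms have
  expectation zero and second moments add up. They amount to n terms of order \<Delta>^2, which is
  of order \<Delta> when n \<Delta> is bounded.\<close>

lemma covariance_fluctuation:
  fixes g h :: 'h
  assumes D: "\<Delta> \<ge> 0"
  defines "G \<equiv> \<lambda>n \<omega>. \<Sum>i<n. inner (W (real (Suc i) * \<Delta>) \<omega> - W (real i * \<Delta>) \<omega>) g
       * inner (W (real (Suc i) * \<Delta>) \<omega> - W (real i * \<Delta>) \<omega>) h - \<Delta> * inner (Q g) h"
  shows "G n \<in> borel_measurable M"
    and "(\<integral>\<^sup>+\<omega>. ennreal ((G n \<omega>)\<^sup>2) \<partial>M) \<le> ennreal (real n * (3 * \<Delta>\<^sup>2 * (inner (Q g) g * inner (Q h) h)))"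
proof -
  define c where "c = 3 * \<Delta>\<^sup>2 * (inner (Q g) g * inner (Q h) h)"
  define \<phi> where "\<phi> x = inner x g * inner x h - \<Delta> * inner (Q g) h" for x
  have \<phi>m: "\<phi> \<in> borel_measurable borel"
    unfolding \<phi>_def using borel_measurable_inner_const by measurable
  have main: "G n \<in> borel_measurable (Ft (real n * \<Delta>)) \<and> integrable M (\<lambda>\<omega>. (G n \<omega>)\<^sup>2)
    \<and> (\<integral>\<omega>. (G n \<omega>)\<^sup>2 \<partial>M) \<le> real n * c" for n
  proof (induction n)
    case 0 show ?case by (simp add: G_def)
  next
    case (Suc n)
    have st: "0 \<le> real n * \<Delta>" "real n * \<Delta> \<le> real (Suc n) * \<Delta>" "0 \<le> real (Suc n) * \<Delta>"
      using D by (auto intro: mult_right_mono)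
    have tms: "real (Suc n) * \<Delta> - real n * \<Delta> = \<Delta>" by (simp add: algebra_simps)
    define D' where "D' \<omega> = W (real (Suc n) * \<Delta>) \<omega> - W (real n * \<Delta>) \<omega>" for \<omega>
    note mom = dW_product_moments[OF st(1,2), of g h, unfolded tms, folded D'_def \<phi>_def c_def]
    have GS: "G (Suc n) \<omega> = G n \<omega> + \<phi> (D' \<omega>)" for \<omega> by (simp add: G_def D'_def \<phi>_def)
    have Gm: "G n \<in> borel_measurable (Ft (real n * \<Delta>))" and Gi: "integrable M (\<lambda>\<omega>. (G n \<omega>)\<^sup>2)"
      and GE: "(\<integral>\<omega>. (G n \<omega>)\<^sup>2 \<partial>M) \<le> real n * c" using Suc.IH by auto
    have GM: "G n \<in> borel_measurable M" by (rule measurable_Ft_imp[OF st(1) Gm])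
    have G1: "integrable M (G n)"
      using integrable_power_mono[OF Gi GM, of 1] by simp
    note prod = indep_set_integral_mult[OF dW_indep[OF st(1,2), folded D'_def] F_sigma[OF st(1)]
        Gm \<phi>m G1 mom(1)]
    have p2: "(G (Suc n) \<omega>)\<^sup>2 = (G n \<omega>)\<^sup>2 + 2 * (G n \<omega> * \<phi> (D' \<omega>)) + (\<phi> (D' \<omega>))\<^sup>2" for \<omega>
      by (simp add: GS power2_sum)
    have "G (Suc n) \<in> borel_measurable (Ft (real (Suc n) * \<Delta>))"
    proof -
      have "G n \<in> borel_measurable (Ft (real (Suc n) * \<Delta>))"
        by (rule measurable_Ft_mono[OF st(1,2) Gm])
      moreover have "(\<lambda>\<omega>. inner (D' \<omega>) z) \<in> borel_measurable (Ft (real (Suc n) * \<Delta>))" for z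
        unfolding D'_def by (rule dW_Ft[OF st(1,2)])
      ultimately show ?thesis unfolding GS \<phi>_def by measurable
    qed
    moreover have "integrable M (\<lambda>\<omega>. (G (Suc n) \<omega>)\<^sup>2)"
      unfolding p2 using prod mom Gi by simp
    moreover have "(\<integral>\<omega>. (G (Suc n) \<omega>)\<^sup>2 \<partial>M) = (\<integral>\<omega>. (G n \<omega>)\<^sup>2 \<partial>M) + (\<integral>\<omega>. (\<phi> (D' \<omega>))\<^sup>2 \<partial>M)"
      unfolding p2 using prod mom Gi by simp
    then have "(\<integral>\<omega>. (G (Suc n) \<omega>)\<^sup>2 \<partial>M) \<le> real (Suc n) * c"
      using mom(4) GE by (simp add: algebra_simps)
    ultimately show ?case by blast
  qed
  show "G n \<in> borel_measurable M"
    using main D by (intro measurable_Ft_imp[of "real n * \<Delta>"]) auto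
  have "(\<integral>\<^sup>+\<omega>. ennreal ((G n \<omega>)\<^sup>2) \<partial>M) = ennreal (\<integral>\<omega>. (G n \<omega>)\<^sup>2 \<partial>M)"
    using main by (intro nn_integral_eq_integral) auto
  also have "\<dots> \<le> ennreal (real n * c)" using main by (intro ennreal_leI) auto
  finally show "(\<integral>\<^sup>+\<omega>. ennreal ((G n \<omega>)\<^sup>2) \<partial>M) \<le> ennreal (real n * (3 * \<Delta>\<^sup>2 * (inner (Q g) g * inner (Q h) h)))"
    unfolding c_def .
qed

end

section \<open>Increments of the stochastic convolution\<close>

locale ou_setting = symmetric_semigroup DA A S + wiener_setting M e F Q W
  for DA :: "'h::{real_inner, complete_space} set" and A :: "'h \<Rightarrow> 'h" and S :: "real \<Rightarrow> 'h \<Rightarrow> 'h"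
    and M :: "'w measure" and e :: "nat \<Rightarrow> 'h" and F Q W +
  fixes Y :: "real \<Rightarrow> 'w \<Rightarrow> 'h"
  assumes conv: "stochastic_convolution M S W Y"
begin

section \<open>Orbit increments of S averaged over the Gaussian vector\<close>

definition orbit_mean :: "real \<Rightarrow> nat \<Rightarrow> ennreal" where
  "orbit_mean \<Delta> n = (\<integral>\<^sup>+\<omega>. ennreal (orbit_variation \<Delta> n (N \<omega>)) \<partial>M)"

text \<open>The mean-square modulus of continuity of S at time 0 along N. The supremum over s gives
  one bound for all grid cells in the block of the current increment.\<close>

definition modulus :: "real \<Rightarrow> ennreal" where
  "modulus \<Delta> = (SUP s\<in>{0..\<Delta>}. \<integral>\<^sup>+\<omega>. ennreal ((norm (S s (N \<omega>) - N \<omega>))\<^sup>2) \<partial>M)"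

lemma S_diff_symmetric:
  "a \<ge> 0 \<Longrightarrow> b \<ge> 0 \<Longrightarrow> inner (S a x - S b x) y = inner x (S a y - S b y)"
  by (simp add: inner_diff_left inner_diff_right S_symmetric)

lemma S_N_measurable [measurable]:
  "a \<ge> 0 \<Longrightarrow> b \<ge> 0 \<Longrightarrow> (\<lambda>\<omega>. (norm (S a (N \<omega>) - S b (N \<omega>)))\<^sup>2) \<in> borel_measurable M"
  by (rule norm_image_N_measurable[of "\<lambda>x. S a x - S b x"]) (rule S_diff_symmetric)

lemma orbit_variation_measurable:
  assumes "\<Delta> \<ge> 0" and U: "\<And>h. (\<lambda>\<omega>. inner (U \<omega>) h) \<in> borel_measurable M"
  shows "(\<lambda>\<omega>. orbit_variation \<Delta> n (U \<omega>)) \<in> borel_measurable M"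
  unfolding orbit_variation_def
  by (intro borel_measurable_sum measurable_norm_sq) (use assms in \<open>simp add: S_diff_symmetric\<close>)

lemma orbit_mean_mono: "m \<le> n \<Longrightarrow> orbit_mean \<Delta> m \<le> orbit_mean \<Delta> n"
  unfolding orbit_mean_def orbit_variation_def
  by (intro nn_integral_mono ennreal_leI sum_mono2) auto

lemma orbit_mean_tendsto_0:
  assumes d: "\<And>k. d k > 0" "d \<longlonglongrightarrow> 0" and n: "\<And>k. real (n k) * d k \<le> T"
  shows "(\<lambda>k. orbit_mean (d k) (n k)) \<longlonglongrightarrow> 0"
proof -
  have "(\<lambda>k. \<integral>\<^sup>+\<omega>. ennreal (orbit_variation (d k) (n k) (N \<omega>)) \<partial>M) \<longlonglongrightarrow> (\<integral>\<^sup>+\<omega>. 0 \<partial>M)"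
  proof (rule nn_integral_dominated_convergence[where w = "\<lambda>\<omega>. ennreal ((norm (N \<omega>))\<^sup>2)"])
    show "(\<lambda>\<omega>. ennreal (orbit_variation (d k) (n k) (N \<omega>))) \<in> borel_measurable M" for k
      using orbit_variation_measurable[OF less_imp_le[OF d(1)] N_measurable] by measurable
    show "(\<lambda>\<omega>. ennreal ((norm (N \<omega>))\<^sup>2)) \<in> borel_measurable M"
      using measurable_norm_sq[OF N_measurable] by measurable
    show "AE \<omega> in M. ennreal (orbit_variation (d k) (n k) (N \<omega>)) \<le> ennreal ((norm (N \<omega>))\<^sup>2)" for k
      using orbit_variation_le[OF less_imp_le[OF d(1)]] by (intro AE_I2 ennreal_leI)
    show "(\<integral>\<^sup>+\<omega>. ennreal ((norm (N \<omega>))\<^sup>2) \<partial>M) < \<infinity>" by (rule nn_integral_norm_N_finite)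
    show "AE \<omega> in M. (\<lambda>k. ennreal (orbit_variation (d k) (n k) (N \<omega>))) \<longlonglongrightarrow> 0"
      using tendsto_ennrealI[OF orbit_variation_tendsto_0[OF d n]] by (intro AE_I2) simp
  qed simp
  then show ?thesis by (simp add: orbit_mean_def)
qed

lemma mean_square_S_N_tendsto_0:
  "((\<lambda>s. \<integral>\<^sup>+\<omega>. ennreal ((norm (S s (N \<omega>) - N \<omega>))\<^sup>2) \<partial>M) \<longlongrightarrow> 0) (at_right 0)"
proof (rule tendsto_at_right_sequentially[where b = 1])
  fix s :: "nat \<Rightarrow> real" assume s: "\<And>n. 0 < s n" "s \<longlonglongrightarrow> 0"
  have dr: "filterlim s (at_right 0) sequentially"
    by (intro tendsto_imp_filterlim_at_right s(2)) (simp add: s(1))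
  have m: "(\<lambda>\<omega>. ennreal ((norm (N \<omega>))\<^sup>2)) \<in> borel_measurable M"
    using measurable_norm_sq[OF N_measurable] by measurable
  have "(\<lambda>n. \<integral>\<^sup>+\<omega>. ennreal ((norm (S (s n) (N \<omega>) - N \<omega>))\<^sup>2) \<partial>M) \<longlonglongrightarrow> (\<integral>\<^sup>+\<omega>. 0 \<partial>M)"
  proof (rule nn_integral_dominated_convergence[where w = "\<lambda>\<omega>. ennreal 4 * ennreal ((norm (N \<omega>))\<^sup>2)"])
    show "(\<lambda>\<omega>. ennreal ((norm (S (s n) (N \<omega>) - N \<omega>))\<^sup>2)) \<in> borel_measurable M" for n
      using S_N_measurable[of "s n" 0] less_imp_le[OF s(1)] by simp
    show "(\<lambda>\<omega>. ennreal 4 * ennreal ((norm (N \<omega>))\<^sup>2)) \<in> borel_measurable M" using m by measurable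
    show "AE \<omega> in M. ennreal ((norm (S (s n) (N \<omega>) - N \<omega>))\<^sup>2) \<le> ennreal 4 * ennreal ((norm (N \<omega>))\<^sup>2)" for n
    proof (rule AE_I2)
      fix \<omega>
      have "norm (S (s n) (N \<omega>) - N \<omega>) \<le> 2 * norm (N \<omega>)"
        using norm_triangle_ineq4[of "S (s n) (N \<omega>)" "N \<omega>"] S_contraction[OF less_imp_le[OF s(1)[of n]], of "N \<omega>"]
        by linarith
      then have "(norm (S (s n) (N \<omega>) - N \<omega>))\<^sup>2 \<le> (2 * norm (N \<omega>))\<^sup>2" by (intro power_mono) auto
      then have "(norm (S (s n) (N \<omega>) - N \<omega>))\<^sup>2 \<le> 4 * (norm (N \<omega>))\<^sup>2" by (simp add: power_mult_distrib)
      then show "ennreal ((norm (S (s n) (N \<omega>) - N \<omega>))\<^sup>2) \<le> ennreal 4 * ennreal ((norm (N \<omega>))\<^sup>2)"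
        by (subst ennreal_mult[symmetric]) (auto intro: ennreal_leI)
    qed
    show "(\<integral>\<^sup>+\<omega>. ennreal 4 * ennreal ((norm (N \<omega>))\<^sup>2) \<partial>M) < \<infinity>"
      using m nn_integral_norm_N_finite by (simp add: nn_integral_cmult ennreal_mult_less_top)
    show "AE \<omega> in M. (\<lambda>n. ennreal ((norm (S (s n) (N \<omega>) - N \<omega>))\<^sup>2)) \<longlonglongrightarrow> 0"
    proof (rule AE_I2)
      fix \<omega>
      have "(\<lambda>n. S (s n) (N \<omega>)) \<longlonglongrightarrow> N \<omega>" by (rule filterlim_compose[OF S_tendsto_0 dr])
      then have "(\<lambda>n. (norm (S (s n) (N \<omega>) - N \<omega>))\<^sup>2) \<longlonglongrightarrow> (norm (N \<omega> - N \<omega>))\<^sup>2"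
        by (intro tendsto_intros)
      then show "(\<lambda>n. ennreal ((norm (S (s n) (N \<omega>) - N \<omega>))\<^sup>2)) \<longlonglongrightarrow> 0"
        using tendsto_ennrealI by fastforce
    qed
  qed simp
  then show "(\<lambda>n. \<integral>\<^sup>+\<omega>. ennreal ((norm (S (s n) (N \<omega>) - N \<omega>))\<^sup>2) \<partial>M) \<longlonglongrightarrow> 0" by simp
qed simp

lemma modulus_tendsto_0:
  assumes d: "\<And>k. d k > 0" "d \<longlonglongrightarrow> 0"
  shows "(\<lambda>k. modulus (d k)) \<longlonglongrightarrow> 0"
proof (rule order_tendstoI)
  fix a :: ennreal assume "0 < a"
  \<comment> \<open>A second level below a is needed, since a supremum of values below b is only
    known to be at most b.\<close>
  then obtain b where b: "0 < b" "b < a" using dense by blast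
  have "\<forall>\<^sub>F s in at_right 0. (\<integral>\<^sup>+\<omega>. ennreal ((norm (S s (N \<omega>) - N \<omega>))\<^sup>2) \<partial>M) < b"
    by (rule order_tendstoD(2)[OF mean_square_S_N_tendsto_0 b(1)])
  then obtain \<delta> where \<delta>: "\<delta> > 0"
    "\<And>s. 0 < s \<Longrightarrow> s < \<delta> \<Longrightarrow> (\<integral>\<^sup>+\<omega>. ennreal ((norm (S s (N \<omega>) - N \<omega>))\<^sup>2) \<partial>M) < b"
    unfolding eventually_at_right_field by auto
  have "\<forall>\<^sub>F k in sequentially. d k < \<delta>" by (rule order_tendstoD(2)[OF d(2) \<delta>(1)])
  then show "\<forall>\<^sub>F k in sequentially. modulus (d k) < a"
  proof eventually_elim
    case (elim k)
    have "modulus (d k) \<le> b"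
      unfolding modulus_def
    proof (rule SUP_least)
      fix s assume s: "s \<in> {0..d k}"
      show "(\<integral>\<^sup>+\<omega>. ennreal ((norm (S s (N \<omega>) - N \<omega>))\<^sup>2) \<partial>M) \<le> b"
      proof (cases "s = 0")
        case False
        then show ?thesis using s elim by (intro less_imp_le \<delta>) auto
      qed simp
    qed
    then show ?case using b(2) by simp
  qed
qed simp

section \<open>The increment of the convolution compared with that of the Wiener process\<close>

definition remainder :: "real \<Rightarrow> nat \<Rightarrow> 'w \<Rightarrow> 'h" where
  "remainder \<Delta> i \<omega> = Y (real (Suc i) * \<Delta>) \<omega> - Y (real i * \<Delta>) \<omega>
      - (W (real (Suc i) * \<Delta>) \<omega> - W (real i * \<Delta>) \<omega>)"

lemma Y_measurable:
  assumes "t \<ge> 0" shows "(\<lambda>\<omega>. inner (Y t \<omega>) h) \<in> borel_measurable M"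
proof -
  have "Y t \<in> borel_measurable M"
    using conv assms unfolding stochastic_convolution_def by blast
  then show ?thesis by (rule measurable_compose[OF _ borel_measurable_inner_const])
qed

lemma remainder_measurable:
  assumes "\<Delta> \<ge> 0" shows "(\<lambda>\<omega>. inner (remainder \<Delta> i \<omega>) h) \<in> borel_measurable M"
proof -
  have "(\<lambda>\<omega>. inner (W (real (Suc i) * \<Delta>) \<omega> - W (real i * \<Delta>) \<omega>) h) \<in> borel_measurable M"
    using assms by (intro dW_measurable) (auto intro: mult_right_mono)
  moreover have "(\<lambda>\<omega>. inner (Y (real (Suc i) * \<Delta>) \<omega>) h) \<in> borel_measurable M"
    "(\<lambda>\<omega>. inner (Y (real i * \<Delta>) \<omega>) h) \<in> borel_measurable M"
    using assms by (auto intro!: Y_measurable)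
  ultimately show ?thesis
    unfolding remainder_def inner_diff_left[of "_ - _" "_ - _"] inner_diff_left[of "Y _ _"] by measurable
qed

text \<open>Refining \<open>[0, i\<Delta>]\<close> into \<open>i p\<close> cells makes the partitions for all \<open>i\<close> aligned, with mesh \<open>\<Delta>/p\<close>.\<close>
lemma riemann_conv_sum_aligned:
  assumes p: "p > 0"
  shows "riemann_conv_sum S W (i * p) (real i * \<Delta>) \<omega>
    = (\<Sum>j<i * p. S (real i * \<Delta> - real j * \<Delta> / real p)
        (W (real (Suc j) * \<Delta> / real p) \<omega> - W (real j * \<Delta> / real p) \<omega>))"
proof (cases "i = 0")
  case False
  then have "x * (real i * \<Delta>) / real (i * p) = x * \<Delta> / real p" for x by simp
  then show ?thesis unfolding riemann_conv_sum_def by simp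
qed (simp add: riemann_conv_sum_def)

lemma aligned_L2_limit:
  assumes D: "\<Delta> \<ge> 0"
  shows "(\<lambda>m. \<integral>\<^sup>+\<omega>. ennreal ((norm (Y (real i * \<Delta>) \<omega>
      - riemann_conv_sum S W (i * Suc m) (real i * \<Delta>) \<omega>))\<^sup>2) \<partial>M) \<longlonglongrightarrow> 0"
proof -
  have lim: "(\<lambda>n. \<integral>\<^sup>+\<omega>. ennreal ((norm (Y (real i * \<Delta>) \<omega>
      - riemann_conv_sum S W n (real i * \<Delta>) \<omega>))\<^sup>2) \<partial>M) \<longlonglongrightarrow> 0"
    using conv D unfolding stochastic_convolution_def by simp
  show ?thesis
  proof (cases "i = 0")
    \<comment> \<open>For i = 0 the indices i (m + 1) do not form a subsequence. All Riemann sums at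
      time 0 coincide, so the limit statement already says that Y 0 agrees with this common value in
      L^2.\<close>
    case True
    have "riemann_conv_sum S W n 0 \<omega> = riemann_conv_sum S W 0 0 \<omega>" for n \<omega>
      by (simp add: riemann_conv_sum_def)
    then have eq: "(\<integral>\<^sup>+\<omega>. ennreal ((norm (Y 0 \<omega> - riemann_conv_sum S W n 0 \<omega>))\<^sup>2) \<partial>M)
        = (\<integral>\<^sup>+\<omega>. ennreal ((norm (Y 0 \<omega> - riemann_conv_sum S W 0 0 \<omega>))\<^sup>2) \<partial>M)" for n
      by metis
    have "(\<lambda>n. \<integral>\<^sup>+\<omega>. ennreal ((norm (Y 0 \<omega> - riemann_conv_sum S W n 0 \<omega>))\<^sup>2) \<partial>M) \<longlonglongrightarrow> 0"
      using lim True by simp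
    then have "(\<lambda>n::nat. \<integral>\<^sup>+\<omega>. ennreal ((norm (Y 0 \<omega> - riemann_conv_sum S W 0 0 \<omega>))\<^sup>2) \<partial>M) \<longlonglongrightarrow> 0"
      by (subst (asm) eq)
    then show ?thesis using True by simp
  next
    case False
    then have "strict_mono (\<lambda>m. i * Suc m)" by (auto intro!: strict_monoI)
    from LIMSEQ_subseq_LIMSEQ[OF lim this] show ?thesis by (simp add: o_def)
  qed
qed

text \<open>The integrands of the remainder on the common grid: the difference of two semigroup
  operators before time i \<Delta>, and S - I within the current block. The identity beyond the
  range is a default that keeps the operator symmetric for every j, as required for Wiener
  sums.\<close>

definition grid_op :: "real \<Rightarrow> nat \<Rightarrow> nat \<Rightarrow> nat \<Rightarrow> 'h \<Rightarrow> 'h" where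
  "grid_op \<Delta> i p j = (if j < i * p then \<lambda>x. S (real (Suc i) * \<Delta> - real j * \<Delta> / real p) x - S (real i * \<Delta> - real j * \<Delta> / real p) x
     else if j < Suc i * p then \<lambda>x. S (real (Suc i) * \<Delta> - real j * \<Delta> / real p) x - x else (\<lambda>x. x))"

lemma grid_time_le:
  assumes "\<Delta> \<ge> 0" "p > 0" "j \<le> i * p"
  shows "real j * \<Delta> / real p \<le> real i * \<Delta>"
proof -
  have "real j \<le> real i * real p" using assms(3) by (metis of_nat_le_iff of_nat_mult)
  then have "real j * \<Delta> \<le> (real i * real p) * \<Delta>" using assms(1) by (rule mult_right_mono)
  then show ?thesis using assms(2) by (simp add: pos_divide_le_eq mult_ac)
qed

lemma grid_op_symmetric:
  assumes "\<Delta> \<ge> 0" "p > 0"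
  shows "inner (grid_op \<Delta> i p j x) y = inner x (grid_op \<Delta> i p j y)"
proof -
  consider "j < i * p" | "\<not> j < i * p" "j < Suc i * p" | "\<not> j < Suc i * p" by blast
  then show ?thesis
  proof cases
    case 1
    then have "j \<le> Suc i * p" "j \<le> i * p" by auto
    then show ?thesis unfolding grid_op_def using 1 grid_time_le[OF assms, of j]
      by (simp add: S_diff_symmetric del: of_nat_Suc)
  next
    case 2
    then have "j \<le> Suc i * p" by auto
    then show ?thesis unfolding grid_op_def using 2 grid_time_le[OF assms, of j "Suc i"]
      by (simp add: inner_diff_left inner_diff_right S_symmetric del: of_nat_Suc)
  next
    case 3
    then show ?thesis unfolding grid_op_def by auto
  qed
qed

text \<open>On the common grid both Riemann sums run over the same cells, and the Wiener increment
  telescopes over the last p of them, so the three quantities can be subtracted cell by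
  cell.\<close>

lemma aligned_remainder:
  assumes p: "p > 0"
  shows "riemann_conv_sum S W (Suc i * p) (real (Suc i) * \<Delta>) \<omega> - riemann_conv_sum S W (i * p) (real i * \<Delta>) \<omega>
       - (W (real (Suc i) * \<Delta>) \<omega> - W (real i * \<Delta>) \<omega>)
     = (\<Sum>j<Suc i * p. grid_op \<Delta> i p j (W (real (Suc j) * \<Delta> / real p) \<omega> - W (real j * \<Delta> / real p) \<omega>))"
proof -
  define w where "w j = W (real j * \<Delta> / real p) \<omega>" for j
  have ip: "i * p \<le> Suc i * p" by simp
  have split: "(\<Sum>j<Suc i * p. f j) = (\<Sum>j<i * p. f j) + (\<Sum>j\<in>{i * p..<Suc i * p}. f j)" for f :: "nat \<Rightarrow> 'h"
    using sum.union_disjoint[of "{..<i * p}" "{i * p..<Suc i * p}" f]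
    by (simp add: ivl_disj_un_one(2)[OF ip] ivl_disj_int_one del: mult_Suc)
  have "w (Suc i * p) - w (i * p) = (\<Sum>j\<in>{i * p..<Suc i * p}. w (Suc j) - w j)"
    by (rule sum_Suc_diff'[OF ip, symmetric])
  moreover have "w (Suc i * p) = W (real (Suc i) * \<Delta>) \<omega>" "w (i * p) = W (real i * \<Delta>) \<omega>"
    using p by (simp_all add: w_def del: mult_Suc of_nat_Suc)
  ultimately have tel: "W (real (Suc i) * \<Delta>) \<omega> - W (real i * \<Delta>) \<omega> = (\<Sum>j\<in>{i * p..<Suc i * p}. w (Suc j) - w j)"
    by simp
  have "(\<Sum>j<Suc i * p. grid_op \<Delta> i p j (w (Suc j) - w j))
    = (\<Sum>j<i * p. S (real (Suc i) * \<Delta> - real j * \<Delta> / real p) (w (Suc j) - w j)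
                   - S (real i * \<Delta> - real j * \<Delta> / real p) (w (Suc j) - w j))
      + (\<Sum>j\<in>{i * p..<Suc i * p}. S (real (Suc i) * \<Delta> - real j * \<Delta> / real p) (w (Suc j) - w j) - (w (Suc j) - w j))"
    unfolding split by (intro arg_cong2[where f = "(+)"] sum.cong) (auto simp: grid_op_def)
  also have "\<dots> = (\<Sum>j<Suc i * p. S (real (Suc i) * \<Delta> - real j * \<Delta> / real p) (w (Suc j) - w j))
      - (\<Sum>j<i * p. S (real i * \<Delta> - real j * \<Delta> / real p) (w (Suc j) - w j))
      - (W (real (Suc i) * \<Delta>) \<omega> - W (real i * \<Delta>) \<omega>)"
    unfolding split tel sum_subtractf by simp
  finally show ?thesis
    unfolding riemann_conv_sum_aligned[OF p] w_def by (rule sym)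
qed

text \<open>Each cell carries weight \<Delta>/p. The cells before time i \<Delta> contribute at most
  p orbit variations in total by the refinement bound, and the p cells of the current block
  contribute at most \<open>modulus\<close> each; p cancels, so the bound does not depend on the
  mesh.\<close>

lemma grid_energy_le:
  assumes D: "\<Delta> \<ge> 0" and p: "p > 0"
  shows "(\<Sum>j<Suc i * p. ennreal (\<Delta> / real p) * (\<integral>\<^sup>+\<omega>. ennreal ((norm (grid_op \<Delta> i p j (N \<omega>)))\<^sup>2) \<partial>M))
     \<le> ennreal \<Delta> * (orbit_mean \<Delta> i + modulus \<Delta>)"
proof -
  let ?E = "\<lambda>j. \<integral>\<^sup>+\<omega>. ennreal ((norm (grid_op \<Delta> i p j (N \<omega>)))\<^sup>2) \<partial>M"
  have ip: "i * p \<le> Suc i * p" by simp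
  have c: "ennreal (\<Delta> / real p) * ennreal (real p) = ennreal \<Delta>"
    using D p by (subst ennreal_mult[symmetric]) auto
  have "(\<Sum>j<i * p. ?E j) \<le> ennreal (real p) * orbit_mean \<Delta> i"
  proof -
    have meas: "(\<lambda>\<omega>. ennreal ((norm (grid_op \<Delta> i p j (N \<omega>)))\<^sup>2)) \<in> borel_measurable M" for j
      using norm_image_N_measurable[of "grid_op \<Delta> i p j", OF grid_op_symmetric[OF D p]] by measurable
    have "(\<Sum>j<i * p. ?E j) = (\<integral>\<^sup>+\<omega>. (\<Sum>j<i * p. ennreal ((norm (grid_op \<Delta> i p j (N \<omega>)))\<^sup>2)) \<partial>M)"
      using meas by (subst nn_integral_sum) auto
    also have "\<dots> \<le> (\<integral>\<^sup>+\<omega>. ennreal (real p) * ennreal (orbit_variation \<Delta> i (N \<omega>)) \<partial>M)"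
    proof (rule nn_integral_mono)
      fix \<omega>
      define f where "f l = (norm (S (\<Delta> + real (Suc l) * \<Delta> / real p) (N \<omega>) - S (real (Suc l) * \<Delta> / real p) (N \<omega>)))\<^sup>2" for l
      \<comment> \<open>Reversing the index turns the time left until i \<Delta> into a whole number
        of cells. Evaluation at left endpoints leaves at least one cell, which accounts for the
        \<open>Suc\<close> in f.\<close>
      have "(norm (grid_op \<Delta> i p j (N \<omega>)))\<^sup>2 = f (i * p - Suc j)" if "j < i * p" for j
      proof -
        have "Suc (i * p - Suc j) = i * p - j" using that by simp
        then have "real (Suc (i * p - Suc j)) = real i * real p - real j" using that by (simp add: of_nat_diff)
        then have 1: "real (Suc (i * p - Suc j)) * \<Delta> / real p = real i * \<Delta> - real j * \<Delta> / real p"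
          using p by (simp add: diff_divide_distrib left_diff_distrib)
        then have 2: "\<Delta> + real (Suc (i * p - Suc j)) * \<Delta> / real p = real (Suc i) * \<Delta> - real j * \<Delta> / real p"
          by (simp add: algebra_simps)
        show ?thesis unfolding f_def 2 unfolding 1 using that by (simp add: grid_op_def)
      qed
      then have "(\<Sum>j<i * p. (norm (grid_op \<Delta> i p j (N \<omega>)))\<^sup>2) = (\<Sum>j<i * p. f (i * p - Suc j))"
        by (intro sum.cong) auto
      also have "\<dots> = (\<Sum>l<i * p. f l)" by (rule sum.nat_diff_reindex)
      also have "\<dots> \<le> real p * orbit_variation \<Delta> i (N \<omega>)"
        unfolding f_def by (rule refined_variation_le[OF D p])
      finally show "(\<Sum>j<i * p. ennreal ((norm (grid_op \<Delta> i p j (N \<omega>)))\<^sup>2)) \<le> ennreal (real p) * ennreal (orbit_variation \<Delta> i (N \<omega>))"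
        by (simp add: orbit_variation_nonneg ennreal_leI flip: ennreal_mult)
    qed
    also have "\<dots> = ennreal (real p) * orbit_mean \<Delta> i"
      unfolding orbit_mean_def using orbit_variation_measurable[OF D N_measurable] by (intro nn_integral_cmult) measurable
    finally show ?thesis .
  qed
  moreover have "(\<Sum>j\<in>{i * p..<Suc i * p}. ?E j) \<le> (\<Sum>j\<in>{i * p..<Suc i * p}. modulus \<Delta>)"
  proof (rule sum_mono)
    fix j assume j: "j \<in> {i * p..<Suc i * p}"
    define s where "s = real (Suc i) * \<Delta> - real j * \<Delta> / real p"
    have "s \<ge> 0" unfolding s_def using grid_time_le[OF D p, of j "Suc i"] j by simp
    moreover have "s \<le> \<Delta>"
    proof -
      have "real i * real p \<le> real j" using j by (metis atLeastLessThan_iff of_nat_le_iff of_nat_mult)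
      then have "real i * \<Delta> \<le> real j * \<Delta> / real p"
        using D p mult_right_mono[of "real i * real p" "real j" \<Delta>] by (simp add: pos_le_divide_eq mult_ac)
      then show ?thesis unfolding s_def by (simp add: algebra_simps)
    qed
    moreover have "grid_op \<Delta> i p j = (\<lambda>x. S s x - x)" using j by (auto simp: grid_op_def s_def)
    ultimately show "?E j \<le> modulus \<Delta>" unfolding modulus_def by (intro SUP_upper2[of s]) auto
  qed
  moreover have "(\<Sum>j\<in>{i * p..<Suc i * p}. modulus \<Delta>) = ennreal (real p) * modulus \<Delta>"
    by (simp add: ennreal_of_nat_eq_real_of_nat)
  moreover have "(\<Sum>j<Suc i * p. ?E j) = (\<Sum>j<i * p. ?E j) + (\<Sum>j\<in>{i * p..<Suc i * p}. ?E j)"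
    using sum.union_disjoint[of "{..<i * p}" "{i * p..<Suc i * p}" ?E]
    by (simp add: ivl_disj_un_one(2)[OF ip] ivl_disj_int_one del: mult_Suc)
  ultimately have "(\<Sum>j<Suc i * p. ?E j) \<le> ennreal (real p) * (orbit_mean \<Delta> i + modulus \<Delta>)"
    by (simp add: distrib_left add_mono del: mult_Suc)
  then have "ennreal (\<Delta> / real p) * (\<Sum>j<Suc i * p. ?E j)
      \<le> ennreal (\<Delta> / real p) * (ennreal (real p) * (orbit_mean \<Delta> i + modulus \<Delta>))"
    by (rule mult_left_mono) simp
  then show ?thesis by (simp only: sum_distrib_left mult.assoc[symmetric] c)
qed

text \<open>The aligned Riemann versions V m are Wiener sums whose fourth moments are bounded
  independently of m, and they converge to the remainder in mean square, so the bound passes to the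
  limit.\<close>

lemma remainder_norm4:
  assumes D: "\<Delta> \<ge> 0"
  shows "(\<integral>\<^sup>+\<omega>. (ennreal ((norm (remainder \<Delta> i \<omega>))\<^sup>2))\<^sup>2 \<partial>M)
    \<le> 3 * (ennreal \<Delta> * (orbit_mean \<Delta> i + modulus \<Delta>))\<^sup>2"
proof -
  define dW where "dW = (\<lambda>\<omega>. W (real (Suc i) * \<Delta>) \<omega> - W (real i * \<Delta>) \<omega>)"
  define C where "C k m = (\<lambda>\<omega>. riemann_conv_sum S W (k * Suc m) (real k * \<Delta>) \<omega>)" for k m
  define V where "V m = (\<lambda>\<omega>. C (Suc i) m \<omega> - C i m \<omega> - dW \<omega>)" for m
  have grid: "real 0 * \<Delta> / real (Suc m) \<ge> 0"
    "\<And>j. real j * \<Delta> / real (Suc m) \<le> real (Suc j) * \<Delta> / real (Suc m)" for m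
    using D by (auto intro!: divide_right_mono mult_right_mono)
  have V: "V m \<omega> = (\<Sum>j<Suc i * Suc m. grid_op \<Delta> i (Suc m) j
      (W (real (Suc j) * \<Delta> / real (Suc m)) \<omega> - W (real j * \<Delta> / real (Suc m)) \<omega>))" for m \<omega>
    unfolding V_def C_def dW_def by (rule aligned_remainder) simp
  have tdiff: "real (Suc j) * \<Delta> / real (Suc m) - real j * \<Delta> / real (Suc m) = \<Delta> / real (Suc m)" for j m
    by (simp add: diff_divide_distrib[symmetric] algebra_simps)
  note wm = wiener_sum_measurable[where \<tau> = "\<lambda>j. real j * \<Delta> / real (Suc m)" for m, OF grid grid_op_symmetric[OF D zero_less_Suc]]
  note wn = wiener_sum_norm4[where \<tau> = "\<lambda>j. real j * \<Delta> / real (Suc m)" for m, OF grid grid_op_symmetric[OF D zero_less_Suc]]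
  have Vm: "(\<lambda>\<omega>. inner (V m \<omega>) h) \<in> borel_measurable M" for m h
    unfolding V by (rule wm)
  have Cm: "(\<lambda>\<omega>. inner (C k m \<omega>) h) \<in> borel_measurable M" for k m h
  proof -
    \<comment> \<open>Past the range the time argument of S can be negative, where nothing is known
      of S; the identity is a symmetric filler.\<close>
    define B where "B j = (if j < k * Suc m then S (real k * \<Delta> - real j * \<Delta> / real (Suc m)) else (\<lambda>x. x))" for j
    have B: "inner (B j x) y = inner x (B j y)" for j x y
      unfolding B_def using grid_time_le[OF D zero_less_Suc[of m], of j k] by (simp add: S_symmetric)
    have "C k m \<omega> = (\<Sum>j<k * Suc m. B j (W (real (Suc j) * \<Delta> / real (Suc m)) \<omega> - W (real j * \<Delta> / real (Suc m)) \<omega>))" for \<omega>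
      unfolding C_def riemann_conv_sum_aligned[OF zero_less_Suc] B_def by (intro sum.cong) auto
    then show ?thesis
      by (simp only: wiener_sum_measurable[where \<tau> = "\<lambda>j. real j * \<Delta> / real (Suc m)", OF grid B])
  qed
  have Ym: "(\<lambda>\<omega>. inner (Y (real k * \<Delta>) \<omega>) h) \<in> borel_measurable M" for k h
    using D by (intro Y_measurable) simp
  have E: "(\<lambda>\<omega>. (norm (Y (real k * \<Delta>) \<omega> - C k m \<omega>))\<^sup>2) \<in> borel_measurable M" for k m
    by (rule measurable_norm_sq) (unfold inner_diff_left, intro borel_measurable_diff Ym Cm)
  show ?thesis
  proof (rule nn_integral_norm4_L2_limit[where V = V])
    show "(\<lambda>\<omega>. inner (remainder \<Delta> i \<omega>) h) \<in> borel_measurable M" for h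
      by (rule remainder_measurable[OF D])
    show "(\<lambda>\<omega>. inner (V m \<omega>) h) \<in> borel_measurable M" for m h by (rule Vm)
    have le: "(\<integral>\<^sup>+\<omega>. ennreal ((norm (remainder \<Delta> i \<omega> - V m \<omega>))\<^sup>2) \<partial>M)
      \<le> 2 * (\<integral>\<^sup>+\<omega>. ennreal ((norm (Y (real (Suc i) * \<Delta>) \<omega> - C (Suc i) m \<omega>))\<^sup>2) \<partial>M)
        + 2 * (\<integral>\<^sup>+\<omega>. ennreal ((norm (Y (real i * \<Delta>) \<omega> - C i m \<omega>))\<^sup>2) \<partial>M)" for m
    proof -
      have "(\<integral>\<^sup>+\<omega>. ennreal ((norm (remainder \<Delta> i \<omega> - V m \<omega>))\<^sup>2) \<partial>M)
        \<le> (\<integral>\<^sup>+\<omega>. 2 * ennreal ((norm (Y (real (Suc i) * \<Delta>) \<omega> - C (Suc i) m \<omega>))\<^sup>2)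
              + 2 * ennreal ((norm (Y (real i * \<Delta>) \<omega> - C i m \<omega>))\<^sup>2) \<partial>M)"
      proof (rule nn_integral_mono)
        fix \<omega>
        have "remainder \<Delta> i \<omega> - V m \<omega> = (Y (real (Suc i) * \<Delta>) \<omega> - C (Suc i) m \<omega>) + (C i m \<omega> - Y (real i * \<Delta>) \<omega>)"
          by (simp add: remainder_def V_def dW_def)
        then have "(norm (remainder \<Delta> i \<omega> - V m \<omega>))\<^sup>2 \<le> 2 * (norm (Y (real (Suc i) * \<Delta>) \<omega> - C (Suc i) m \<omega>))\<^sup>2
            + 2 * (norm (Y (real i * \<Delta>) \<omega> - C i m \<omega>))\<^sup>2"
          using norm_add_sq_le[of "Y (real (Suc i) * \<Delta>) \<omega> - C (Suc i) m \<omega>" "C i m \<omega> - Y (real i * \<Delta>) \<omega>"]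
          by (simp add: norm_minus_commute)
        then have "ennreal ((norm (remainder \<Delta> i \<omega> - V m \<omega>))\<^sup>2)
          \<le> ennreal (2 * (norm (Y (real (Suc i) * \<Delta>) \<omega> - C (Suc i) m \<omega>))\<^sup>2
            + 2 * (norm (Y (real i * \<Delta>) \<omega> - C i m \<omega>))\<^sup>2)" by (rule ennreal_leI)
        also have "\<dots> = 2 * ennreal ((norm (Y (real (Suc i) * \<Delta>) \<omega> - C (Suc i) m \<omega>))\<^sup>2)
              + 2 * ennreal ((norm (Y (real i * \<Delta>) \<omega> - C i m \<omega>))\<^sup>2)"
          by (simp add: ennreal_mult del: of_nat_Suc)
        finally show "ennreal ((norm (remainder \<Delta> i \<omega> - V m \<omega>))\<^sup>2) \<le> \<dots>" .
      qed
      also have "\<dots> = 2 * (\<integral>\<^sup>+\<omega>. ennreal ((norm (Y (real (Suc i) * \<Delta>) \<omega> - C (Suc i) m \<omega>))\<^sup>2) \<partial>M)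
        + 2 * (\<integral>\<^sup>+\<omega>. ennreal ((norm (Y (real i * \<Delta>) \<omega> - C i m \<omega>))\<^sup>2) \<partial>M)"
        using E[of "Suc i" m] E[of i m] by (simp add: nn_integral_add nn_integral_cmult del: of_nat_Suc)
      finally show ?thesis .
    qed
    show "(\<lambda>m. \<integral>\<^sup>+\<omega>. ennreal ((norm (remainder \<Delta> i \<omega> - V m \<omega>))\<^sup>2) \<partial>M) \<longlonglongrightarrow> 0"
    proof (rule tendsto_sandwich[OF _ _ tendsto_const])
      have "(\<lambda>m. 2 * (\<integral>\<^sup>+\<omega>. ennreal ((norm (Y (real (Suc i) * \<Delta>) \<omega> - C (Suc i) m \<omega>))\<^sup>2) \<partial>M)
        + 2 * (\<integral>\<^sup>+\<omega>. ennreal ((norm (Y (real i * \<Delta>) \<omega> - C i m \<omega>))\<^sup>2) \<partial>M)) \<longlonglongrightarrow> 2 * 0 + 2 * 0"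
        unfolding C_def by (intro tendsto_add ennreal_tendsto_cmult aligned_L2_limit[OF D]) auto
      then show "(\<lambda>m. 2 * (\<integral>\<^sup>+\<omega>. ennreal ((norm (Y (real (Suc i) * \<Delta>) \<omega> - C (Suc i) m \<omega>))\<^sup>2) \<partial>M)
        + 2 * (\<integral>\<^sup>+\<omega>. ennreal ((norm (Y (real i * \<Delta>) \<omega> - C i m \<omega>))\<^sup>2) \<partial>M)) \<longlonglongrightarrow> 0" by simp
    qed (use le in auto)
    show "(\<integral>\<^sup>+\<omega>. (ennreal ((norm (V m \<omega>))\<^sup>2))\<^sup>2 \<partial>M) \<le> 3 * (ennreal \<Delta> * (orbit_mean \<Delta> i + modulus \<Delta>))\<^sup>2" for m
      unfolding V
      by (rule order_trans[OF wn], unfold tdiff) (intro mult_left_mono power_mono grid_energy_le[OF D]; simp)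
  qed
qed

end

section \<open>Error of the realized covariation\<close>

lemma (in hilbert_basis) suminf_sum_inner_sq:
  "(\<Sum>k. ennreal (\<Sum>i<n. (inner (v i) (e k))\<^sup>2)) = ennreal (\<Sum>i<n. (norm (v i))\<^sup>2)"
proof -
  have "(\<Sum>k. ennreal (\<Sum>i<n. (inner (v i) (e k))\<^sup>2)) = (\<Sum>k. \<Sum>i<n. ennreal ((inner (v i) (e k))\<^sup>2))"
    by simp
  also have "\<dots> = (\<Sum>i<n. \<Sum>k. ennreal ((inner (v i) (e k))\<^sup>2))"
    by (rule suminf_sum) simp
  finally show ?thesis by (simp add: parseval_ennreal)
qed

lemma sum_product_square_le:
  fixes a b :: "nat \<Rightarrow> real"
  shows "(\<Sum>i<n. a i * b i)\<^sup>2 \<le> (\<Sum>i<n. (a i)\<^sup>2) * (\<Sum>i<n. (b i)\<^sup>2)"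
  using Cauchy_Schwarz_ineq_sum[of a b "{..<n}"] .

lemma sum5_square_le:
  fixes a b c d f :: real
  shows "(a + b + c + d + f)\<^sup>2 \<le> 5 * (a\<^sup>2 + b\<^sup>2 + c\<^sup>2 + d\<^sup>2 + f\<^sup>2)"
proof -
  have "5 * (a\<^sup>2 + b\<^sup>2 + c\<^sup>2 + d\<^sup>2 + f\<^sup>2) - (a + b + c + d + f)\<^sup>2
    = (a-b)\<^sup>2 + (a-c)\<^sup>2 + (a-d)\<^sup>2 + (a-f)\<^sup>2 + (b-c)\<^sup>2 + (b-d)\<^sup>2 + (b-f)\<^sup>2 + (c-d)\<^sup>2 + (c-f)\<^sup>2 + (d-f)\<^sup>2"
    by (simp add: power2_eq_square algebra_simps)
  also have "\<dots> \<ge> 0" by simp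
  finally show ?thesis by linarith
qed

lemma realized_covariation_eq:
  "realized_covariation X id \<Delta> T \<omega> w = (\<Sum>i<nat \<lfloor>T / \<Delta>\<rfloor>.
     inner (X (real (Suc i) * \<Delta>) \<omega> - X (real i * \<Delta>) \<omega>) w
       *\<^sub>R (X (real (Suc i) * \<Delta>) \<omega> - X (real i * \<Delta>) \<omega>))"
proof -
  have "{1..m} = Suc ` {..<m}" for m by (simp add: image_Suc_lessThan)
  then show ?thesis
    unfolding realized_covariation_def outer_def by (simp add: sum.reindex)
qed

text \<open>Every matrix entry has five parts: fluctuation, floor error, two cross terms and the
  square of the perturbation. Cauchy-Schwarz over i bounds the squares of the last three by products
  d k * r l, r k * d l and r k * r l, which factorise when summed over k and l. Young's inequality
  with weight \<epsilon> then separates D from R, so that only their second moments have to be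
  estimated.\<close>

lemma (in hilbert_basis) hs_norm_sq_perturbed_covariation_le:
  fixes \<delta> \<rho> :: "nat \<Rightarrow> 'h" and Q :: "'h \<Rightarrow> 'h" and n :: nat and \<Delta> T \<epsilon> :: real
  assumes Q: "\<And>x y. inner (Q x) y = inner x (Q y)" and T: "T > 0" and \<epsilon>: "\<epsilon> > 0"
  defines "G \<equiv> \<lambda>k l. \<Sum>i<n. inner (\<delta> i) (e k) * inner (\<delta> i) (e l) - \<Delta> * inner (Q (e k)) (e l)"
    and "R \<equiv> \<Sum>i<n. (norm (\<rho> i))\<^sup>2" and "D \<equiv> \<Sum>i<n. (norm (\<delta> i))\<^sup>2"
  shows "hs_norm_sq (\<lambda>w. inverse T *\<^sub>R (\<Sum>i<n. inner (\<delta> i + \<rho> i) w *\<^sub>R (\<delta> i + \<rho> i)) - Q w)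
    \<le> ennreal (5 / T\<^sup>2) * ((\<Sum>k. \<Sum>l. ennreal ((G k l)\<^sup>2))
        + ennreal ((real n * \<Delta> - T)\<^sup>2) * (\<Sum>k. \<Sum>l. ennreal ((inner (Q (e k)) (e l))\<^sup>2))
        + ennreal (\<epsilon> * D\<^sup>2 + (1 / \<epsilon> + 1) * R\<^sup>2))"
proof -
  let ?K = "\<lambda>w. inverse T *\<^sub>R (\<Sum>i<n. inner (\<delta> i + \<rho> i) w *\<^sub>R (\<delta> i + \<rho> i)) - Q w"
  define q where "q k l = inner (Q (e k)) (e l)" for k l
  define d where "d k = (\<Sum>i<n. (inner (\<delta> i) (e k))\<^sup>2)" for k
  define r where "r k = (\<Sum>i<n. (inner (\<rho> i) (e k))\<^sup>2)" for k
  have pos: "d k \<ge> 0" "r k \<ge> 0" "D \<ge> 0" "R \<ge> 0" for k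
    by (simp_all add: d_def r_def D_def R_def sum_nonneg)
  have sym: "inner (?K x) y = inner x (?K y)" for x y
    by (simp add: inner_diff_left inner_diff_right inner_sum_left inner_sum_right Q
        inner_commute[of x] mult.commute)
  have entry: "(inner (?K (e k)) (e l))\<^sup>2 \<le> 5 / T\<^sup>2 * ((G k l)\<^sup>2 + (real n * \<Delta> - T)\<^sup>2 * (q k l)\<^sup>2
      + d k * r l + r k * d l + r k * r l)" for k l
  proof -
    let ?a = "\<lambda>i. inner (\<delta> i) (e k)" and ?b = "\<lambda>i. inner (\<delta> i) (e l)"
      and ?x = "\<lambda>i. inner (\<rho> i) (e k)" and ?y = "\<lambda>i. inner (\<rho> i) (e l)"
    have Ge: "G k l = (\<Sum>i<n. ?a i * ?b i) - real n * \<Delta> * q k l"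
      by (simp add: G_def sum_subtractf q_def)
    have "inner (?K (e k)) (e l) = inverse T * (\<Sum>i<n. (?a i + ?x i) * (?b i + ?y i)) - q k l"
      by (simp add: inner_diff_left inner_sum_left inner_add_left q_def)
    also have "(\<Sum>i<n. (?a i + ?x i) * (?b i + ?y i))
        = (\<Sum>i<n. ?a i * ?b i) + (\<Sum>i<n. ?a i * ?y i) + (\<Sum>i<n. ?x i * ?b i) + (\<Sum>i<n. ?x i * ?y i)"
      by (simp add: algebra_simps sum.distrib)
    \<comment> \<open>G is centred at n \<Delta> <Q e_k, e_l>, while the target is T <Q e_k, e_l>;
      the term with n \<Delta> - T makes up for it.\<close>
    also have "inverse T * \<dots> - q k l = inverse T * (G k l + (real n * \<Delta> - T) * q k l
        + (\<Sum>i<n. ?a i * ?y i) + (\<Sum>i<n. ?x i * ?b i) + (\<Sum>i<n. ?x i * ?y i))"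
      unfolding Ge using T by (simp add: field_simps)
    finally have "(inner (?K (e k)) (e l))\<^sup>2 = (inverse T)\<^sup>2 * (G k l + (real n * \<Delta> - T) * q k l
        + (\<Sum>i<n. ?a i * ?y i) + (\<Sum>i<n. ?x i * ?b i) + (\<Sum>i<n. ?x i * ?y i))\<^sup>2"
      by (simp only: power_mult_distrib)
    also have "\<dots> \<le> (inverse T)\<^sup>2 * (5 * ((G k l)\<^sup>2 + ((real n * \<Delta> - T) * q k l)\<^sup>2
        + (\<Sum>i<n. ?a i * ?y i)\<^sup>2 + (\<Sum>i<n. ?x i * ?b i)\<^sup>2 + (\<Sum>i<n. ?x i * ?y i)\<^sup>2))"
      by (intro mult_left_mono sum5_square_le) simp
    also have "\<dots> \<le> (inverse T)\<^sup>2 * (5 * ((G k l)\<^sup>2 + (real n * \<Delta> - T)\<^sup>2 * (q k l)\<^sup>2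
        + d k * r l + r k * d l + r k * r l))"
      unfolding d_def r_def power_mult_distrib[of "real n * \<Delta> - T"]
      by (intro mult_left_mono add_mono sum_product_square_le order_refl) auto
    also have "\<dots> = 5 / T\<^sup>2 * ((G k l)\<^sup>2 + (real n * \<Delta> - T)\<^sup>2 * (q k l)\<^sup>2
        + d k * r l + r k * d l + r k * r l)" by (simp add: power_inverse divide_inverse)
    finally show ?thesis .
  qed
  have "hs_norm_sq ?K \<le> (\<Sum>k. \<Sum>l. ennreal ((inner (?K (e k)) (e l))\<^sup>2))"
    by (rule hs_norm_sq_le[OF sym])
  also have "\<dots> \<le> (\<Sum>k. \<Sum>l. ennreal (5 / T\<^sup>2) * (ennreal ((G k l)\<^sup>2)
      + ennreal ((real n * \<Delta> - T)\<^sup>2) * ennreal ((q k l)\<^sup>2)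
      + ennreal (d k) * ennreal (r l) + ennreal (r k) * ennreal (d l) + ennreal (r k) * ennreal (r l)))"
  proof (intro suminf_le)
    fix k l
    have "ennreal (5 / T\<^sup>2) * (ennreal ((G k l)\<^sup>2)
      + ennreal ((real n * \<Delta> - T)\<^sup>2) * ennreal ((q k l)\<^sup>2)
      + ennreal (d k) * ennreal (r l) + ennreal (r k) * ennreal (d l) + ennreal (r k) * ennreal (r l))
      = ennreal (5 / T\<^sup>2 * ((G k l)\<^sup>2 + (real n * \<Delta> - T)\<^sup>2 * (q k l)\<^sup>2 + d k * r l + r k * d l + r k * r l))"
    proof -
      have "ennreal (c * (a + x * y + d k * r l + r k * d l + r k * r l))
        = ennreal c * (ennreal a + ennreal x * ennreal y + ennreal (d k) * ennreal (r l)
            + ennreal (r k) * ennreal (d l) + ennreal (r k) * ennreal (r l))"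
        if "c \<ge> 0" "a \<ge> 0" "x \<ge> 0" "y \<ge> 0" for c a x y
        using that pos by (simp add: ennreal_mult)
      from this[of "5 / T\<^sup>2" "(G k l)\<^sup>2" "(real n * \<Delta> - T)\<^sup>2" "(q k l)\<^sup>2"]
      show ?thesis by (simp only: zero_le_power2 divide_nonneg_nonneg zero_le_numeral)
    qed
    then show "ennreal ((inner (?K (e k)) (e l))\<^sup>2) \<le> ennreal (5 / T\<^sup>2) * (ennreal ((G k l)\<^sup>2)
      + ennreal ((real n * \<Delta> - T)\<^sup>2) * ennreal ((q k l)\<^sup>2)
      + ennreal (d k) * ennreal (r l) + ennreal (r k) * ennreal (d l) + ennreal (r k) * ennreal (r l))"
      using entry[of k l] by (simp only: ennreal_leI)
  qed auto
  also have "\<dots> = ennreal (5 / T\<^sup>2) * ((\<Sum>k. \<Sum>l. ennreal ((G k l)\<^sup>2))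
      + ennreal ((real n * \<Delta> - T)\<^sup>2) * (\<Sum>k. \<Sum>l. ennreal ((q k l)\<^sup>2))
      + (\<Sum>k. ennreal (d k)) * (\<Sum>l. ennreal (r l)) + (\<Sum>k. ennreal (r k)) * (\<Sum>l. ennreal (d l))
      + (\<Sum>k. ennreal (r k)) * (\<Sum>l. ennreal (r l)))"
    by (simp add: suminf_add[symmetric])
  also have "(\<Sum>k. ennreal (d k)) = ennreal D" unfolding d_def D_def by (rule suminf_sum_inner_sq)
  also have "(\<Sum>k. ennreal (r k)) = ennreal R" unfolding r_def R_def by (rule suminf_sum_inner_sq)
  also have "ennreal (5 / T\<^sup>2) * ((\<Sum>k. \<Sum>l. ennreal ((G k l)\<^sup>2))
      + ennreal ((real n * \<Delta> - T)\<^sup>2) * (\<Sum>k. \<Sum>l. ennreal ((q k l)\<^sup>2))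
      + ennreal D * ennreal R + ennreal R * ennreal D + ennreal R * ennreal R)
    \<le> ennreal (5 / T\<^sup>2) * ((\<Sum>k. \<Sum>l. ennreal ((G k l)\<^sup>2))
      + ennreal ((real n * \<Delta> - T)\<^sup>2) * (\<Sum>k. \<Sum>l. ennreal ((q k l)\<^sup>2))
      + ennreal (\<epsilon> * D\<^sup>2 + (1 / \<epsilon> + 1) * R\<^sup>2))"
  proof -
    have "2 * (D * R) \<le> \<epsilon> * D\<^sup>2 + 1 / \<epsilon> * R\<^sup>2"
    proof -
      have "0 \<le> (\<epsilon> * D - R)\<^sup>2 / \<epsilon>" using \<epsilon> by simp
      also have "\<dots> = \<epsilon> * D\<^sup>2 + 1 / \<epsilon> * R\<^sup>2 - 2 * (D * R)"
        using \<epsilon> by (simp add: power2_eq_square field_simps)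
      finally show ?thesis by simp
    qed
    then have "D * R + R * D + R * R \<le> \<epsilon> * D\<^sup>2 + (1 / \<epsilon> + 1) * R\<^sup>2"
      by (simp add: power2_eq_square algebra_simps)
    then have "ennreal (D * R + R * D + R * R) \<le> ennreal (\<epsilon> * D\<^sup>2 + (1 / \<epsilon> + 1) * R\<^sup>2)" by (rule ennreal_leI)
    then have "ennreal D * ennreal R + ennreal R * ennreal D + ennreal R * ennreal R
      \<le> ennreal (\<epsilon> * D\<^sup>2 + (1 / \<epsilon> + 1) * R\<^sup>2)"
      using pos by (simp only: ennreal_mult ennreal_plus mult_nonneg_nonneg add_nonneg_nonneg)
    then show ?thesis by (intro mult_left_mono) (simp_all add: add.assoc add_left_mono)
  qed
  finally show ?thesis unfolding q_def .
qed

section \<open>Expected error and passage to the limit\<close>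

context ou_setting
begin

text \<open>Cauchy-Schwarz for the form of Q up to a constant, read off from the variance of a
  product over the unit time interval. Summed over the basis it bounds the squared Hilbert-Schmidt
  norm of Q by 3 times the squared trace.\<close>

lemma inner_Q_sq_le: "(inner (Q g) h)\<^sup>2 \<le> 3 * (inner (Q g) g * inner (Q h) h)"
  using dW_product_moments(5)[of 0 1 g h] by simp

definition trQ :: ennreal where "trQ = (\<Sum>k. ennreal (inner (Q (e k)) (e k)))"

lemma trQ_finite: "trQ < \<infinity>"
  unfolding trQ_def by (rule trace_bounded[OF Q_trace Q_pos])

lemma suminf_Q_entries_le:
  "(\<Sum>k. \<Sum>l. ennreal (c * (inner (Q (e k)) (e k) * inner (Q (e l)) (e l)))) = ennreal c * trQ\<^sup>2" if "c \<ge> 0"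
  using that Q_pos by (simp add: ennreal_mult trQ_def power2_eq_square)

text \<open>The four contributions are the fluctuation, the floor error, \<epsilon> times the second
  moment of the Gaussian sum, and the perturbation. The 8 comes from (2 a + 2 b)^2 \<le> 8 a^2 + 8
  b^2, splitting the perturbation into orbit of X0 and remainder, and 24 is this 8 times the
  Gaussian 3. Since the mean orbit variation grows with the number of steps, its value at n serves
  all i < n, and the n factors \<Delta> add up to at most T.\<close>

lemma nn_integral_realized_covariation_error_le:
  assumes T: "T > 0" and D: "\<Delta> > 0" and \<epsilon>: "\<epsilon> > 0"
    and X0: "\<And>h. (\<lambda>\<omega>. inner (X0 \<omega>) h) \<in> borel_measurable M"
    and X: "\<And>t \<omega>. t \<ge> 0 \<Longrightarrow> \<omega> \<in> space M \<Longrightarrow> X t \<omega> = S t (X0 \<omega>) + Y t \<omega>"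
  defines "n \<equiv> nat \<lfloor>T / \<Delta>\<rfloor>"
  shows "(\<integral>\<^sup>+\<omega>. hs_norm_sq (\<lambda>w. inverse T *\<^sub>R realized_covariation X id \<Delta> T \<omega> w - Q w) \<partial>M)
    \<le> ennreal (5 / T\<^sup>2) * (ennreal (3 * T * \<Delta>) * trQ\<^sup>2 + ennreal (\<Delta>\<^sup>2) * (3 * trQ\<^sup>2)
       + ennreal \<epsilon> * (3 * (ennreal T * trQ)\<^sup>2)
       + ennreal (1 / \<epsilon> + 1) * (8 * (\<integral>\<^sup>+\<omega>. (ennreal (orbit_variation \<Delta> n (X0 \<omega>)))\<^sup>2 \<partial>M)
           + 24 * (ennreal T * (orbit_mean \<Delta> n + modulus \<Delta>))\<^sup>2))"
proof -
  have D0: "\<Delta> \<ge> 0" using D by simp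
  have fl: "real n = of_int \<lfloor>T / \<Delta>\<rfloor>" unfolding n_def using T D by simp
  have "real n \<le> T / \<Delta>" unfolding fl by (rule of_int_floor_le)
  then have nT: "real n * \<Delta> \<le> T" using D by (simp only: pos_le_divide_eq)
  have "T / \<Delta> < real n + 1" unfolding fl by linarith
  then have "T < real n * \<Delta> + \<Delta>" using D by (simp add: pos_divide_less_eq algebra_simps)
  then have "\<bar>real n * \<Delta> - T\<bar> \<le> \<bar>\<Delta>\<bar>" using nT by simp
  then have nT2: "(real n * \<Delta> - T)\<^sup>2 \<le> \<Delta>\<^sup>2" by (simp add: abs_le_square_iff)
  have enT: "(\<Sum>i<n. ennreal \<Delta> * x) \<le> ennreal T * x" for x
  proof -
    have "(\<Sum>i<n. ennreal \<Delta> * x) = ennreal (real n * \<Delta>) * x"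
      using D by (simp add: ennreal_mult ennreal_of_nat_eq_real_of_nat mult.assoc)
    also have "\<dots> \<le> ennreal T * x" using nT by (intro mult_right_mono ennreal_leI) auto
    finally show ?thesis .
  qed
  define \<delta> where "\<delta> i \<omega> = W (real (Suc i) * \<Delta>) \<omega> - W (real i * \<Delta>) \<omega>" for i \<omega>
  define x where "x i \<omega> = S (real (Suc i) * \<Delta>) (X0 \<omega>) - S (real i * \<Delta>) (X0 \<omega>)" for i \<omega>
  define \<rho> where "\<rho> i \<omega> = x i \<omega> + remainder \<Delta> i \<omega>" for i \<omega>
  define G where "G k l \<omega> = (\<Sum>i<n. inner (\<delta> i \<omega>) (e k) * inner (\<delta> i \<omega>) (e l) - \<Delta> * inner (Q (e k)) (e l))" for k l \<omega>
  define R where "R \<omega> = (\<Sum>i<n. (norm (\<rho> i \<omega>))\<^sup>2)" for \<omega>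
  define DD where "DD \<omega> = (\<Sum>i<n. (norm (\<delta> i \<omega>))\<^sup>2)" for \<omega>
  define r where "r \<omega> = (\<Sum>i<n. (norm (remainder \<Delta> i \<omega>))\<^sup>2)" for \<omega>
  have st: "0 \<le> real i * \<Delta>" "real i * \<Delta> \<le> real (Suc i) * \<Delta>" for i
    using D by (auto intro: mult_right_mono)
  have \<delta>m: "(\<lambda>\<omega>. inner (\<delta> i \<omega>) h) \<in> borel_measurable M" for i h
    unfolding \<delta>_def by (rule dW_measurable[OF st])
  note rm = remainder_measurable[OF D0]
  have [measurable]: "DD \<in> borel_measurable M" "r \<in> borel_measurable M"
    unfolding DD_def r_def by (intro borel_measurable_sum measurable_norm_sq \<delta>m rm)+
  have [measurable]: "(\<lambda>\<omega>. orbit_variation \<Delta> n (X0 \<omega>)) \<in> borel_measurable M"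
    by (rule orbit_variation_measurable[OF D0 X0])
  have Gm[measurable]: "G k l \<in> borel_measurable M" for k l
    unfolding G_def \<delta>_def using covariance_fluctuation(1)[OF D0, of "e k" "e l" n] .
  have "S (real (Suc i) * \<Delta>) (X0 \<omega>) = x i \<omega> + S (real i * \<Delta>) (X0 \<omega>)" for i \<omega> by (simp add: x_def)
  then have dX: "X (real (Suc i) * \<Delta>) \<omega> - X (real i * \<Delta>) \<omega> = \<delta> i \<omega> + \<rho> i \<omega>" if "\<omega> \<in> space M" for i \<omega>
    using X[OF st(1)[of i] that] X[OF st(1)[of "Suc i"] that]
    by (simp add: \<delta>_def \<rho>_def remainder_def del: of_nat_Suc)
  have R_le: "R \<omega> \<le> 2 * orbit_variation \<Delta> n (X0 \<omega>) + 2 * r \<omega>" for \<omega>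
    unfolding R_def r_def orbit_variation_def sum_distrib_left sum.distrib[symmetric] \<rho>_def x_def
    by (intro sum_mono norm_add_sq_le)
  have R2: "(R \<omega>)\<^sup>2 \<le> 8 * (orbit_variation \<Delta> n (X0 \<omega>))\<^sup>2 + 8 * (r \<omega>)\<^sup>2" for \<omega>
  proof -
    have "R \<omega> \<ge> 0" by (simp add: R_def sum_nonneg)
    then have "(R \<omega>)\<^sup>2 \<le> (2 * orbit_variation \<Delta> n (X0 \<omega>) + 2 * r \<omega>)\<^sup>2" by (intro power_mono R_le)
    also have "\<dots> \<le> 8 * (orbit_variation \<Delta> n (X0 \<omega>))\<^sup>2 + 8 * (r \<omega>)\<^sup>2"
      using zero_le_power2[of "orbit_variation \<Delta> n (X0 \<omega>) - r \<omega>"] by (simp add: power2_eq_square algebra_simps)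
    finally show ?thesis .
  qed
  have pos: "DD \<omega> \<ge> 0" "r \<omega> \<ge> 0" for \<omega> by (simp_all add: DD_def r_def sum_nonneg)
  have pt: "hs_norm_sq (\<lambda>w. inverse T *\<^sub>R realized_covariation X id \<Delta> T \<omega> w - Q w)
    \<le> ennreal (5 / T\<^sup>2) * ((\<Sum>k. \<Sum>l. ennreal ((G k l \<omega>)\<^sup>2)) + ennreal (\<Delta>\<^sup>2) * (3 * trQ\<^sup>2)
        + ennreal \<epsilon> * (ennreal (DD \<omega>))\<^sup>2
        + ennreal (1 / \<epsilon> + 1) * (8 * (ennreal (orbit_variation \<Delta> n (X0 \<omega>)))\<^sup>2 + 8 * (ennreal (r \<omega>))\<^sup>2))"
    if \<omega>: "\<omega> \<in> space M" for \<omega>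
  proof -
    have "realized_covariation X id \<Delta> T \<omega> = (\<lambda>w. \<Sum>i<n. inner (\<delta> i \<omega> + \<rho> i \<omega>) w *\<^sub>R (\<delta> i \<omega> + \<rho> i \<omega>))"
      unfolding realized_covariation_eq dX[OF \<omega>] n_def ..
    then have "hs_norm_sq (\<lambda>w. inverse T *\<^sub>R realized_covariation X id \<Delta> T \<omega> w - Q w)
      \<le> ennreal (5 / T\<^sup>2) * ((\<Sum>k. \<Sum>l. ennreal ((G k l \<omega>)\<^sup>2))
        + ennreal ((real n * \<Delta> - T)\<^sup>2) * (\<Sum>k. \<Sum>l. ennreal ((inner (Q (e k)) (e l))\<^sup>2))
        + ennreal (\<epsilon> * (DD \<omega>)\<^sup>2 + (1 / \<epsilon> + 1) * (R \<omega>)\<^sup>2))"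
      unfolding G_def DD_def R_def
      using hs_norm_sq_perturbed_covariation_le[OF Q_sym T \<epsilon>,
          where n = n and \<delta> = "\<lambda>i. \<delta> i \<omega>" and \<rho> = "\<lambda>i. \<rho> i \<omega>" and \<Delta> = \<Delta>] by simp
    also have "\<dots> \<le> ennreal (5 / T\<^sup>2) * ((\<Sum>k. \<Sum>l. ennreal ((G k l \<omega>)\<^sup>2))
        + ennreal (\<Delta>\<^sup>2) * (3 * trQ\<^sup>2)
        + (ennreal \<epsilon> * (ennreal (DD \<omega>))\<^sup>2
          + ennreal (1 / \<epsilon> + 1) * (8 * (ennreal (orbit_variation \<Delta> n (X0 \<omega>)))\<^sup>2 + 8 * (ennreal (r \<omega>))\<^sup>2)))"
    proof (intro mult_left_mono add_mono order_refl mult_mono ennreal_leI nT2)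
      have "(\<Sum>k. \<Sum>l. ennreal ((inner (Q (e k)) (e l))\<^sup>2))
        \<le> (\<Sum>k. \<Sum>l. ennreal (3 * (inner (Q (e k)) (e k) * inner (Q (e l)) (e l))))"
        by (intro suminf_le ennreal_leI inner_Q_sq_le) auto
      also have "\<dots> = 3 * trQ\<^sup>2" by (subst suminf_Q_entries_le) auto
      finally show "(\<Sum>k. \<Sum>l. ennreal ((inner (Q (e k)) (e l))\<^sup>2)) \<le> 3 * trQ\<^sup>2" .
      have "ennreal (\<epsilon> * (DD \<omega>)\<^sup>2 + (1 / \<epsilon> + 1) * (R \<omega>)\<^sup>2)
        \<le> ennreal (\<epsilon> * (DD \<omega>)\<^sup>2 + (1 / \<epsilon> + 1) * (8 * (orbit_variation \<Delta> n (X0 \<omega>))\<^sup>2 + 8 * (r \<omega>)\<^sup>2))"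
        using \<epsilon> by (intro ennreal_leI add_mono mult_left_mono R2) auto
      also have "\<dots> = ennreal \<epsilon> * (ennreal (DD \<omega>))\<^sup>2
          + ennreal (1 / \<epsilon> + 1) * (8 * (ennreal (orbit_variation \<Delta> n (X0 \<omega>)))\<^sup>2 + 8 * (ennreal (r \<omega>))\<^sup>2)"
        using \<epsilon> pos orbit_variation_nonneg
        by (simp add: ennreal_mult ennreal_power add_nonneg_nonneg del: ennreal_plus flip: ennreal_numeral)
          (simp add: ennreal_mult ennreal_power)
      finally show "ennreal (\<epsilon> * (DD \<omega>)\<^sup>2 + (1 / \<epsilon> + 1) * (R \<omega>)\<^sup>2) \<le> \<dots>" .
    qed auto
    finally show ?thesis by (simp only: add.assoc)
  qed
  have EG: "(\<integral>\<^sup>+\<omega>. (\<Sum>k. \<Sum>l. ennreal ((G k l \<omega>)\<^sup>2)) \<partial>M) \<le> ennreal (3 * T * \<Delta>) * trQ\<^sup>2"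
  proof -
    have "(\<integral>\<^sup>+\<omega>. (\<Sum>k. \<Sum>l. ennreal ((G k l \<omega>)\<^sup>2)) \<partial>M) = (\<Sum>k. \<Sum>l. \<integral>\<^sup>+\<omega>. ennreal ((G k l \<omega>)\<^sup>2) \<partial>M)"
      by (subst nn_integral_suminf, measurable, subst nn_integral_suminf, measurable)
    also have "\<dots> \<le> (\<Sum>k. \<Sum>l. ennreal ((3 * T * \<Delta>) * (inner (Q (e k)) (e k) * inner (Q (e l)) (e l))))"
    proof (intro suminf_le)
      fix k l
      have "(\<integral>\<^sup>+\<omega>. ennreal ((G k l \<omega>)\<^sup>2) \<partial>M) \<le> ennreal (real n * (3 * \<Delta>\<^sup>2 * (inner (Q (e k)) (e k) * inner (Q (e l)) (e l))))"
        unfolding G_def \<delta>_def by (rule covariance_fluctuation(2)[OF D0])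
      also have "real n * (3 * \<Delta>\<^sup>2 * (inner (Q (e k)) (e k) * inner (Q (e l)) (e l)))
          = (real n * \<Delta>) * (3 * \<Delta> * (inner (Q (e k)) (e k) * inner (Q (e l)) (e l)))"
        by (simp add: power2_eq_square)
      also have "ennreal \<dots> \<le> ennreal (T * (3 * \<Delta> * (inner (Q (e k)) (e k) * inner (Q (e l)) (e l))))"
        using nT D Q_pos by (intro ennreal_leI mult_right_mono) auto
      finally show "(\<integral>\<^sup>+\<omega>. ennreal ((G k l \<omega>)\<^sup>2) \<partial>M)
          \<le> ennreal ((3 * T * \<Delta>) * (inner (Q (e k)) (e k) * inner (Q (e l)) (e l)))"
        by (simp only: mult_ac)
    qed auto
    also have "\<dots> = ennreal (3 * T * \<Delta>) * trQ\<^sup>2" using T D by (intro suminf_Q_entries_le) simp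
    finally show ?thesis .
  qed
  have ED: "(\<integral>\<^sup>+\<omega>. (ennreal (DD \<omega>))\<^sup>2 \<partial>M) \<le> 3 * (ennreal T * trQ)\<^sup>2"
  proof -
    have "(\<integral>\<^sup>+\<omega>. (ennreal (DD \<omega>))\<^sup>2 \<partial>M) = (\<integral>\<^sup>+\<omega>. (\<Sum>i<n. ennreal ((norm (\<delta> i \<omega>))\<^sup>2))\<^sup>2 \<partial>M)"
      by (simp add: DD_def)
    also have "\<dots> \<le> 3 * (\<Sum>i<n. ennreal \<Delta> * trQ)\<^sup>2"
    proof (rule nn_integral_sum_square_le)
      fix i
      show "(\<lambda>\<omega>. ennreal ((norm (\<delta> i \<omega>))\<^sup>2)) \<in> borel_measurable M"
        using measurable_norm_sq[OF \<delta>m] by measurable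
      show "(\<integral>\<^sup>+\<omega>. (ennreal ((norm (\<delta> i \<omega>))\<^sup>2))\<^sup>2 \<partial>M) \<le> 3 * (ennreal \<Delta> * trQ)\<^sup>2"
        using dW_norm4[OF st[of i]] unfolding \<delta>_def nn_integral_norm_N trQ_def by (simp add: algebra_simps)
    qed
    also have "\<dots> \<le> 3 * (ennreal T * trQ)\<^sup>2" by (intro mult_left_mono power_mono enT) auto
    finally show ?thesis .
  qed
  have Er: "(\<integral>\<^sup>+\<omega>. (ennreal (r \<omega>))\<^sup>2 \<partial>M) \<le> 3 * (ennreal T * (orbit_mean \<Delta> n + modulus \<Delta>))\<^sup>2"
  proof -
    have "(\<integral>\<^sup>+\<omega>. (ennreal (r \<omega>))\<^sup>2 \<partial>M) = (\<integral>\<^sup>+\<omega>. (\<Sum>i<n. ennreal ((norm (remainder \<Delta> i \<omega>))\<^sup>2))\<^sup>2 \<partial>M)"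
      by (simp add: r_def)
    also have "\<dots> \<le> 3 * (\<Sum>i<n. ennreal \<Delta> * (orbit_mean \<Delta> n + modulus \<Delta>))\<^sup>2"
    proof (rule nn_integral_sum_square_le)
      show "(\<lambda>\<omega>. ennreal ((norm (remainder \<Delta> i \<omega>))\<^sup>2)) \<in> borel_measurable M" for i
        using measurable_norm_sq[OF rm] by measurable
      show "(\<integral>\<^sup>+\<omega>. (ennreal ((norm (remainder \<Delta> i \<omega>))\<^sup>2))\<^sup>2 \<partial>M)
          \<le> 3 * (ennreal \<Delta> * (orbit_mean \<Delta> n + modulus \<Delta>))\<^sup>2" if "i < n" for i
        by (rule order_trans[OF remainder_norm4[OF D0]])
          (intro mult_left_mono power_mono add_right_mono orbit_mean_mono less_imp_le[OF that]; simp)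
    qed
    also have "\<dots> \<le> 3 * (ennreal T * (orbit_mean \<Delta> n + modulus \<Delta>))\<^sup>2"
      by (intro mult_left_mono power_mono enT) auto
    finally show ?thesis .
  qed
  have "(\<integral>\<^sup>+\<omega>. hs_norm_sq (\<lambda>w. inverse T *\<^sub>R realized_covariation X id \<Delta> T \<omega> w - Q w) \<partial>M)
    \<le> (\<integral>\<^sup>+\<omega>. ennreal (5 / T\<^sup>2) * ((\<Sum>k. \<Sum>l. ennreal ((G k l \<omega>)\<^sup>2)) + ennreal (\<Delta>\<^sup>2) * (3 * trQ\<^sup>2)
        + ennreal \<epsilon> * (ennreal (DD \<omega>))\<^sup>2
        + ennreal (1 / \<epsilon> + 1) * (8 * (ennreal (orbit_variation \<Delta> n (X0 \<omega>)))\<^sup>2 + 8 * (ennreal (r \<omega>))\<^sup>2)) \<partial>M)"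
    \<comment> \<open>Monotonicity asks for no measurability of the left integrand, which is a
      supremum over all finite orthonormal families; from here on only the measurable majorant is
      integrated termwise.\<close>
    by (rule nn_integral_mono) (rule pt)
  also have "\<dots> = ennreal (5 / T\<^sup>2) * ((\<integral>\<^sup>+\<omega>. (\<Sum>k. \<Sum>l. ennreal ((G k l \<omega>)\<^sup>2)) \<partial>M) + ennreal (\<Delta>\<^sup>2) * (3 * trQ\<^sup>2)
        + ennreal \<epsilon> * (\<integral>\<^sup>+\<omega>. (ennreal (DD \<omega>))\<^sup>2 \<partial>M)
        + ennreal (1 / \<epsilon> + 1) * (8 * (\<integral>\<^sup>+\<omega>. (ennreal (orbit_variation \<Delta> n (X0 \<omega>)))\<^sup>2 \<partial>M)
            + 8 * (\<integral>\<^sup>+\<omega>. (ennreal (r \<omega>))\<^sup>2 \<partial>M)))"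
    by (simp add: nn_integral_add nn_integral_cmult emeasure_space_1)
  also have "\<dots> \<le> ennreal (5 / T\<^sup>2) * (ennreal (3 * T * \<Delta>) * trQ\<^sup>2 + ennreal (\<Delta>\<^sup>2) * (3 * trQ\<^sup>2)
       + ennreal \<epsilon> * (3 * (ennreal T * trQ)\<^sup>2)
       + ennreal (1 / \<epsilon> + 1) * (8 * (\<integral>\<^sup>+\<omega>. (ennreal (orbit_variation \<Delta> n (X0 \<omega>)))\<^sup>2 \<partial>M)
           + 8 * (3 * (ennreal T * (orbit_mean \<Delta> n + modulus \<Delta>))\<^sup>2)))"
    by (intro mult_left_mono add_mono order_refl EG ED Er) auto
  finally show ?thesis by (simp add: mult.assoc[symmetric])
qed

end

lemma tendsto_0_power2_ennreal:
  fixes u :: "nat \<Rightarrow> ennreal"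
  assumes u: "u \<longlonglongrightarrow> 0" shows "(\<lambda>k. (u k)\<^sup>2) \<longlonglongrightarrow> 0"
proof (rule tendsto_sandwich[OF _ _ tendsto_const u])
  have "\<forall>\<^sub>F k in sequentially. u k < 1" by (rule order_tendstoD(2)[OF u]) simp
  then show "\<forall>\<^sub>F k in sequentially. (u k)\<^sup>2 \<le> u k"
  proof eventually_elim
    case (elim k)
    then have "u k * u k \<le> u k * 1" by (intro mult_left_mono) auto
    then show ?case by (simp add: power2_eq_square)
  qed
qed simp

context ou_setting
begin

text \<open>Dominated convergence for the squared variation: its majorant is |X0|^4, so this is
  where the fourth moment of the initial value enters.\<close>

lemma orbit_variation_X0_tendsto_0:
  assumes d: "\<And>k. d k > 0" "d \<longlonglongrightarrow> 0" and n: "\<And>k. real (n k) * d k \<le> T"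
    and X0: "\<And>h. (\<lambda>\<omega>. inner (X0 \<omega>) h) \<in> borel_measurable M"
    and X04: "(\<integral>\<^sup>+\<omega>. ennreal ((norm (X0 \<omega>)) ^ 4) \<partial>M) < \<infinity>"
  shows "(\<lambda>k. \<integral>\<^sup>+\<omega>. (ennreal (orbit_variation (d k) (n k) (X0 \<omega>)))\<^sup>2 \<partial>M) \<longlonglongrightarrow> 0"
proof -
  have [measurable]: "(\<lambda>\<omega>. (norm (X0 \<omega>))\<^sup>2) \<in> borel_measurable M" by (rule measurable_norm_sq[OF X0])
  have [measurable]: "(\<lambda>\<omega>. orbit_variation (d k) (n k) (X0 \<omega>)) \<in> borel_measurable M" for k
    by (rule orbit_variation_measurable[OF less_imp_le[OF d(1)] X0])
  have sq: "(ennreal ((norm (X0 \<omega>))\<^sup>2))\<^sup>2 = ennreal ((norm (X0 \<omega>)) ^ 4)" for \<omega>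
    by (simp add: ennreal_power flip: power_mult)
  have "(\<lambda>k. \<integral>\<^sup>+\<omega>. (ennreal (orbit_variation (d k) (n k) (X0 \<omega>)))\<^sup>2 \<partial>M) \<longlonglongrightarrow> (\<integral>\<^sup>+\<omega>. 0 \<partial>M)"
  proof (rule nn_integral_dominated_convergence[where w = "\<lambda>\<omega>. (ennreal ((norm (X0 \<omega>))\<^sup>2))\<^sup>2"])
    show "AE \<omega> in M. (ennreal (orbit_variation (d k) (n k) (X0 \<omega>)))\<^sup>2 \<le> (ennreal ((norm (X0 \<omega>))\<^sup>2))\<^sup>2" for k
      using orbit_variation_le[OF less_imp_le[OF d(1)]] by (intro AE_I2 power_mono ennreal_leI) auto
    show "(\<integral>\<^sup>+\<omega>. (ennreal ((norm (X0 \<omega>))\<^sup>2))\<^sup>2 \<partial>M) < \<infinity>" unfolding sq by (rule X04)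
    show "AE \<omega> in M. (\<lambda>k. (ennreal (orbit_variation (d k) (n k) (X0 \<omega>)))\<^sup>2) \<longlonglongrightarrow> 0"
    proof (intro AE_I2 tendsto_0_power2_ennreal)
      fix \<omega>
      have "(\<lambda>k. ennreal (orbit_variation (d k) (n k) (X0 \<omega>))) \<longlonglongrightarrow> ennreal 0"
        by (rule tendsto_ennrealI[OF orbit_variation_tendsto_0[OF d n]])
      then show "(\<lambda>k. ennreal (orbit_variation (d k) (n k) (X0 \<omega>))) \<longlonglongrightarrow> 0" by simp
    qed
  qed measurable
  then show ?thesis by simp
qed

text \<open>The weight in Young's inequality is the square root of a real bound \<open>\<beta>\<close> for the second moment of
  \<open>\<Sum>i. (norm (\<rho> i))\<^sup>2\<close>; adding \<open>\<Delta>\<close> to \<open>\<beta>\<close> keeps it positive.\<close>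
lemma realized_covariation_tendsto:
  assumes T: "T > 0"
    and X0: "\<And>h. (\<lambda>\<omega>. inner (X0 \<omega>) h) \<in> borel_measurable M"
    and X04: "(\<integral>\<^sup>+\<omega>. ennreal ((norm (X0 \<omega>)) ^ 4) \<partial>M) < \<infinity>"
    and X: "\<And>t \<omega>. t \<ge> 0 \<Longrightarrow> \<omega> \<in> space M \<Longrightarrow> X t \<omega> = S t (X0 \<omega>) + Y t \<omega>"
  shows "((\<lambda>\<Delta>. \<integral>\<^sup>+\<omega>. hs_norm_sq (\<lambda>w. inverse T *\<^sub>R realized_covariation X id \<Delta> T \<omega> w - Q w) \<partial>M)
           \<longlongrightarrow> 0) (at_right 0)"
\<comment> \<open>The limit is tested along sequences of step sizes, because dominated convergence
  is sequential.\<close>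
proof (rule tendsto_at_right_sequentially[where b = 1])
  fix d :: "nat \<Rightarrow> real" assume d: "\<And>k. 0 < d k" "d \<longlonglongrightarrow> 0"
  let ?I = "\<lambda>k. \<integral>\<^sup>+\<omega>. hs_norm_sq (\<lambda>w. inverse T *\<^sub>R realized_covariation X id (d k) T \<omega> w - Q w) \<partial>M"
  define n where "n k = nat \<lfloor>T / d k\<rfloor>" for k
  have nT: "real (n k) * d k \<le> T" for k
  proof -
    have "real (n k) = of_int \<lfloor>T / d k\<rfloor>" unfolding n_def using T d(1)[of k] by simp
    then have "real (n k) \<le> T / d k" by (simp only: of_int_floor_le)
    then show ?thesis using d(1)[of k] by (simp only: pos_le_divide_eq)
  qed
  define b where "b k = 8 * (\<integral>\<^sup>+\<omega>. (ennreal (orbit_variation (d k) (n k) (X0 \<omega>)))\<^sup>2 \<partial>M)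
           + 24 * (ennreal T * (orbit_mean (d k) (n k) + modulus (d k)))\<^sup>2" for k
  have "b \<longlonglongrightarrow> 8 * 0 + 24 * 0"
    unfolding b_def
  proof (intro tendsto_add ennreal_tendsto_cmult orbit_variation_X0_tendsto_0[OF d nT X0 X04] tendsto_0_power2_ennreal)
    have "(\<lambda>k. ennreal T * (orbit_mean (d k) (n k) + modulus (d k))) \<longlonglongrightarrow> ennreal T * (0 + 0)"
      by (intro ennreal_tendsto_cmult tendsto_add orbit_mean_tendsto_0[OF d nT] modulus_tendsto_0[OF d]) simp
    then show "(\<lambda>k. ennreal T * (orbit_mean (d k) (n k) + modulus (d k))) \<longlonglongrightarrow> 0" by simp
  qed auto
  then have b0: "b \<longlonglongrightarrow> 0" by simp
  \<comment> \<open>\<open>enn2real\<close> sends infinity to 0, so \<beta> k dominates b k only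
    where b k is finite, which holds eventually.\<close>
  have bfin: "\<forall>\<^sub>F k in sequentially. b k < \<top>" by (rule order_tendstoD(2)[OF b0]) simp
  define \<beta> where "\<beta> k = enn2real (b k) + d k" for k
  have \<beta>pos: "\<beta> k > 0" for k unfolding \<beta>_def using d(1)[of k] enn2real_nonneg[of "b k"] by linarith
  have "(\<lambda>k. enn2real (b k)) \<longlonglongrightarrow> 0" by (rule tendsto_enn2real) (use b0 in simp_all)
  then have \<beta>0: "\<beta> \<longlonglongrightarrow> 0" unfolding \<beta>_def using tendsto_add[OF _ d(2), of _ 0] by simp
  have tr2: "trQ\<^sup>2 < \<top>" and Ttr: "(ennreal T * trQ)\<^sup>2 < \<top>"
    using trQ_finite by (simp_all add: power2_eq_square ennreal_mult_less_top)
  define B where "B k = ennreal (5 / T\<^sup>2) * (trQ\<^sup>2 * ennreal (3 * T * d k) + 3 * trQ\<^sup>2 * ennreal ((d k)\<^sup>2)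
       + 3 * (ennreal T * trQ)\<^sup>2 * ennreal (sqrt (\<beta> k)) + ennreal (sqrt (\<beta> k) + \<beta> k))" for k
  have "B \<longlonglongrightarrow> ennreal (5 / T\<^sup>2) * (trQ\<^sup>2 * ennreal (3 * T * 0) + 3 * trQ\<^sup>2 * ennreal (0\<^sup>2)
       + 3 * (ennreal T * trQ)\<^sup>2 * ennreal (sqrt 0) + ennreal (sqrt 0 + 0))"
    unfolding B_def
    by (intro ennreal_tendsto_cmult tendsto_add tendsto_ennrealI tendsto_power tendsto_mult_left tendsto_real_sqrt d(2) \<beta>0)
      (use tr2 Ttr in \<open>simp_all add: ennreal_mult_less_top\<close>)
  then have B0: "B \<longlonglongrightarrow> 0" by simp
  have "\<forall>\<^sub>F k in sequentially. ?I k \<le> B k"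
    using bfin
  proof eventually_elim
    case (elim k)
    have sp: "sqrt (\<beta> k) > 0" using \<beta>pos by simp
    have "b k = ennreal (enn2real (b k))" using elim by simp
    also have "\<dots> \<le> ennreal (\<beta> k)" unfolding \<beta>_def using d(1)[of k] by (intro ennreal_leI) simp
    finally have bb: "b k \<le> ennreal (\<beta> k)" .
    have "(1 / sqrt (\<beta> k) + 1) * \<beta> k = sqrt (\<beta> k) + \<beta> k"
      using \<beta>pos[of k] by (simp add: distrib_right real_div_sqrt)
    then have young: "ennreal (1 / sqrt (\<beta> k) + 1) * ennreal (\<beta> k) = ennreal (sqrt (\<beta> k) + \<beta> k)"
      using \<beta>pos[of k] sp by (subst ennreal_mult[symmetric]) auto
    have "?I k \<le> ennreal (5 / T\<^sup>2) * (ennreal (3 * T * d k) * trQ\<^sup>2 + ennreal ((d k)\<^sup>2) * (3 * trQ\<^sup>2)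
       + ennreal (sqrt (\<beta> k)) * (3 * (ennreal T * trQ)\<^sup>2) + ennreal (1 / sqrt (\<beta> k) + 1) * b k)"
      unfolding b_def n_def by (rule nn_integral_realized_covariation_error_le[OF T d(1) sp X0 X])
    also have "\<dots> \<le> ennreal (5 / T\<^sup>2) * (ennreal (3 * T * d k) * trQ\<^sup>2 + ennreal ((d k)\<^sup>2) * (3 * trQ\<^sup>2)
       + ennreal (sqrt (\<beta> k)) * (3 * (ennreal T * trQ)\<^sup>2) + ennreal (1 / sqrt (\<beta> k) + 1) * ennreal (\<beta> k))"
      by (intro mult_left_mono add_left_mono bb) auto
    also have "\<dots> = B k" unfolding young B_def by (simp only: mult.commute)
    finally show ?case .
  qed
  then show "?I \<longlonglongrightarrow> 0" by (intro tendsto_sandwich[OF _ _ tendsto_const B0]) auto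
qed simp

end

theorem mainTheorem1:
  fixes M :: "'w measure"
    and F :: "real \<Rightarrow> 'w set set"
    and Q :: "'h::{real_inner, complete_space} \<Rightarrow> 'h"
    and W :: "real \<Rightarrow> 'w \<Rightarrow> 'h"
    and DA :: "'h set" and A :: "'h \<Rightarrow> 'h"
    and S :: "real \<Rightarrow> 'h \<Rightarrow> 'h"
    and X0 :: "'w \<Rightarrow> 'h"
    and Y X :: "real \<Rightarrow> 'w \<Rightarrow> 'h"
    and T :: real
  assumes "complete_prob_space M"
    and "normal_filtration M F"
    and "bounded_linear Q" and "\<forall>x y. inner (Q x) y = inner x (Q y)"
    and "\<forall>x. inner (Q x) x \<ge> 0" and "trace_class Q"
    and "Q_Wiener_process M F Q W"
    and "linear_op DA A" and "closed_op DA A" and "densely_defined DA"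
    and "self_adjoint_op DA A" and "positive_definite_op DA A"
    and "has_compact_inverse DA A"
    and "neg_generates_C0_semigroup DA A S"
    and "measurable_wrt M (F 0) X0"
    and "(\<integral>\<^sup>+\<omega>. ennreal ((norm (X0 \<omega>)) ^ 4) \<partial>M) < \<infinity>"
    and "stochastic_convolution M S W Y"
    and "\<forall>t\<ge>0. \<forall>\<omega>\<in>space M. X t \<omega> = S t (X0 \<omega>) + Y t \<omega>"
    and "T > 0"
  shows "((\<lambda>\<Delta>. \<integral>\<^sup>+\<omega>. hs_norm_sq (\<lambda>w. inverse T *\<^sub>R realized_covariation X id \<Delta> T \<omega> w - Q w) \<partial>M)
           \<longlongrightarrow> 0) (at_right 0)"
proof -
  \<comment> \<open>The compact inverse supplies the separability of H, and with it the countable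
    basis on which all coordinate arguments rest.\<close>
  obtain c :: "nat \<Rightarrow> 'h" where "closure (range c) = UNIV"
    using compact_inverse_imp_separable[OF assms(13,10)] by blast
  then have basis: "hilbert_basis (gram_schmidt c)" by (rule hilbert_basis_exists)
  have sg: "symmetric_semigroup DA A S"
  proof
    show "inner (A x) y = inner x (A y)" if "x \<in> DA" "y \<in> DA" for x y
      using assms(11) that by (simp add: self_adjoint_op_def)
    show "inner (A x) x \<ge> 0" if "x \<in> DA" for x
      using assms(12) that by (cases "x = 0") (auto simp: positive_definite_op_def intro: less_imp_le)
  qed (fact assms)+
  have P: "prob_space M" using assms(1) by (simp add: complete_prob_space_def)
  have wiener: "wiener_setting M (gram_schmidt c) F Q W"
    using P basis assms(2-7) by (simp add: wiener_setting_def wiener_setting_axioms_def)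
  interpret ou_setting DA A S M "gram_schmidt c" F Q W Y
    using sg wiener assms(17) by (simp add: ou_setting_def ou_setting_axioms_def)
  have "X0 \<in> borel_measurable (Ft 0)" using assms(15) by (simp add: measurable_Ft_iff)
  then have "X0 \<in> borel_measurable M" by (rule measurable_Ft_imp[rotated]) simp
  then have "(\<lambda>\<omega>. inner (X0 \<omega>) h) \<in> borel_measurable M" for h
    by (rule measurable_compose[OF _ borel_measurable_inner_const])
  then show ?thesis
    by (rule realized_covariation_tendsto[OF assms(19) _ assms(16)]) (use assms(18) in auto)
qed

end
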